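(* Let $y_0>0$ be given, let $\Omega=\{(x,y): x\in\mathbb{R},\ -y_0\le y\le 0\}$, and let $ds^2=E(y)\,dx^2+dy^2$ be a helicoid metric on $\Omega$: $E(y)>0$, $E'(y)<0$ for $y<0$, and the Gauss curvature of the metric is $K(y)=-k_0E(y)^{a}$ with constants $k_0>0$ and $a\le-2$. Let the initial data $$(u,v)|_{y=-y_0}=(\bar u_0(x),\bar v_0(x)),\qquad x\in\mathbb{R},$$ be such that $\bar u_0+\bar v_0$ and $\bar u_0-\bar v_0$ are bounded on $\mathbb{R}$ and $$\inf_{x\in\mathbb{R}}\left(\bar u_0(x)+\bar v_0(x)\right)>0,\qquad \sup_{x\in\mathbb{R}}\left(\bar u_0(x)-\bar v_0(x)\right)<0 .$$ Then the Gauss-Codazzi system $$\begin{cases} M_x-L_y=\Gamma^2_{22}L-2\Gamma^2_{12}M+\Gamma^2_{11}N,\\ N_x-M_y=-\Gamma^1_{22}L+2\Gamma^1_{12}M-\Gamma^1_{11}N,\\ LN-M^2=K,\end{cases}$$ associated with this metric has a weak solution $(L,M,N)\in L^\infty(\Omega)^3$ in $\Omega$ with this initial data.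
   Context: Metric: it has the form $E\,dx^2+2F\,dx\,dy+G\,dy^2$ with $F\equiv 0$ and $G\equiv1$, where $E=E(y)$ is a $C^{1,1}$ function on an interval containing $[-y_0,0]$. The $\Gamma^k_{ij}$ are its Christoffel symbols, explicitly $$\Gamma^2_{22}=0,\quad \Gamma^2_{12}=0,\quad \Gamma^2_{11}=-\frac{E'}{2},\quad \Gamma^1_{22}=0,\quad \Gamma^1_{12}=\frac{E'}{2E},\quad \Gamma^1_{11}=0.$$ Unknowns: $L=h_{11}/\sqrt{|g|}$, $M=h_{12}/\sqrt{|g|}$, $N=h_{22}/\sqrt{|g|}$, where $h_{11}dx^2+2h_{12}dx\,dy+h_{22}dy^2$ is the second fundamental form and $|g|=EG-F^2$. Subscripts $x,y$ denote partial derivatives; $y$ plays the role of time. Variables $(u,v)$: write $K=-\gamma^2$ with $\gamma>0$, and set $\tilde L=L/\gamma$, $\tilde M=M/\gamma$, $\tilde N=N/\gamma$, and $u=-\tilde M/\tilde L$, $v=1/\tilde L$, so that $\tilde L=1/v$, $\tilde M=-u/v$, $\tilde N=(u^2-v^2)/v$. Thus the initial data $(\bar u_0,\bar v_0)$ (measurable functions on $\mathbb{R}$) prescribe at $y=-y_0$ the values $$L_0(x)=\frac{\gamma(-y_0)}{\bar v_0(x)},\quad M_0(x)=-\frac{\gamma(-y_0)\bar u_0(x)}{\bar v_0(x)},\quad N_0(x)=\frac{\gamma(-y_0)\left(\bar u_0(x)^2-\bar v_0(x)^2\right)}{\bar v_0(x)}.$$ Weak solution with this initial data: $L,M,N\in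 L^\infty(\Omega)$, the equation $LN-M^2=K$ holds almost everywhere in $\Omega$, and the first two equations hold in the sense of distributions with initial data taken in the weak sense, i.e. for every $\phi\in C_c^\infty(\mathbb{R}\times[-y_0,0))$, $$\iint_\Omega\left(-M\phi_x+L\phi_y\right)dx\,dy+\int_{\mathbb{R}}L_0(x)\phi(x,-y_0)\,dx=\iint_\Omega\left(\Gamma^2_{22}L-2\Gamma^2_{12}M+\Gamma^2_{11}N\right)\phi\,dx\,dy,$$ $$\iint_\Omega\left(-N\phi_x+M\phi_y\right)dx\,dy+\int_{\mathbb{R}}M_0(x)\phi(x,-y_0)\,dx=\iint_\Omega\left(-\Gamma^1_{22}L+2\Gamma^1_{12}M-\Gamma^1_{11}N\right)\phi\,dx\,dy.$$ *)

theory Defs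
  imports "HOL-Analysis.Analysis"
begin

definition pd_x :: "(real \<times> real \<Rightarrow> real) \<Rightarrow> real \<times> real \<Rightarrow> real" where
  "pd_x f p = deriv (\<lambda>s. f (s, snd p)) (fst p)"

definition pd_y :: "(real \<times> real \<Rightarrow> real) \<Rightarrow> real \<times> real \<Rightarrow> real" where
  "pd_y f p = deriv (\<lambda>t. f (fst p, t)) (snd p)"

text \<open>
  Christoffel symbols of a general metric \<open>E dx\<^sup>2 + 2 F dx dy + G dy\<^sup>2\<close>.
  The first index is the upper one: \<open>Gamma2_11\<close> is the symbol with upper index 2
  and lower indices 1, 1.
\<close>

definition detg where
  "detg E F G p = E p * G p - (F p)\<^sup>2" for E F G :: "real \<times> real \<Rightarrow> real"

definition Gamma1_11 where
  "Gamma1_11 E F G p =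
     (G p * pd_x E p - 2 * F p * pd_x F p + F p * pd_y E p) / (2 * detg E F G p)"

definition Gamma2_11 where
  "Gamma2_11 E F G p =
     (2 * E p * pd_x F p - E p * pd_y E p - F p * pd_x E p) / (2 * detg E F G p)"

definition Gamma1_12 where
  "Gamma1_12 E F G p = (G p * pd_y E p - F p * pd_x G p) / (2 * detg E F G p)"

definition Gamma2_12 where
  "Gamma2_12 E F G p = (E p * pd_x G p - F p * pd_y E p) / (2 * detg E F G p)"

definition Gamma1_22 where
  "Gamma1_22 E F G p =
     (2 * G p * pd_y F p - G p * pd_x G p - F p * pd_y G p) / (2 * detg E F G p)"

definition Gamma2_22 where
  "Gamma2_22 E F G p =
     (E p * pd_y G p - 2 * F p * pd_y F p + F p * pd_x G p) / (2 * detg E F G p)"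

text \<open>
  Intrinsic Gauss curvature, by the Gauss formula (Theorema Egregium)
  \<open>- E K = (Gamma2_12)_x - (Gamma2_11)_y + Gamma1_12 Gamma2_11 + Gamma2_12\<^sup>2
          - Gamma2_11 Gamma2_22 - Gamma1_11 Gamma2_12\<close>.
\<close>

definition gauss_curvature where
  "gauss_curvature E F G p =
     - (pd_x (Gamma2_12 E F G) p - pd_y (Gamma2_11 E F G) p
        + Gamma1_12 E F G p * Gamma2_11 E F G p + (Gamma2_12 E F G p)\<^sup>2
        - Gamma2_11 E F G p * Gamma2_22 E F G p
        - Gamma1_11 E F G p * Gamma2_12 E F G p) / E p"

text \<open>
  \<open>f\<close> is of class C^{1,1} on the interval \<open>I\<close> with derivative \<open>f'\<close> (one-sided at
  endpoints that belong to \<open>I\<close>). The Lipschitz condition is required on compact subsets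
  only; if \<open>I\<close> is compact this is the global one.
\<close>

definition C11_on :: "real set \<Rightarrow> (real \<Rightarrow> real) \<Rightarrow> (real \<Rightarrow> real) \<Rightarrow> bool" where
  "C11_on I f f' \<longleftrightarrow>
     (\<forall>y\<in>I. (f has_real_derivative f' y) (at y within I)) \<and>
     (\<forall>C. compact C \<and> C \<subseteq> I \<longrightarrow> (\<exists>B. B-lipschitz_on C f'))"

primrec Ck :: "nat \<Rightarrow> (real \<times> real \<Rightarrow> real) \<Rightarrow> bool" where
  "Ck 0 f \<longleftrightarrow> continuous_on UNIV f"
| "Ck (Suc k) f \<longleftrightarrow>
     (\<exists>fx fy. (\<forall>p. (f has_derivative (\<lambda>h. fx p * fst h + fy p * snd h)) (at p)) \<and>
              Ck k fx \<and> Ck k fy)"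

definition Omega :: "real \<Rightarrow> (real \<times> real) set" where
  "Omega y0 = UNIV \<times> {- y0..0}"

text \<open>
  Test functions of class \<open>C_c^\<infinity>\<close> on the half-open strip \<open>UNIV \<times> {- y0..<0}\<close>: smoothness
  up to the edge \<open>y = - y0\<close> means being the restriction of a smooth function on the plane, so
  a test function is represented by such an extension. Its support within the strip is
  compact and stays away from \<open>y = 0\<close> but may meet \<open>y = - y0\<close>; nothing is required of the
  support of the extension outside the strip.
\<close>

definition test_function :: "real \<Rightarrow> (real \<times> real \<Rightarrow> real) \<Rightarrow> bool" where
  "test_function y0 \<phi> \<longleftrightarrow>
     (\<forall>k. Ck k \<phi>) \<and>
     (\<exists>C. compact C \<and> C \<subseteq> UNIV \<times> {- y0..<0} \<and> (\<forall>p \<in> Omega y0 - C. \<phi> p = 0))"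

definition Linfty_on :: "(real \<times> real) set \<Rightarrow> (real \<times> real \<Rightarrow> real) \<Rightarrow> bool" where
  "Linfty_on S f \<longleftrightarrow>
     f \<in> borel_measurable (lebesgue_on S) \<and> (\<exists>B. AE p in lebesgue_on S. \<bar>f p\<bar> \<le> B)"

text \<open>
  Weak solutions of the Gauss-Codazzi system of the metric \<open>(E, F, G)\<close> with Gauss curvature
  \<open>K\<close> on the strip. The initial data enter through \<open>L0\<close> and \<open>M0\<close> only, as
  no \<open>y\<close>-derivative of \<open>N\<close> occurs in the system.
\<close>

definition gauss_codazzi_weak_solution where
  "gauss_codazzi_weak_solution y0 E F G K L0 M0 L M N \<longleftrightarrow>
     Linfty_on (Omega y0) L \<and> Linfty_on (Omega y0) M \<and> Linfty_on (Omega y0) N \<and>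
     (AE p in lebesgue_on (Omega y0). L p * N p - (M p)\<^sup>2 = K p) \<and>
     (\<forall>\<phi>. test_function y0 \<phi> \<longrightarrow>
        (LINT p|lebesgue_on (Omega y0). - M p * pd_x \<phi> p + L p * pd_y \<phi> p)
          + (LINT x|lebesgue. L0 x * \<phi> (x, - y0))
        = (LINT p|lebesgue_on (Omega y0).
             (Gamma2_22 E F G p * L p - 2 * Gamma2_12 E F G p * M p
              + Gamma2_11 E F G p * N p) * \<phi> p) \<and>
        (LINT p|lebesgue_on (Omega y0). - N p * pd_x \<phi> p + M p * pd_y \<phi> p)
          + (LINT x|lebesgue. M0 x * \<phi> (x, - y0))
        = (LINT p|lebesgue_on (Omega y0).
             (- Gamma1_22 E F G p * L p + 2 * Gamma1_12 E F G p * M p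
              - Gamma1_11 E F G p * N p) * \<phi> p))"
  for E F G K L M N :: "real \<times> real \<Rightarrow> real"

text \<open>
  Change of unknowns: with \<open>K = - \<gamma>\<^sup>2\<close> one has \<open>u = - (M/\<gamma>) / (L/\<gamma>)\<close> and \<open>v = 1 / (L/\<gamma>)\<close>.
\<close>

definition L_of_uv :: "real \<Rightarrow> real \<Rightarrow> real \<Rightarrow> real" where
  "L_of_uv \<gamma> u v = \<gamma> / v"

definition M_of_uv :: "real \<Rightarrow> real \<Rightarrow> real \<Rightarrow> real" where
  "M_of_uv \<gamma> u v = - \<gamma> * u / v"

text \<open>
  For \<open>E = E(y)\<close>, \<open>F = 0\<close>, \<open>G = 1\<close> the general formulas reduce to the familiar ones.
\<close>

lemma christoffel_helicoid:
  fixes e :: "real \<Rightarrow> real"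
  assumes "(e has_real_derivative d) (at y)" and "e y > 0"
  defines "E \<equiv> \<lambda>p. e (snd p)" and "F \<equiv> \<lambda>_. 0" and "G \<equiv> \<lambda>_. 1"
  shows "Gamma2_22 E F G (x, y) = 0" "Gamma2_12 E F G (x, y) = 0"
    "Gamma2_11 E F G (x, y) = - d / 2" "Gamma1_22 E F G (x, y) = 0"
    "Gamma1_12 E F G (x, y) = d / (2 * e y)" "Gamma1_11 E F G (x, y) = 0"
  using DERIV_imp_deriv[OF assms(1)] assms(2)
  by (simp_all add: Gamma1_11_def Gamma2_11_def Gamma1_12_def Gamma2_12_def Gamma1_22_def
      Gamma2_22_def detg_def pd_x_def pd_y_def E_def F_def G_def)

lemma gauss_curvature_helicoid:
  fixes e e' :: "real \<Rightarrow> real"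
  assumes "open S" "y \<in> S"
    and "\<And>t. t \<in> S \<Longrightarrow> (e has_real_derivative e' t) (at t)"
    and "\<And>t. t \<in> S \<Longrightarrow> e t > 0"
    and "(e' has_real_derivative d2) (at y)"
  defines "E \<equiv> \<lambda>p. e (snd p)" and "F \<equiv> \<lambda>_. 0" and "G \<equiv> \<lambda>_. 1"
  shows "gauss_curvature E F G (x, y) = - d2 / (2 * e y) + (e' y)\<^sup>2 / (4 * (e y)\<^sup>2)"
proof -
  note ch = christoffel_helicoid[of e, folded E_def F_def G_def]
  have "((\<lambda>t. - e' t / 2) has_real_derivative - d2 / 2) (at y)"
    using assms(5) by (auto intro!: derivative_eq_intros)
  then have "((\<lambda>t. Gamma2_11 E F G (x, t)) has_real_derivative - d2 / 2) (at y)"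
    by (rule has_field_derivative_transform_within_open[OF _ assms(1,2)])
      (simp add: ch(3)[OF assms(3,4)])
  then have 1: "pd_y (Gamma2_11 E F G) (x, y) = - d2 / 2"
    by (simp add: pd_y_def DERIV_imp_deriv)
  have 2: "pd_x (Gamma2_12 E F G) (x, y) = 0"
    using ch(2)[OF assms(3)[OF assms(2)] assms(4)[OF assms(2)]] by (simp add: pd_x_def)
  have 3: "E (x, y) = e y"
    by (simp add: E_def)
  have "e y > 0"
    using assms(2,4) by simp
  then show ?thesis
    unfolding gauss_curvature_def 1 2 3 ch[OF assms(3)[OF assms(2)] assms(4)[OF assms(2)]]
    by (simp add: field_simps power2_eq_square)
qed

end

theory Submission imports Defs begin

text \<open>
  Put \<open>w = u + v > 0 > z = u - v\<close>. The system is linearly degenerate: \<open>w\<close> is transported with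
  speed \<open>z\<close> and \<open>z\<close> with speed \<open>w\<close>, up to source terms. Hence no compactness is needed. In
  characteristic coordinates \<open>(s, t)\<close>, with \<open>x_s = w y_s\<close> and \<open>x_t = z y_t\<close>, the system becomes a
  semilinear one for \<open>w\<close>, \<open>z\<close>, \<open>a = y_s\<close>, \<open>b = y_t\<close> and \<open>y\<close>, in which \<open>w\<close> and \<open>a\<close> are
  differentiated only in \<open>t\<close>, and \<open>z\<close> and \<open>b\<close> only in \<open>s\<close>. Picard iteration solves it for bounded
  measurable data. When the exponent in \<open>K\<close> is at most \<open>- 2\<close>, the quantities \<open>sqrt E w\<close> and \<open>- sqrt E z\<close> stay in a square away
  from \<open>0\<close>, which makes \<open>(s, t) \<mapsto> (x, y)\<close> bi-Lipschitz.

  The forms \<open>L dx + M dy\<close> and \<open>M dx + N dy\<close>, whose exterior derivatives are the Codazzi equations,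
  pull back to \<open>\<gamma> (a ds - b dt)\<close> and \<open>- \<gamma> (w a ds - z b dt)\<close>, so the weak equations follow by
  integrating by parts along coordinate lines. The change of variables formula is obtained from
  Green's theorem on triangles in the same way, without Rademacher's theorem.
\<close>

text \<open>The form of the semilinear system is forced. Let \<open>c\<close> be minus half the
  exponent and \<open>k = - E' / (2 E)\<close>. The first Codazzi equation gives
  \<open>y_st = k (P Q - 2 c) a b\<close>, hence the equal sources of \<open>a\<close> and
  \<open>b\<close>. The second one together with \<open>x_st = x_ts\<close> can be solved for
  \<open>P_t\<close> and \<open>Q_s\<close>, which yields the cubic reaction terms. Conversely,
  these sources make \<open>a ds + b dt\<close> and the corresponding form for \<open>x\<close>
  closed, so that \<open>x\<close> and \<open>y\<close> are recovered as potentials. The obstacle is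
  regularity: for measurable data \<open>P\<close> is Lipschitz only in \<open>t\<close> and
  \<open>Q\<close> only in \<open>s\<close>, so \<open>x\<close> and \<open>y\<close> are merely
  Lipschitz and a chain rule is available along coordinate lines only. Each two-dimensional identity
  is therefore stated for a pair of coefficients, one integrated in each direction, over a triangle
  resting on the antidiagonal. The exponent enters through a sign: on the edge \<open>P = m\<close>
  the reaction term is at least \<open>(c - 1) (Q - m)\<close>, which is nonnegative when
  \<open>1 <= c\<close>.\<close>

section \<open>Locally bounded Borel functions\<close>

text \<open>Borel measurability survives restriction to every single line and composition with
  continuous maps, which almost-everywhere classes do not; local boundedness makes all integrals
  over bounded sets exist.\<close>

definition loc_bdd_measurable :: "('a::euclidean_space \<Rightarrow> 'b::euclidean_space) \<Rightarrow> bool" where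
  "loc_bdd_measurable f \<longleftrightarrow> f \<in> borel_measurable borel \<and> (\<forall>S. bounded S \<longrightarrow> bounded (f ` S))"

lemma loc_bdd_measurableD:
  assumes "loc_bdd_measurable f"
  shows "f \<in> borel_measurable borel" "bounded S \<Longrightarrow> bounded (f ` S)"
  using assms unfolding loc_bdd_measurable_def by auto

lemma loc_bdd_measurable_continuous_compose:
  assumes "loc_bdd_measurable f" "continuous_on UNIV G"
  shows "loc_bdd_measurable (\<lambda>x. G (f x))"
  unfolding loc_bdd_measurable_def
proof (intro conjI allI impI)
  show "(\<lambda>x. G (f x)) \<in> borel_measurable borel"
    using borel_measurable_continuous_on[OF assms(2) loc_bdd_measurableD(1)[OF assms(1)]] .
  fix S :: "'a set" assume "bounded S"
  then have "compact (closure (f ` S))"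
    using loc_bdd_measurableD(2)[OF assms(1)] by (simp add: compact_closure)
  then have "bounded (G ` closure (f ` S))"
    using assms(2) by (meson compact_continuous_image compact_imp_bounded continuous_on_subset subset_UNIV)
  then show "bounded ((\<lambda>x. G (f x)) ` S)"
    by (rule bounded_subset) (use closure_subset in fastforce)
qed

lemma loc_bdd_measurable_continuous:
  "continuous_on UNIV f \<Longrightarrow> loc_bdd_measurable f"
  using loc_bdd_measurable_continuous_compose[of "\<lambda>x. x" f]
  by (simp add: loc_bdd_measurable_def)

lemma loc_bdd_measurable_const [simp]: "loc_bdd_measurable (\<lambda>x. c)"
  by (rule loc_bdd_measurable_continuous) (rule continuous_on_const)

lemma loc_bdd_measurable_compose_continuous:
  assumes "loc_bdd_measurable f" "continuous_on UNIV g"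
  shows "loc_bdd_measurable (\<lambda>x. f (g x))"
  unfolding loc_bdd_measurable_def
proof (intro conjI allI impI)
  show "(\<lambda>x. f (g x)) \<in> borel_measurable borel"
    using loc_bdd_measurableD(1)[OF assms(1)] borel_measurable_continuous_onI[OF assms(2)]
    by measurable
  fix S :: "'c set" assume "bounded S"
  then have "bounded (g ` S)"
    using loc_bdd_measurableD(2)[OF loc_bdd_measurable_continuous[OF assms(2)]] by blast
  then show "bounded ((\<lambda>x. f (g x)) ` S)"
    using loc_bdd_measurableD(2)[OF assms(1)] by (metis image_image)
qed

lemma loc_bdd_measurable_Pair:
  assumes "loc_bdd_measurable f" "loc_bdd_measurable g"
  shows "loc_bdd_measurable (\<lambda>x. (f x, g x))"
  unfolding loc_bdd_measurable_def
proof (intro conjI allI impI)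
  show "(\<lambda>x. (f x, g x)) \<in> borel_measurable borel"
    using assms unfolding loc_bdd_measurable_def by (simp add: borel_measurable_Pair)
  fix S :: "'a set" assume "bounded S"
  then have "bounded (f ` S \<times> g ` S)"
    using assms by (simp add: bounded_Times loc_bdd_measurable_def)
  then show "bounded ((\<lambda>x. (f x, g x)) ` S)"
    by (rule bounded_subset) auto
qed

lemma loc_bdd_measurable_binop:
  assumes "loc_bdd_measurable f" "loc_bdd_measurable g" "continuous_on UNIV (\<lambda>p. op (fst p) (snd p))"
  shows "loc_bdd_measurable (\<lambda>x. op (f x) (g x))"
  using loc_bdd_measurable_continuous_compose[OF loc_bdd_measurable_Pair[OF assms(1,2)] assms(3)] by simp

lemma loc_bdd_measurable_arith:
  fixes f g :: "'a::euclidean_space \<Rightarrow> real"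
  assumes "loc_bdd_measurable f" "loc_bdd_measurable g"
  shows "loc_bdd_measurable (\<lambda>x. f x + g x)" "loc_bdd_measurable (\<lambda>x. f x - g x)"
    "loc_bdd_measurable (\<lambda>x. f x * g x)"
  by (rule loc_bdd_measurable_binop[OF assms]; intro continuous_intros)+

lemma loc_bdd_measurable_inner:
  assumes "loc_bdd_measurable f" "loc_bdd_measurable g"
  shows "loc_bdd_measurable (\<lambda>x. f x \<bullet> g x)"
  by (rule loc_bdd_measurable_binop[OF assms]; intro continuous_intros)+

lemma loc_bdd_measurable_bound:
  assumes "loc_bdd_measurable f" "bounded S"
  obtains B where "B > 0" "\<And>x. x \<in> S \<Longrightarrow> norm (f x) \<le> B"
  using loc_bdd_measurableD(2)[OF assms] unfolding bounded_pos by auto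

lemma loc_bdd_measurable_integrable:
  fixes f :: "'a::euclidean_space \<Rightarrow> 'b::euclidean_space"
  assumes "loc_bdd_measurable f" "bounded S" "S \<in> sets borel"
  shows "set_integrable lborel S f"
proof -
  obtain B where B: "\<And>x. x \<in> S \<Longrightarrow> norm (f x) \<le> B"
    using loc_bdd_measurable_bound[OF assms(1,2)] by blast
  have fin: "emeasure lborel S < \<infinity>"
    using emeasure_bounded_finite[OF assms(2)] by simp
  have "integrable lborel (\<lambda>x. indicator S x *\<^sub>R f x)"
  proof (rule Bochner_Integration.integrable_bound[of _ "\<lambda>x. indicator S x *\<^sub>R (\<bar>B\<bar> + 1)"])
    show "integrable lborel (\<lambda>x. indicator S x *\<^sub>R (\<bar>B\<bar> + 1))"
      using fin assms(3) by (intro integrable_scaleR_left integrable_real_indicator) auto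
    show "(\<lambda>x. indicator S x *\<^sub>R f x) \<in> borel_measurable lborel"
      using assms(3) loc_bdd_measurableD(1)[OF assms(1)] by simp
    show "AE x in lborel. norm (indicator S x *\<^sub>R f x) \<le> norm (indicator S x *\<^sub>R (\<bar>B\<bar> + 1))"
      by (rule AE_I2) (use B in \<open>force simp: indicator_def\<close>)
  qed
  then show ?thesis
    by (simp add: set_integrable_def)
qed

lemma loc_bdd_measurable_has_integral:
  fixes f :: "real \<Rightarrow> 'b::euclidean_space"
  assumes "loc_bdd_measurable f"
  shows "(f has_integral (LINT x:{a..b}|lborel. f x)) {a..b}"
  using set_borel_integral_eq_integral[OF loc_bdd_measurable_integrable[OF assms, of "{a..b}"]]
  by (simp add: has_integral_iff)

section \<open>The chain rule for indefinite integrals of bounded functions\<close>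

lemma lipschitz_of_has_integral:
  fixes X :: "real \<Rightarrow> 'b::euclidean_space"
  assumes int: "\<And>t. r \<le> t \<Longrightarrow> (\<xi> has_integral (X t - X r)) {r..t}"
  shows "r \<le> s \<Longrightarrow> s \<le> t \<Longrightarrow> (\<xi> has_integral (X t - X s)) {s..t}"
    and "r \<le> s \<Longrightarrow> s \<le> t \<Longrightarrow> (\<And>x. x \<in> {s..t} \<Longrightarrow> norm (\<xi> x) \<le> B) \<Longrightarrow>
      norm (X t - X s) \<le> B * (t - s)"
proof -
  show *: "(\<xi> has_integral (X t - X s)) {s..t}" if "r \<le> s" "s \<le> t" for s t
  proof -
    have "\<xi> integrable_on {s..t}"
      using int[of t] that by (meson atLeastatMost_subset_iff has_integral_iff integrable_on_subinterval order_refl order_trans)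
    moreover have "integral {r..s} \<xi> + integral {s..t} \<xi> = integral {r..t} \<xi>"
      using int[of t] that by (intro Henstock_Kurzweil_Integration.integral_combine) auto
    moreover have "integral {r..s} \<xi> = X s - X r" "integral {r..t} \<xi> = X t - X r"
      using int[of s] int[of t] that by (auto simp del: atLeastAtMost_iff)
    ultimately have "integral {s..t} \<xi> = (X t - X r) - (X s - X r)" "\<xi> integrable_on {s..t}"
      by (metis add_diff_cancel_left')+
    then show ?thesis
      by (simp add: has_integral_iff)
  qed
  assume st: "r \<le> s" "s \<le> t" and B: "\<And>x. x \<in> {s..t} \<Longrightarrow> norm (\<xi> x) \<le> B"
  have "0 \<le> B" using B[of s] st order_trans[OF norm_ge_zero] by simp
  then show "norm (X t - X s) \<le> B * (t - s)"
    using has_integral_bound_real[of B "{}" \<xi> "X t - X s" s t] *[OF st] B st by simp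
qed

text \<open>No differentiation theorem for Lebesgue integrals is needed: the difference of the two
  sides is differentiable everywhere with derivative zero.\<close>

lemma chain_rule_has_integral:
  fixes X \<xi> :: "real \<Rightarrow> 'b::euclidean_space" and G :: "'b \<Rightarrow> real"
  assumes int: "\<And>t. r \<le> t \<Longrightarrow> (\<xi> has_integral (X t - X r)) {r..t}"
    and \<xi>: "loc_bdd_measurable \<xi>" and X: "loc_bdd_measurable X"
    and G: "\<And>x. (G has_derivative (\<lambda>h. g x \<bullet> h)) (at x)"
    and g: "continuous_on UNIV g"
    and T: "r \<le> T"
  shows "((\<lambda>t. g (X t) \<bullet> \<xi> t) has_integral (G (X T) - G (X r))) {r..T}"
proof -
  define f where "f = (\<lambda>t. g (X t) \<bullet> \<xi> t)"
  have f: "loc_bdd_measurable f"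
    unfolding f_def by (intro loc_bdd_measurable_inner loc_bdd_measurable_continuous_compose[OF X g] \<xi>)
  define I where "I t = (LINT x:{r..t}|lborel. f x)" for t
  have I: "(f has_integral (I t)) {r..t}" for t
    unfolding I_def by (rule loc_bdd_measurable_has_integral[OF f])
  have Ir: "I r = 0"
    using has_integral_unique[OF I[of r] has_integral_null_real] by simp
  have I2: "(f has_integral (I t - I s)) {s..t}" if "r \<le> s" "s \<le> t" for s t
    using lipschitz_of_has_integral(1)[of r f I] I that Ir by simp
  obtain B where B: "B > 0" "\<And>t. t \<in> {r..T} \<Longrightarrow> norm (\<xi> t) \<le> B"
    using loc_bdd_measurable_bound[OF \<xi> bounded_closed_interval] by blast
  define D where "D t = G (X t) - I t" for t
  have Lip: "norm (X t - X s) \<le> B * \<bar>t - s\<bar>" if "s \<in> {r..T}" "t \<in> {r..T}" for s t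
  proof (cases "s \<le> t")
    case True
    then show ?thesis using lipschitz_of_has_integral(2)[OF int, of s t B] B that by auto
  next
    case False
    then show ?thesis using lipschitz_of_has_integral(2)[OF int, of t s B] B that
      by (auto simp: norm_minus_commute)
  qed
  have der: "(D has_derivative (\<lambda>h. 0)) (at t0 within {r..T})" if t0: "t0 \<in> {r..T}" for t0
  proof -
    have "\<exists>d>0. \<forall>t\<in>{r..T}. norm (t - t0) < d \<longrightarrow> norm (D t - D t0 - 0) \<le> e * norm (t - t0)" if e: "e > 0" for e
    proof -
      \<comment> \<open>Two errors, each at most \<open>e' * B * \<bar>t - t0\<bar>\<close>, have to
        add up to \<open>e * \<bar>t - t0\<bar>\<close>: freezing the coefficient in
        \<open>I\<close>, and linearizing \<open>G\<close> at \<open>X t0\<close>.\<close>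
      define e' where "e' = e / (2 * B)"
      have e': "e' > 0" using e B by (simp add: e'_def)
      obtain d1 where d1: "d1 > 0" "\<And>x. dist x (X t0) < d1 \<Longrightarrow> dist (g x) (g (X t0)) < e'"
        using g e' unfolding continuous_on_iff by (metis UNIV_I)
      obtain d2 where d2: "d2 > 0"
        "\<And>x. norm (x - X t0) < d2 \<Longrightarrow> norm (G x - G (X t0) - g (X t0) \<bullet> (x - X t0)) \<le> e' * norm (x - X t0)"
        using G[of "X t0"] e' unfolding has_derivative_at_alt by blast
      define d where "d = min d1 d2 / B"
      have d: "d > 0" using d1 d2 B by (simp add: d_def)
      have close: "norm (X t - X t0) < d1" "norm (X t - X t0) < d2"
        if "t \<in> {r..T}" "norm (t - t0) < d" for t
      proof -
        have "norm (X t - X t0) \<le> B * \<bar>t - t0\<bar>" using Lip t0 that by blast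
        also have "\<dots> < B * d" using that B by simp
        also have "\<dots> = min d1 d2" using B by (simp add: d_def)
        finally show "norm (X t - X t0) < d1" "norm (X t - X t0) < d2" by auto
      qed
      \<comment> \<open>With the coefficient frozen at \<open>g (X t0)\<close> the integral is
        exactly \<open>g (X t0) \<bullet> (X t - X s)\<close>. The error uses only continuity of
        \<open>g\<close> and boundedness of \<open>\<xi>\<close>, so \<open>\<xi>\<close> may be
        discontinuous.\<close>
      have key: "\<bar>I t - I s - g (X t0) \<bullet> (X t - X s)\<bar> \<le> e' * B * (t - s)"
        if st: "s \<le> t" "s \<in> {r..T}" "t \<in> {r..T}" "norm (t - t0) < d" "norm (s - t0) < d" for s t
      proof -
        have "((\<lambda>\<tau>. g (X t0) \<bullet> \<xi> \<tau>) has_integral (g (X t0) \<bullet> (X t - X s))) {s..t}"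
          using has_integral_linear[OF lipschitz_of_has_integral(1)[OF int, of s t] bounded_linear_inner_right] st
          by (simp add: o_def)
        then have "((\<lambda>\<tau>. f \<tau> - g (X t0) \<bullet> \<xi> \<tau>) has_integral (I t - I s - g (X t0) \<bullet> (X t - X s))) {s..t}"
          using I2[of s t] st by (intro has_integral_diff) auto
        moreover have "norm (f \<tau> - g (X t0) \<bullet> \<xi> \<tau>) \<le> e' * B" if \<tau>: "\<tau> \<in> {s..t}" for \<tau>
        proof -
          have \<tau>': "\<tau> \<in> {r..T}" "norm (\<tau> - t0) < d" using \<tau> st by auto
          have "f \<tau> - g (X t0) \<bullet> \<xi> \<tau> = (g (X \<tau>) - g (X t0)) \<bullet> \<xi> \<tau>"
            by (simp add: f_def inner_diff_left)
          also have "norm \<dots> \<le> norm (g (X \<tau>) - g (X t0)) * norm (\<xi> \<tau>)"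
            using Cauchy_Schwarz_ineq2 by simp
          also have "\<dots> \<le> e' * B"
            using d1(2)[of "X \<tau>"] close(1)[OF \<tau>'] B(2)[OF \<tau>'(1)] e'
            by (intro mult_mono) (auto simp: dist_norm)
          finally show ?thesis .
        qed
        ultimately show ?thesis
          using has_integral_bound_real[of "e' * B" "{}" "\<lambda>\<tau>. f \<tau> - g (X t0) \<bullet> \<xi> \<tau>" _ s t] e' B st by simp
      qed
      have "norm (D t - D t0) \<le> e * norm (t - t0)" if t: "t \<in> {r..T}" "norm (t - t0) < d" for t
      proof -
        have 1: "\<bar>I t - I t0 - g (X t0) \<bullet> (X t - X t0)\<bar> \<le> e' * B * \<bar>t - t0\<bar>"
        proof (cases "t0 \<le> t")
          case True
          then show ?thesis using key[of t0 t] t t0 d by simp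
        next
          case False
          then have "\<bar>I t0 - I t - g (X t0) \<bullet> (X t0 - X t)\<bar> \<le> e' * B * (t0 - t)"
            using key[of t t0] t t0 d by simp
          moreover have "I t - I t0 - g (X t0) \<bullet> (X t - X t0) = - (I t0 - I t - g (X t0) \<bullet> (X t0 - X t))"
            by (simp add: inner_diff_right)
          ultimately show ?thesis using False by simp
        qed
        have "\<bar>G (X t) - G (X t0) - g (X t0) \<bullet> (X t - X t0)\<bar> \<le> e' * norm (X t - X t0)"
          using d2(2)[OF close(2)[OF t]] by simp
        also have "\<dots> \<le> e' * (B * \<bar>t - t0\<bar>)"
          using Lip[OF t0 t(1)] e' by (intro mult_left_mono) auto
        finally have "\<bar>G (X t) - G (X t0) - g (X t0) \<bullet> (X t - X t0)\<bar> \<le> e' * B * \<bar>t - t0\<bar>"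
          by simp
        then have "\<bar>D t - D t0\<bar> \<le> 2 * (e' * B * \<bar>t - t0\<bar>)" using 1 unfolding D_def by linarith
        also have "\<dots> = e * \<bar>t - t0\<bar>" using B by (simp add: e'_def)
        finally show ?thesis by simp
      qed
      then show ?thesis using d by auto
    qed
    then show ?thesis
      unfolding has_derivative_within_alt by simp
  qed
  have "D T = D r"
  proof -
    obtain c where "\<And>x. x \<in> {r..T} \<Longrightarrow> D x = c"
      using has_derivative_zero_constant[of "{r..T}" D] der by (metis convex_real_interval(5))
    then show ?thesis using T by auto
  qed
  then have "I T = G (X T) - G (X r)"
    by (simp add: D_def Ir)
  then show ?thesis
    using I[of T] unfolding f_def by simp
qed

text \<open>After the last time at which \<open>f\<close> is at least \<open>m\<close> the integrand
  is nonnegative, so \<open>f\<close> cannot end up lower than it was at that time.\<close>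

lemma integral_barrier:
  fixes f f' :: "real \<Rightarrow> real"
  assumes int: "\<And>t. r \<le> t \<Longrightarrow> (f' has_integral (f t - f r)) {r..t}"
    and sgn: "\<And>t. r \<le> t \<Longrightarrow> f t < m \<Longrightarrow> 0 \<le> f' t"
    and "m \<le> f r" "r \<le> T"
  shows "m \<le> f T"
proof (rule ccontr)
  assume neg: "\<not> m \<le> f T"
  have "continuous_on {r..T} (\<lambda>t. integral {r..t} f')"
    using int[of T] assms by (intro indefinite_integral_continuous_1) (auto simp: has_integral_iff)
  then have "continuous_on {r..T} (\<lambda>t. f r + integral {r..t} f')"
    by (intro continuous_intros)
  moreover have "f r + integral {r..t} f' = f t" if "t \<in> {r..T}" for t
    using int[of t] that by (auto simp: has_integral_iff)
  ultimately have cont: "continuous_on {r..T} f"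
    using continuous_on_cong[of "{r..T}" "{r..T}" "\<lambda>t. f r + integral {r..t} f'" f] by blast
  define S where "S = {t \<in> {r..T}. m \<le> f t}"
  have "closed S"
    using continuous_closed_preimage[OF cont, of "{m..}"]
    by (simp add: S_def vimage_def Int_def)
  moreover have "r \<in> S" using assms by (simp add: S_def)
  moreover have bS: "bdd_above S" unfolding S_def by (auto intro: bdd_aboveI[of _ T])
  ultimately have "Sup S \<in> S"
    using closed_contains_Sup by blast
  then have S: "Sup S \<in> {r..T}" "m \<le> f (Sup S)" unfolding S_def by auto
  have "0 \<le> f' t" if "t \<in> {Sup S..T} - {Sup S}" for t
  proof -
    have "t \<notin> S" using cSup_upper[OF _ bS, of t] that by auto
    then show ?thesis using sgn[of t] that S by (auto simp: S_def)
  qed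
  \<comment> \<open>At \<open>Sup S\<close> itself \<open>f\<close> is not below \<open>m\<close>,
    so nothing is known about the sign of \<open>f'\<close> there; the value at one point is changed
    to \<open>0\<close>.\<close>
  moreover have "((\<lambda>t. if t = Sup S then 0 else f' t) has_integral (f T - f (Sup S))) {Sup S..T}"
    by (rule has_integral_spike_finite[of "{Sup S}" _ _ f'])
      (use lipschitz_of_has_integral(1)[of r f' f "Sup S" T] int S in auto)
  ultimately have "0 \<le> f T - f (Sup S)"
    by (elim has_integral_nonneg) auto
  then show False using neg S by simp
qed

section \<open>Calculus above the antidiagonal\<close>

text \<open>In the characteristic coordinates \<open>(s, t)\<close> the initial line \<open>y = - y0\<close> is the antidiagonal
  \<open>t = - s\<close>. Solutions are Lipschitz in one coordinate only, so derivatives are replaced by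
  indefinite integrals along the coordinate lines.\<close>

definition has_dt :: "(real \<times> real \<Rightarrow> 'b::euclidean_space) \<Rightarrow> (real \<times> real \<Rightarrow> 'b) \<Rightarrow> bool" where
  "has_dt f f' \<longleftrightarrow> loc_bdd_measurable f \<and> loc_bdd_measurable f' \<and>
     (\<forall>s t. - s \<le> t \<longrightarrow> ((\<lambda>\<tau>. f' (s, \<tau>)) has_integral (f (s, t) - f (s, - s))) {- s..t})"

text \<open>Reflection in the diagonal maps the antidiagonal to itself, so facts about
  \<open>has_dt\<close> transfer without a second proof.\<close>

definition has_ds :: "(real \<times> real \<Rightarrow> 'b::euclidean_space) \<Rightarrow> (real \<times> real \<Rightarrow> 'b) \<Rightarrow> bool" where
  "has_ds f f' \<longleftrightarrow> has_dt (\<lambda>p. f (prod.swap p)) (\<lambda>p. f' (prod.swap p))"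

lemma continuous_on_swap: "continuous_on S (prod.swap :: 'a::topological_space \<times> 'b::topological_space \<Rightarrow> _)"
  unfolding prod.swap_def by (intro continuous_intros)

lemma loc_bdd_measurable_swap:
  fixes f :: "real \<times> real \<Rightarrow> 'b::euclidean_space"
  shows "loc_bdd_measurable (\<lambda>p. f (prod.swap p)) \<longleftrightarrow> loc_bdd_measurable f"
  using loc_bdd_measurable_compose_continuous[of f prod.swap]
    loc_bdd_measurable_compose_continuous[of "\<lambda>p. f (prod.swap p)" prod.swap]
  by (auto simp: continuous_on_swap)

lemma has_dtD:
  assumes "has_dt f f'"
  shows "loc_bdd_measurable f" "loc_bdd_measurable f'"
    "- s \<le> t \<Longrightarrow> ((\<lambda>\<tau>. f' (s, \<tau>)) has_integral (f (s, t) - f (s, - s))) {- s..t}"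
  using assms unfolding has_dt_def by auto

lemma has_dsD:
  assumes "has_ds f f'"
  shows "loc_bdd_measurable f" "loc_bdd_measurable f'"
    "- t \<le> s \<Longrightarrow> ((\<lambda>\<sigma>. f' (\<sigma>, t)) has_integral (f (s, t) - f (- t, t))) {- t..s}"
  using assms unfolding has_ds_def has_dt_def by (auto simp: loc_bdd_measurable_swap)

lemma has_dt_chain:
  assumes f: "has_dt f f'"
    and G: "\<And>x. (G has_derivative (\<lambda>h. g x \<bullet> h)) (at x)" and g: "continuous_on UNIV g"
  shows "has_dt (\<lambda>p. G (f p)) (\<lambda>p. g (f p) \<bullet> f' p :: real)"
proof -
  note f' = has_dtD[OF f]
  have cont: "continuous_on UNIV G"
    using G has_derivative_continuous continuous_at_imp_continuous_on by blast
  have line: "loc_bdd_measurable (\<lambda>\<tau>. h (s, \<tau>))" if "loc_bdd_measurable h" for h :: "real \<times> real \<Rightarrow> 'a" and s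
    by (rule loc_bdd_measurable_compose_continuous[OF that]) (intro continuous_intros)
  show ?thesis
    unfolding has_dt_def
  proof (intro conjI allI impI)
    show "loc_bdd_measurable (\<lambda>p. G (f p))"
      by (rule loc_bdd_measurable_continuous_compose[OF f'(1) cont])
    show "loc_bdd_measurable (\<lambda>p. g (f p) \<bullet> f' p)"
      by (intro loc_bdd_measurable_inner loc_bdd_measurable_continuous_compose[OF f'(1) g] f'(2))
    fix s t :: real assume "- s \<le> t"
    then show "((\<lambda>\<tau>. g (f (s, \<tau>)) \<bullet> f' (s, \<tau>)) has_integral (G (f (s, t)) - G (f (s, - s)))) {- s..t}"
      using chain_rule_has_integral[where X = "\<lambda>\<tau>. f (s, \<tau>)", OF f'(3) line[OF f'(2)] line[OF f'(1)] G g]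
      by simp
  qed
qed

lemma has_integral_Pair:
  fixes f :: "'a::euclidean_space \<Rightarrow> 'b::euclidean_space" and g :: "'a \<Rightarrow> 'c::euclidean_space"
  assumes "(f has_integral i) S" "(g has_integral j) S"
  shows "((\<lambda>x. (f x, g x)) has_integral (i, j)) S"
proof -
  have "bounded_linear (\<lambda>x :: 'b. (x, 0 :: 'c))" "bounded_linear (\<lambda>x :: 'c. (0 :: 'b, x))"
    by (intro bounded_linear_Pair bounded_linear_ident bounded_linear_zero)+
  from has_integral_add[OF has_integral_linear[OF assms(1) this(1)] has_integral_linear[OF assms(2) this(2)]]
  show ?thesis by (simp add: o_def)
qed

lemma has_dt_Pair:
  assumes "has_dt f f'" "has_dt g g'"
  shows "has_dt (\<lambda>p. (f p, g p)) (\<lambda>p. (f' p, g' p))"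
  using assms unfolding has_dt_def by (auto intro!: loc_bdd_measurable_Pair has_integral_Pair)

lemma has_dt_compose2:
  fixes f g :: "real \<times> real \<Rightarrow> real"
  assumes "has_dt f f'" "has_dt g g'"
    and "\<And>p. (G has_derivative (\<lambda>h. gx p * fst h + gy p * snd h)) (at p)"
    and "continuous_on UNIV gx" "continuous_on UNIV gy"
  shows "has_dt (\<lambda>p. G (f p, g p)) (\<lambda>p. gx (f p, g p) * f' p + gy (f p, g p) * g' p)"
  using has_dt_chain[OF has_dt_Pair[OF assms(1,2)], of G "\<lambda>p. (gx p, gy p)"] assms(3-)
  by (auto simp: inner_prod_def intro!: continuous_intros)

lemma has_dt_mult:
  fixes f g :: "real \<times> real \<Rightarrow> real"
  assumes "has_dt f f'" "has_dt g g'"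
  shows "has_dt (\<lambda>p. f p * g p) (\<lambda>p. f' p * g p + f p * g' p)"
proof -
  have D: "((\<lambda>p. fst p * snd p) has_derivative (\<lambda>h. snd p * fst h + fst p * snd h)) (at p)" for p :: "real \<times> real"
    by (auto intro!: derivative_eq_intros)
  show ?thesis
    using has_dt_compose2[OF assms D] by (simp add: mult.commute continuous_on_fst continuous_on_snd)
qed

lemma has_dt_compose:
  fixes f :: "real \<times> real \<Rightarrow> real"
  assumes "has_dt f f'" "\<And>x. (h has_real_derivative h' x) (at x)" "continuous_on UNIV h'"
  shows "has_dt (\<lambda>p. h (f p)) (\<lambda>p. h' (f p) * f' p)"
  using has_dt_chain[OF assms(1), of h h'] assms(2,3)
  by (simp add: has_field_derivative_def)

lemma has_dt_linear:
  fixes f g :: "real \<times> real \<Rightarrow> real"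
  assumes "has_dt f f'" "has_dt g g'"
  shows "has_dt (\<lambda>p. f p + g p) (\<lambda>p. f' p + g' p)" "has_dt (\<lambda>p. f p - g p) (\<lambda>p. f' p - g' p)"
proof -
  have D: "((\<lambda>p. fst p + snd p) has_derivative (\<lambda>h. 1 * fst h + 1 * snd h)) (at p)"
    "((\<lambda>p. fst p - snd p) has_derivative (\<lambda>h. 1 * fst h + - 1 * snd h)) (at p)" for p :: "real \<times> real"
    by (auto intro!: derivative_eq_intros)
  show "has_dt (\<lambda>p. f p + g p) (\<lambda>p. f' p + g' p)"
    using has_dt_compose2[OF assms, of "\<lambda>p. fst p + snd p" "\<lambda>_. 1" "\<lambda>_. 1"] D(1)
    by simp
  show "has_dt (\<lambda>p. f p - g p) (\<lambda>p. f' p - g' p)"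
    using has_dt_compose2[OF assms, of "\<lambda>p. fst p - snd p" "\<lambda>_. 1" "\<lambda>_. - 1"] D(2)
    by simp
qed

lemma has_dt_cmult:
  fixes f :: "real \<times> real \<Rightarrow> real"
  assumes "has_dt f f'"
  shows "has_dt (\<lambda>p. c * f p) (\<lambda>p. c * f' p)"
  by (rule has_dt_compose[OF assms]) (auto intro!: derivative_eq_intros)

lemma has_ds_compose2:
  fixes f g :: "real \<times> real \<Rightarrow> real"
  assumes "has_ds f f'" "has_ds g g'"
    and "\<And>p. (G has_derivative (\<lambda>h. gx p * fst h + gy p * snd h)) (at p)"
    and "continuous_on UNIV gx" "continuous_on UNIV gy"
  shows "has_ds (\<lambda>p. G (f p, g p)) (\<lambda>p. gx (f p, g p) * f' p + gy (f p, g p) * g' p)"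
  using assms unfolding has_ds_def by (rule has_dt_compose2)

lemma has_ds_mult:
  fixes f g :: "real \<times> real \<Rightarrow> real"
  assumes "has_ds f f'" "has_ds g g'"
  shows "has_ds (\<lambda>p. f p * g p) (\<lambda>p. f' p * g p + f p * g' p)"
  using assms unfolding has_ds_def by (rule has_dt_mult)

lemma has_ds_compose:
  fixes f :: "real \<times> real \<Rightarrow> real"
  assumes "has_ds f f'" "\<And>x. (h has_real_derivative h' x) (at x)" "continuous_on UNIV h'"
  shows "has_ds (\<lambda>p. h (f p)) (\<lambda>p. h' (f p) * f' p)"
  using assms unfolding has_ds_def by (rule has_dt_compose)

lemma has_ds_linear:
  fixes f g :: "real \<times> real \<Rightarrow> real"
  assumes "has_ds f f'" "has_ds g g'"
  shows "has_ds (\<lambda>p. f p + g p) (\<lambda>p. f' p + g' p)" "has_ds (\<lambda>p. f p - g p) (\<lambda>p. f' p - g' p)"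
  using assms unfolding has_ds_def by (rule has_dt_linear)+

lemma has_ds_cmult:
  fixes f :: "real \<times> real \<Rightarrow> real"
  assumes "has_ds f f'"
  shows "has_ds (\<lambda>p. c * f p) (\<lambda>p. c * f' p)"
  using assms unfolding has_ds_def by (rule has_dt_cmult)

lemma has_dt_cong:
  assumes "has_dt f f'" "\<And>p. f' p = g' p"
  shows "has_dt f g'"
proof -
  have "f' = g'" using assms(2) by blast
  then show ?thesis using assms(1) by simp
qed

lemma has_ds_cong:
  assumes "has_ds f f'" "\<And>p. f' p = g' p"
  shows "has_ds f g'"
proof -
  have "f' = g'" using assms(2) by blast
  then show ?thesis using assms(1) by simp
qed

text \<open>The limits of integration depend on the point. Written as a condition in the integrand
  they become part of a jointly measurable function, and the parameter integral is
  measurable.\<close>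

lemma borel_measurable_line_integral:
  fixes f :: "real \<times> real \<Rightarrow> 'b::euclidean_space"
  assumes [measurable]: "f \<in> borel_measurable borel"
  shows "(\<lambda>p. LINT \<tau>:{- fst p..snd p}|lborel. f (fst p, \<tau>)) \<in> borel_measurable borel"
proof -
  have [measurable]: "(\<lambda>(p, \<tau>). if - fst p \<le> \<tau> \<and> \<tau> \<le> snd p then f (fst p, \<tau>) else 0)
      \<in> borel_measurable ((borel :: (real \<times> real) measure) \<Otimes>\<^sub>M lborel)"
    unfolding case_prod_beta borel_prod[symmetric] using assms[folded borel_prod] by measurable
  have "(\<lambda>p. LINT \<tau>|lborel. (if - fst p \<le> \<tau> \<and> \<tau> \<le> snd p then f (fst p, \<tau>) else 0)) \<in> borel_measurable borel"
    by (rule lborel.borel_measurable_lebesgue_integral) measurable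
  also have "(\<lambda>p. LINT \<tau>|lborel. (if - fst p \<le> \<tau> \<and> \<tau> \<le> snd p then f (fst p, \<tau>) else 0)) =
      (\<lambda>p. LINT \<tau>:{- fst p..snd p}|lborel. f (fst p, \<tau>))"
    unfolding set_lebesgue_integral_def
    by (intro ext Bochner_Integration.integral_cong) (auto simp: indicator_def)
  finally show ?thesis .
qed

lemma set_integral_interval_bound:
  fixes f :: "real \<Rightarrow> 'b::euclidean_space"
  assumes f: "loc_bdd_measurable f" and B: "0 \<le> B" "\<And>x. x \<in> {a..b} \<Longrightarrow> norm (f x) \<le> B"
  shows "norm (LINT x:{a..b}|lborel. f x) \<le> B * max 0 (b - a)"
  using has_integral_bound_real[OF B(1) finite.emptyI loc_bdd_measurable_has_integral[OF f], of a b] B(2)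
  by (auto simp: max_def split: if_splits)

lemma loc_bdd_measurable_line:
  assumes "loc_bdd_measurable (f :: real \<times> real \<Rightarrow> 'b::euclidean_space)"
  shows "loc_bdd_measurable (\<lambda>\<tau>. f (s, \<tau>))" "loc_bdd_measurable (\<lambda>\<sigma>. f (\<sigma>, t))"
  by (rule loc_bdd_measurable_compose_continuous[OF assms]; intro continuous_intros)+

lemma has_dt_line_integral:
  fixes f :: "real \<times> real \<Rightarrow> 'b::euclidean_space"
  assumes f: "loc_bdd_measurable f"
  shows "has_dt (\<lambda>p. LINT \<tau>:{- fst p..snd p}|lborel. f (fst p, \<tau>)) f"
  unfolding has_dt_def
proof (intro conjI allI impI)
  let ?F = "\<lambda>p. LINT \<tau>:{- fst p..snd p}|lborel. f (fst p, \<tau>)"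
  note line = loc_bdd_measurable_line[OF f]
  show "loc_bdd_measurable ?F"
    unfolding loc_bdd_measurable_def
  proof (intro conjI allI impI)
    show "?F \<in> borel_measurable borel"
      by (rule borel_measurable_line_integral[OF loc_bdd_measurableD(1)[OF f]])
    fix S :: "(real \<times> real) set" assume "bounded S"
    then obtain R where R: "R > 0" "\<And>p. p \<in> S \<Longrightarrow> norm p \<le> R" unfolding bounded_pos by auto
    define C where "C = {- R..R} \<times> {- R..R}"
    have "bounded C" unfolding C_def by (simp add: bounded_Times)
    from loc_bdd_measurable_bound[OF f this] obtain B where B: "B > 0" "\<And>p. p \<in> C \<Longrightarrow> norm (f p) \<le> B" by blast
    have "norm (?F p) \<le> B * (2 * R)" if "p \<in> S" for p
    proof -
      have p: "\<bar>fst p\<bar> \<le> R" "\<bar>snd p\<bar> \<le> R"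
        using R(2)[OF that] norm_fst_le[of "fst p" "snd p"] norm_snd_le[of "snd p" "fst p"] by auto
      have "norm (?F p) \<le> B * max 0 (snd p - - fst p)"
      proof (rule set_integral_interval_bound[OF line(1)])
        fix \<tau> assume "\<tau> \<in> {- fst p..snd p}"
        then have "(fst p, \<tau>) \<in> C" using p by (auto simp: C_def)
        then show "norm (f (fst p, \<tau>)) \<le> B" by (rule B(2))
      qed (use B in simp)
      also have "\<dots> \<le> B * (2 * R)" using B p R by (intro mult_left_mono) auto
      finally show ?thesis .
    qed
    then show "bounded (?F ` S)" unfolding bounded_iff by blast
  qed
  show "loc_bdd_measurable f" by (rule f)
  fix s t :: real assume "- s \<le> t"
  have "(LINT \<tau>:{- s..- s}|lborel. f (s, \<tau>)) = 0"
    by (rule has_integral_unique[OF loc_bdd_measurable_has_integral[OF line(1)] has_integral_null_real]) simp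
  then show "((\<lambda>\<tau>. f (s, \<tau>)) has_integral (?F (s, t) - ?F (s, - s))) {- s..t}"
    using loc_bdd_measurable_has_integral[OF line(1), of s "- s" t] by simp
qed

section \<open>Green's theorem on triangles resting on the antidiagonal\<close>

text \<open>Two sides are coordinate lines and the third lies on the initial line, so an integration
  by parts in one variable leaves one coordinate side and the initial data.\<close>

definition triangle :: "real \<Rightarrow> real \<Rightarrow> (real \<times> real) set" where
  "triangle S T = {p. fst p \<le> S \<and> snd p \<le> T \<and> - fst p \<le> snd p}"

lemma triangle_borel [measurable]: "triangle S T \<in> sets borel"
proof -
  have "closed (triangle S T)"
    unfolding triangle_def by (intro closed_Collect_conj closed_Collect_le continuous_intros)
  then show ?thesis by simp
qed

lemma triangle_bounded: "bounded (triangle S T)"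
proof -
  have "triangle S T \<subseteq> {- T..S} \<times> {- S..T}" unfolding triangle_def by auto
  then show ?thesis by (rule bounded_subset[rotated]) (simp add: bounded_Times)
qed

lemma set_integral_triangle:
  fixes f :: "real \<times> real \<Rightarrow> 'b::euclidean_space"
  assumes f: "loc_bdd_measurable f"
  shows "(LINT p:triangle S T|lborel. f p) = (LINT s:{- T..S}|lborel. LINT t:{- s..T}|lborel. f (s, t))"
proof -
  have int: "integrable (lborel \<Otimes>\<^sub>M lborel) (\<lambda>p. indicator (triangle S T) p *\<^sub>R f p)"
    using loc_bdd_measurable_integrable[OF f triangle_bounded triangle_borel]
    by (simp add: set_integrable_def lborel_prod)
  have "(LINT p:triangle S T|lborel. f p) =
      (LINT s|lborel. LINT t|lborel. indicator (triangle S T) (s, t) *\<^sub>R f (s, t))"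
    using lborel_pair.integral_fst'[OF int] by (simp add: set_lebesgue_integral_def lborel_prod)
  also have "\<dots> = (LINT s:{- T..S}|lborel. LINT t:{- s..T}|lborel. f (s, t))"
    unfolding set_lebesgue_integral_def Bochner_Integration.integral_scaleR_right[symmetric] scaleR_scaleR
    by (intro Bochner_Integration.integral_cong refl) (auto simp: indicator_def triangle_def)
  finally show ?thesis .
qed

text \<open>One half of Green's theorem: by Fubini the inner integral runs along a line of constant
  \<open>s\<close>, where \<open>has_dt\<close> evaluates it.\<close>

lemma has_dt_triangle:
  assumes "has_dt f f'"
  shows "(LINT p:triangle S T|lborel. f' p) = (LINT s:{- T..S}|lborel. f (s, T) - f (s, - s))"
  unfolding set_integral_triangle[OF has_dtD(2)[OF assms]] set_lebesgue_integral_def[of lborel "{- T..S}"]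
proof (intro Bochner_Integration.integral_cong refl)
  fix s
  show "indicat_real {- T..S} s *\<^sub>R (LINT t:{- s..T}|lborel. f' (s, t)) =
      indicat_real {- T..S} s *\<^sub>R (f (s, T) - f (s, - s))"
  proof (cases "s \<in> {- T..S}")
    case True
    then have "- s \<le> T" by auto
    from has_integral_unique[OF loc_bdd_measurable_has_integral[OF loc_bdd_measurable_line(1)[OF has_dtD(2)[OF assms]]] has_dtD(3)[OF assms this]]
    show ?thesis by simp
  qed simp
qed

lemma set_integral_swap:
  fixes f :: "real \<times> real \<Rightarrow> 'b::{banach, second_countable_topology}"
  assumes [measurable]: "f \<in> borel_measurable borel" "A \<in> sets borel"
  shows "(LINT p:A|lborel. f p) = (LINT p:prod.swap ` A|lborel. f (prod.swap p))"
proof -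
  have m: "(prod.swap :: real \<times> real \<Rightarrow> _) \<in> borel \<rightarrow>\<^sub>M borel"
    by (rule borel_measurable_continuous_onI) (rule continuous_on_swap)
  have sw: "(prod.swap :: real \<times> real \<Rightarrow> _) = (\<lambda>(x, y). (y, x))"
    by auto
  have "(lborel :: (real \<times> real) measure) = distr lborel lborel prod.swap"
    using lborel_pair.distr_pair_swap[where ?'a = real and ?'b = real]
    by (simp add: lborel_prod sw)
  then have "(LINT p:A|lborel. f p) = (LINT p|distr lborel lborel prod.swap. indicator A p *\<^sub>R f p)"
    unfolding set_lebesgue_integral_def by simp
  also have "\<dots> = (LINT p|lborel. indicator A (prod.swap p) *\<^sub>R f (prod.swap p))"
    by (subst integral_distr) (use m in \<open>auto simp: measurable_lborel2\<close>)
  also have "\<dots> = (LINT p:prod.swap ` A|lborel. f (prod.swap p))"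
  proof -
    have "x \<in> prod.swap ` A \<longleftrightarrow> prod.swap x \<in> A" for x
      by (cases x) (force simp: image_iff)
    then show ?thesis
      by (simp add: set_lebesgue_integral_def indicator_def)
  qed
  finally show ?thesis .
qed

lemma triangle_swap: "prod.swap ` triangle S T = triangle T S"
  unfolding triangle_def by (force simp: image_iff)

lemma has_ds_triangle:
  assumes "has_ds f f'"
  shows "(LINT p:triangle S T|lborel. f' p) = (LINT t:{- S..T}|lborel. f (S, t) - f (- t, t))"
  using has_dt_triangle[OF assms[unfolded has_ds_def], of T S]
    set_integral_swap[OF loc_bdd_measurableD(1)[OF has_dsD(2)[OF assms]] triangle_borel, of S T]
  by (simp add: triangle_swap)

lemma set_integral_reflect:
  fixes f :: "real \<Rightarrow> real"
  shows "(LINT x:{- b..- a}|lborel. f (- x)) = (LINT x:{a..b}|lborel. f x)"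
proof -
  have "(LINT x|lborel. indicator {a..b} x *\<^sub>R f x) =
      (LINT x|lborel. indicator {a..b} (0 + (- 1) * x) *\<^sub>R f (0 + (- 1) * x))"
    using lborel_integral_real_affine[of "- 1" "\<lambda>x. indicator {a..b} x *\<^sub>R f x" 0] by simp
  also have "\<dots> = (LINT x|lborel. indicator {- b..- a} x *\<^sub>R f (- x))"
    by (intro Bochner_Integration.integral_cong) (auto simp: indicator_def)
  finally show ?thesis by (simp add: set_lebesgue_integral_def)
qed

text \<open>The Poincare lemma for the closed form \<open>p ds + q dt\<close>.\<close>

lemma has_ds_potential:
  fixes p q \<Psi> :: "real \<times> real \<Rightarrow> real"
  assumes p: "has_dt p r" and q: "has_ds q r" and \<Psi>: "has_dt \<Psi> q"
    and bottom: "\<And>a b. a \<le> b \<Longrightarrow>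
      ((\<lambda>\<sigma>. p (\<sigma>, - \<sigma>) - q (\<sigma>, - \<sigma>)) has_integral (\<Psi> (b, - b) - \<Psi> (a, - a))) {a..b}"
  shows "has_ds \<Psi> p"
  unfolding has_ds_def has_dt_def
proof (intro conjI allI impI)
  show "loc_bdd_measurable (\<lambda>x. \<Psi> (prod.swap x))" "loc_bdd_measurable (\<lambda>x. p (prod.swap x))"
    using has_dtD[OF p] has_dtD[OF \<Psi>] by (simp_all add: loc_bdd_measurable_swap)
  fix t s :: real assume "- t \<le> s"
  then have st: "- t \<le> s" "- s \<le> t" by auto
  have diag: "loc_bdd_measurable (\<lambda>\<sigma>. h (\<sigma>, - \<sigma>))" "loc_bdd_measurable (\<lambda>\<sigma>. h (- \<sigma>, \<sigma>))"
    if "loc_bdd_measurable h" for h :: "real \<times> real \<Rightarrow> real"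
    by (rule loc_bdd_measurable_compose_continuous[OF that]; intro continuous_intros)+
  note lp = has_dtD(1)[OF p] and lq = has_dsD(1)[OF q]
  note line = loc_bdd_measurable_line
  have si: "set_integrable lborel {a..b} h" if "loc_bdd_measurable h" for h :: "real \<Rightarrow> real" and a b
    by (rule loc_bdd_measurable_integrable[OF that]) auto
  let ?I = "\<lambda>h. LINT \<sigma>:{- t..s}|lborel. h \<sigma>" and ?J = "\<lambda>h. LINT \<tau>:{- s..t}|lborel. h \<tau>"
  \<comment> \<open>The common source \<open>r\<close> is integrated over the triangle in both
    orders. Equating the results says that the circulation of \<open>p ds + q dt\<close> around the
    triangle is zero.\<close>
  have 1: "(LINT x:triangle s t|lborel. r x) = ?I (\<lambda>\<sigma>. p (\<sigma>, t)) - ?I (\<lambda>\<sigma>. p (\<sigma>, - \<sigma>))"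
    unfolding has_dt_triangle[OF p] by (intro set_integral_diff si line diag lp)
  have 2: "(LINT x:triangle s t|lborel. r x) = ?J (\<lambda>\<tau>. q (s, \<tau>)) - ?J (\<lambda>\<tau>. q (- \<tau>, \<tau>))"
    unfolding has_ds_triangle[OF q] by (intro set_integral_diff si line diag lq)
  have 3: "?J (\<lambda>\<tau>. q (s, \<tau>)) = \<Psi> (s, t) - \<Psi> (s, - s)"
    by (rule has_integral_unique[OF loc_bdd_measurable_has_integral[OF line(1)[OF lq]] has_dtD(3)[OF \<Psi> st(2)]])
  have 4: "?J (\<lambda>\<tau>. q (- \<tau>, \<tau>)) = ?I (\<lambda>\<sigma>. q (\<sigma>, - \<sigma>))"
    using set_integral_reflect[where a = "- t" and b = s and f = "\<lambda>\<sigma>. q (\<sigma>, - \<sigma>)"] by simp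
  have 5: "?I (\<lambda>\<sigma>. p (\<sigma>, - \<sigma>)) - ?I (\<lambda>\<sigma>. q (\<sigma>, - \<sigma>)) = \<Psi> (s, - s) - \<Psi> (- t, t)"
    using has_integral_unique[OF has_integral_diff[OF loc_bdd_measurable_has_integral[OF diag(1)[OF lp]]
        loc_bdd_measurable_has_integral[OF diag(1)[OF lq]]] bottom[OF st(1)]] by simp
  have "?I (\<lambda>\<sigma>. p (\<sigma>, t)) = \<Psi> (s, t) - \<Psi> (- t, t)"
    using 1 2 3 4 5 by linarith
  then show "((\<lambda>\<tau>. p (prod.swap (t, \<tau>))) has_integral \<Psi> (prod.swap (t, s)) - \<Psi> (prod.swap (t, - t))) {- t..s}"
    using loc_bdd_measurable_has_integral[OF line(2)[OF lp], of t "- t" s] by simp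
qed

section \<open>Picard iteration for semilinear systems in characteristic coordinates\<close>

text \<open>Integration in one characteristic direction gains a factor \<open>1 / l\<close> in the
  exponentially weighted norm. This gain makes the Picard map a contraction on the whole
  plane.\<close>

lemma set_integral_exp_bound:
  fixes h :: "real \<Rightarrow> 'b::euclidean_space"
  assumes h: "loc_bdd_measurable h" and l: "0 < l" and C: "0 \<le> C"
    and b: "\<And>\<tau>. - s \<le> \<tau> \<Longrightarrow> norm (h \<tau>) \<le> C * exp (l * (s + \<tau>))"
  shows "norm (LINT \<tau>:{- s..t}|lborel. h \<tau>) \<le> C / l * exp (l * max 0 (s + t))"
proof (cases "- s \<le> t")
  case True
  have "((\<lambda>\<tau>. C * exp (l * (s + \<tau>))) has_integral
      (C / l * exp (l * (s + t)) - C / l * exp (l * (s + - s)))) {- s..t}"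
    by (rule fundamental_theorem_of_calculus[OF True])
      (use l in \<open>auto intro!: derivative_eq_intros simp: has_real_derivative_iff_has_vector_derivative[symmetric]\<close>)
  moreover have "(h has_integral (LINT \<tau>:{- s..t}|lborel. h \<tau>)) {- s..t}"
    by (rule loc_bdd_measurable_has_integral[OF h])
  ultimately have "norm (LINT \<tau>:{- s..t}|lborel. h \<tau>) \<le> C / l * exp (l * (s + t)) - C / l * exp (l * (s + - s))"
    using integral_norm_bound_integral[of h "{- s..t}" "\<lambda>\<tau>. C * exp (l * (s + \<tau>))"] b
    by (auto simp: has_integral_iff)
  also have "\<dots> \<le> C / l * exp (l * max 0 (s + t))" using True C l by simp
  finally show ?thesis .
next
  case False
  then have "(LINT \<tau>:{- s..t}|lborel. h \<tau>) = 0" by (simp add: set_lebesgue_integral_def)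
  then show ?thesis using C l by simp
qed

text \<open>The Picard map contracts the supremum norm with weight
  \<open>exp (l * max 0 (s + t))\<close>, since \<open>s + t\<close> is the distance from the
  antidiagonal along either coordinate line. The iterates converge at every point, so the limit is
  again Borel and the equation holds everywhere.\<close>

theorem characteristic_system_solvable:
  fixes X0 :: "real \<times> real \<Rightarrow> 'b::euclidean_space" and F G :: "'b \<Rightarrow> 'b"
  assumes X0: "X0 \<in> borel_measurable borel" "\<And>p. norm (X0 p) \<le> B0"
    and FG: "L-lipschitz_on UNIV F" "L-lipschitz_on UNIV G"
  obtains X where "loc_bdd_measurable X"
    "\<And>s t. X (s, t) = X0 (s, t) + (LINT \<tau>:{- s..t}|lborel. F (X (s, \<tau>))) + (LINT \<sigma>:{- t..s}|lborel. G (X (\<sigma>, t)))"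
proof -
  have L: "0 \<le> L" using FG(1) lipschitz_on_nonneg by blast
  \<comment> \<open>Each of the two integrals contributes the factor \<open>L / l\<close>; the added
    \<open>4\<close> keeps \<open>l\<close> positive when \<open>L = 0\<close>.\<close>
  define l where "l = 4 * L + 4"
  have l: "l > 0" "2 * L / l \<le> 1 / 2" using L by (auto simp: l_def field_simps)
  define W where "W p = exp (l * max 0 (fst p + snd p))" for p :: "real \<times> real"
  have W: "W p > 0" "1 \<le> W p" for p using l by (auto simp: W_def)
  have contW: "continuous_on UNIV W" unfolding W_def by (intro continuous_intros)
  have cont: "continuous_on UNIV F" "continuous_on UNIV G"
    using FG lipschitz_on_continuous_on by blast+
  have lX0: "loc_bdd_measurable X0"
    unfolding loc_bdd_measurable_def bounded_iff using X0 by blast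
  define I where "I H X p = (LINT \<tau>:{- fst p..snd p}|lborel. H (X (fst p, \<tau>)))" for H :: "'b \<Rightarrow> 'b" and X and p :: "real \<times> real"
  \<comment> \<open>The integral in \<open>s\<close> is the integral in \<open>t\<close> of the
    reflected function, so \<open>I\<close> is estimated only once.\<close>
  define T where "T X p = X0 p + I F X p + I G (\<lambda>p. X (prod.swap p)) (prod.swap p)" for X p
  have lI: "loc_bdd_measurable (I H X)" if "loc_bdd_measurable X" "continuous_on UNIV H" for H X
    unfolding I_def by (rule has_dtD(1)[OF has_dt_line_integral[OF loc_bdd_measurable_continuous_compose[OF that]]])
  have lT: "loc_bdd_measurable (T X)" if X: "loc_bdd_measurable X" for X
  proof -
    have 1: "loc_bdd_measurable (I F X)" "loc_bdd_measurable (\<lambda>p. I G (\<lambda>p. X (prod.swap p)) (prod.swap p))"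
      using lI[OF X cont(1)] lI[of "\<lambda>p. X (prod.swap p)" G] X cont(2)
        loc_bdd_measurable_swap[of "I G (\<lambda>p. X (prod.swap p))"] loc_bdd_measurable_swap[of X] by auto
    have "loc_bdd_measurable (\<lambda>p. X0 p + I F X p)"
      by (rule loc_bdd_measurable_binop[OF lX0 1(1)]) (intro continuous_intros)
    from loc_bdd_measurable_binop[OF this 1(2), of "(+)"] show ?thesis
      unfolding T_def by (simp add: continuous_on_add continuous_on_fst continuous_on_snd)
  qed
  have Idiff: "norm (I H X p - I H Y p) \<le> L * D / l * W p"
    if H: "L-lipschitz_on UNIV H" and XY: "loc_bdd_measurable X" "loc_bdd_measurable Y"
      and D: "0 \<le> D" "\<And>p. norm (X p - Y p) \<le> D * W p" for H X Y D p
  proof -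
    have c: "continuous_on UNIV H" using H lipschitz_on_continuous_on by blast
    have m: "loc_bdd_measurable (\<lambda>\<tau>::real. H (Z (fst p, \<tau>)))" if "loc_bdd_measurable Z" for Z
      by (rule loc_bdd_measurable_line[OF loc_bdd_measurable_continuous_compose[OF that c]])
    have "I H X p - I H Y p = (LINT \<tau>:{- fst p..snd p}|lborel. H (X (fst p, \<tau>)) - H (Y (fst p, \<tau>)))"
      unfolding I_def
      by (rule set_integral_diff(2)[symmetric]; rule loc_bdd_measurable_integrable[OF m]) (use XY in auto)
    also have "norm \<dots> \<le> L * D / l * exp (l * max 0 (fst p + snd p))"
    proof (rule set_integral_exp_bound)
      show "loc_bdd_measurable (\<lambda>\<tau>. H (X (fst p, \<tau>)) - H (Y (fst p, \<tau>)))"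
        by (rule loc_bdd_measurable_binop[OF m[OF XY(1)] m[OF XY(2)]]) (intro continuous_intros)
      fix \<tau> assume "- fst p \<le> \<tau>"
      then have "W (fst p, \<tau>) = exp (l * (fst p + \<tau>))" by (simp add: W_def)
      moreover have "norm (H (X (fst p, \<tau>)) - H (Y (fst p, \<tau>))) \<le> L * (D * W (fst p, \<tau>))"
        using lipschitz_onD[OF H, of "X (fst p, \<tau>)" "Y (fst p, \<tau>)"] D(2)[of "(fst p, \<tau>)"] L
        by (auto simp: dist_norm intro: order_trans mult_left_mono)
      ultimately show "norm (H (X (fst p, \<tau>)) - H (Y (fst p, \<tau>))) \<le> L * D * exp (l * (fst p + \<tau>))"
        by simp
    qed (use l L D in auto)
    finally show ?thesis by (simp add: W_def)
  qed
  have Wswap: "W (prod.swap p) = W p" for p by (simp add: W_def add.commute)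
  have contraction: "norm (T X p - T Y p) \<le> D / 2 * W p"
    if XY: "loc_bdd_measurable X" "loc_bdd_measurable Y"
      and D: "0 \<le> D" "\<And>p. norm (X p - Y p) \<le> D * W p" for X Y D p
  proof -
    have D': "norm (X (prod.swap q) - Y (prod.swap q)) \<le> D * W q" for q
      using D(2)[of "prod.swap q"] by (simp only: Wswap)
    have 1: "norm (I F X p - I F Y p) \<le> L * D / l * W p" by (rule Idiff[OF FG(1) XY D])
    have 2: "norm (I G (\<lambda>p. X (prod.swap p)) (prod.swap p) - I G (\<lambda>p. Y (prod.swap p)) (prod.swap p)) \<le> L * D / l * W (prod.swap p)"
      by (rule Idiff[OF FG(2) _ _ D(1) D']) (use XY in \<open>simp_all add: loc_bdd_measurable_swap\<close>)
    have "norm (T X p - T Y p) \<le> norm (I F X p - I F Y p) + norm (I G (\<lambda>p. X (prod.swap p)) (prod.swap p) - I G (\<lambda>p. Y (prod.swap p)) (prod.swap p))"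
      unfolding T_def by (rule order_trans[OF _ norm_triangle_ineq]) (simp add: algebra_simps)
    also have "\<dots> \<le> L * D / l * W p + L * D / l * W p" using 1 2 unfolding Wswap by (rule add_mono)
    also have "\<dots> = 2 * L / l * D * W p" by simp
    also have "\<dots> \<le> 1 / 2 * D * W p" using l(2) D(1) W(1)[of p] by (intro mult_right_mono) auto
    finally show ?thesis by simp
  qed
  define Z where "Z n = (T ^^ n) X0" for n
  have Z0: "Z 0 = X0" and ZS: "Z (Suc n) = T (Z n)" for n by (simp_all add: Z_def)
  have lZ: "loc_bdd_measurable (Z n)" for n by (induction n) (simp_all add: Z0 ZS lX0 lT)
  obtain K where K: "K > 0" "\<And>x. norm x \<le> B0 \<Longrightarrow> norm (F x) \<le> K \<and> norm (G x) \<le> K"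
  proof -
    have "bounded (cball 0 B0 :: 'b set)" by simp
    from loc_bdd_measurable_bound[OF loc_bdd_measurable_Pair[OF loc_bdd_measurable_continuous[OF cont(1)] loc_bdd_measurable_continuous[OF cont(2)]] this]
    obtain K where "K > 0" "\<And>x. norm x \<le> B0 \<Longrightarrow> norm (F x, G x) \<le> K" by auto
    then show thesis using that norm_fst_le norm_snd_le by (meson order_trans)
  qed
  have I0: "norm (I H X p) \<le> K / l * W p"
    if "continuous_on UNIV H" "loc_bdd_measurable X" "\<And>p. norm (H (X p)) \<le> K" for H X p
  proof -
    have "norm (LINT \<tau>:{- fst p..snd p}|lborel. H (X (fst p, \<tau>))) \<le> K / l * exp (l * max 0 (fst p + snd p))"
    proof (rule set_integral_exp_bound)
      show "loc_bdd_measurable (\<lambda>\<tau>. H (X (fst p, \<tau>)))"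
        by (rule loc_bdd_measurable_line[OF loc_bdd_measurable_continuous_compose[OF that(2,1)]])
      fix \<tau> assume "- fst p \<le> \<tau>"
      then have "1 \<le> exp (l * (fst p + \<tau>))" using l by simp
      then show "norm (H (X (fst p, \<tau>))) \<le> K * exp (l * (fst p + \<tau>))"
        using that(3)[of "(fst p, \<tau>)"] mult_left_mono[of 1 "exp (l * (fst p + \<tau>))" K] K(1) by linarith
    qed (use l K in auto)
    then show ?thesis by (simp add: I_def W_def)
  qed
  \<comment> \<open>The first Picard step consists of two integrals, each bounded by
    \<open>K / l\<close> times the weight.\<close>
  define D where "D = 2 * K / l"
  have D: "D > 0" using K l by (simp add: D_def)
  have step: "norm (Z (Suc n) p - Z n p) \<le> D * (1 / 2) ^ n * W p" for n p
  proof (induction n arbitrary: p)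
    case 0
    have "norm (I F X0 p) \<le> K / l * W p" by (rule I0) (use cont lX0 K X0 in auto)
    moreover have "norm (I G (\<lambda>p. X0 (prod.swap p)) (prod.swap p)) \<le> K / l * W (prod.swap p)"
      by (rule I0) (use cont lX0 K X0 in \<open>auto simp: loc_bdd_measurable_swap\<close>)
    ultimately have "norm (I F X0 p + I G (\<lambda>p. X0 (prod.swap p)) (prod.swap p)) \<le> K / l * W p + K / l * W p"
      unfolding Wswap by (rule norm_triangle_mono)
    then have "norm (I F X0 p + I G (\<lambda>p. X0 (prod.swap p)) (prod.swap p)) \<le> 2 * K / l * W p"
      by simp
    then show ?case by (simp add: Z0 ZS T_def D_def add.assoc)
  next
    case (Suc n)
    have "norm (T (Z (Suc n)) p - T (Z n) p) \<le> D * (1 / 2) ^ n / 2 * W p"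
      by (rule contraction[OF lZ lZ]) (use Suc D in auto)
    then show ?case by (simp add: ZS)
  qed
  \<comment> \<open>The factor \<open>1 - (1 / 2) ^ k\<close> is the exact partial sum of the
    geometric series; with it the induction on \<open>k\<close> closes.\<close>
  have tail: "norm (Z (n + k) p - Z n p) \<le> 2 * D * (1 / 2) ^ n * (1 - (1 / 2) ^ k) * W p" for n k p
  proof (induction k)
    case (Suc k)
    have "norm (Z (n + Suc k) p - Z n p) \<le> norm (Z (Suc (n + k)) p - Z (n + k) p) + norm (Z (n + k) p - Z n p)"
      using norm_triangle_ineq[of "Z (Suc (n + k)) p - Z (n + k) p" "Z (n + k) p - Z n p"] by simp
    also have "\<dots> \<le> D * (1 / 2) ^ (n + k) * W p + 2 * D * (1 / 2) ^ n * (1 - (1 / 2) ^ k) * W p"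
      using step[of "n + k" p] Suc by linarith
    also have "\<dots> = 2 * D * (1 / 2) ^ n * (1 - (1 / 2) ^ Suc k) * W p"
      by (simp add: power_add algebra_simps)
    finally show ?case .
  qed simp
  have tail': "norm (Z (n + k) p - Z n p) \<le> 2 * D * (1 / 2) ^ n * W p" for n k p
  proof -
    have "2 * D * (1 / 2) ^ n * (1 - (1 / 2) ^ k) \<le> 2 * D * (1 / 2) ^ n"
      by (rule mult_left_le) (use D in auto)
    then show ?thesis
      using tail[of n k p] W(1)[of p] by (meson less_imp_le mult_right_mono order_trans)
  qed
  have e0: "(\<lambda>n. 2 * D * (1 / 2) ^ n * W p) \<longlonglongrightarrow> 0" for p
    by (intro tendsto_mult_left_zero tendsto_mult_right_zero LIMSEQ_power_zero) simp
  have "convergent (\<lambda>n. Z n p)" for p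
  proof -
    have "Cauchy (\<lambda>n. Z n p)"
    proof (rule metric_CauchyI)
      fix e :: real assume "e > 0"
      then obtain N where N: "2 * D * (1 / 2) ^ N * W p < e / 2"
        using order_tendstoD(2)[OF e0, of "e / 2" p] by (auto simp: eventually_sequentially)
      have "dist (Z m p) (Z n p) < e" if "N \<le> m" "N \<le> n" for m n
      proof -
        have "dist (Z m p) (Z N p) < e / 2" "dist (Z n p) (Z N p) < e / 2"
          using tail'[of N "m - N" p] tail'[of N "n - N" p] N that by (auto simp: dist_norm)
        then show ?thesis by (rule dist_triangle_half_l)
      qed
      then show "\<exists>M. \<forall>m\<ge>M. \<forall>n\<ge>M. dist (Z m p) (Z n p) < e" by blast
    qed
    then show ?thesis by (rule Cauchy_convergent)
  qed
  then obtain X where X: "\<And>p. (\<lambda>n. Z n p) \<longlonglongrightarrow> X p"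
    unfolding convergent_def by metis
  have rest: "norm (X p - Z n p) \<le> 2 * D * (1 / 2) ^ n * W p" for n p
  proof (rule tendsto_upperbound)
    show "(\<lambda>k. norm (Z (n + k) p - Z n p)) \<longlonglongrightarrow> norm (X p - Z n p)"
      using LIMSEQ_ignore_initial_segment[OF X[of p], of n] by (intro tendsto_intros) (simp add: add.commute)
  qed (use tail' in auto)
  have lX: "loc_bdd_measurable X"
    unfolding loc_bdd_measurable_def
  proof (intro conjI allI impI)
    show "X \<in> borel_measurable borel"
      by (rule borel_measurable_LIMSEQ_metric[OF _ X]) (use lZ loc_bdd_measurableD in blast)
    fix S :: "(real \<times> real) set" assume S: "bounded S"
    obtain C where C: "\<And>p. p \<in> S \<Longrightarrow> norm (W p) \<le> C"
      using loc_bdd_measurable_bound[OF loc_bdd_measurable_continuous[OF contW] S] by blast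
    have "norm (X p) \<le> B0 + 2 * D * C" if "p \<in> S" for p
    proof -
      have "norm (X p) \<le> norm (X0 p) + norm (X p - Z 0 p)"
        using norm_triangle_ineq[of "X0 p" "X p - Z 0 p"] by (simp add: Z0)
      also have "\<dots> \<le> B0 + 2 * D * W p" using X0(2)[of p] rest[of p 0] by simp
      also have "\<dots> \<le> B0 + 2 * D * C" using C[OF that] W(1)[of p] D by simp
      finally show ?thesis .
    qed
    then show "bounded (X ` S)" unfolding bounded_iff by blast
  qed
  have "T X p = X p" for p
  proof -
    have "norm (T X p - X p) \<le> 2 * (2 * D * (1 / 2) ^ n * W p)" for n
    proof -
      have "norm (T X p - T (Z n) p) \<le> 2 * D * (1 / 2) ^ n / 2 * W p"
        by (rule contraction[OF lX lZ]) (use rest D in auto)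
      moreover have "norm (X p - Z (Suc n) p) \<le> 2 * D * (1 / 2) ^ Suc n * W p" by (rule rest)
      moreover have "norm (T X p - X p) \<le> norm (T X p - T (Z n) p) + norm (X p - Z (Suc n) p)"
        using norm_triangle_ineq4[of "T X p - T (Z n) p" "X p - Z (Suc n) p"] by (simp add: ZS)
      moreover have "0 \<le> D * (1 / 2) ^ n * W p" using D W(1)[of p] by simp
      ultimately show ?thesis by simp
    qed
    moreover have "(\<lambda>n. 2 * (2 * D * (1 / 2) ^ n * W p)) \<longlonglongrightarrow> 0"
      by (rule tendsto_mult_right_zero[OF e0])
    ultimately have "norm (T X p - X p) \<le> 0"
      using LIMSEQ_le_const by blast
    then show ?thesis by simp
  qed
  then have "X (s, t) = X0 (s, t) + (LINT \<tau>:{- s..t}|lborel. F (X (s, \<tau>))) + (LINT \<sigma>:{- t..s}|lborel. G (X (\<sigma>, t)))" for s t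
    using T_def[of X "(s, t)"] by (simp add: I_def)
  with lX show thesis by (rule that)
qed

text \<open>A component on which \<open>G\<close> vanishes does not see the integral in
  \<open>s\<close>, and its datum depends on \<open>s\<close> alone. What remains of the fixed point
  equation is an integral identity along lines of constant \<open>s\<close>.\<close>

lemma component_has_dt:
  fixes X X0 :: "real \<times> real \<Rightarrow> 'b::euclidean_space" and \<pi> :: "'b \<Rightarrow> real"
  assumes eq: "\<And>s t. X (s, t) = X0 (s, t) + (LINT \<tau>:{- s..t}|lborel. F (X (s, \<tau>))) + (LINT \<sigma>:{- t..s}|lborel. G (X (\<sigma>, t)))"
    and X: "loc_bdd_measurable X" and FG: "continuous_on UNIV F" "continuous_on UNIV G"
    and \<pi>: "bounded_linear \<pi>" "\<And>z. \<pi> (G z) = 0" "\<And>s t. \<pi> (X0 (s, t)) = h s"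
  shows "has_dt (\<lambda>p. \<pi> (X p)) (\<lambda>p. \<pi> (F (X p)))" "\<pi> (X (s, - s)) = h s"
proof -
  have c: "continuous_on UNIV \<pi>" by (rule linear_continuous_on[OF \<pi>(1)])
  have l: "loc_bdd_measurable (\<lambda>\<tau>. F (X (s, \<tau>)))" "loc_bdd_measurable (\<lambda>\<sigma>. G (X (\<sigma>, t)))" for s t
    using loc_bdd_measurable_line[OF loc_bdd_measurable_continuous_compose[OF X FG(1)]]
      loc_bdd_measurable_line[OF loc_bdd_measurable_continuous_compose[OF X FG(2)]] by auto
  have F: "((\<lambda>\<tau>. \<pi> (F (X (s, \<tau>)))) has_integral \<pi> (LINT \<tau>:{- s..t}|lborel. F (X (s, \<tau>)))) {- s..t}" for s t
    using has_integral_linear[OF loc_bdd_measurable_has_integral[OF l(1)] \<pi>(1)] by (simp add: o_def)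
  have G: "\<pi> (LINT \<sigma>:{- t..s}|lborel. G (X (\<sigma>, t))) = 0" for s t
    using has_integral_linear[OF loc_bdd_measurable_has_integral[OF l(2)] \<pi>(1)] \<pi>(2)
    by (simp add: o_def)
  have *: "\<pi> (X (s, t)) = h s + \<pi> (LINT \<tau>:{- s..t}|lborel. F (X (s, \<tau>)))" for s t
    by (subst eq) (simp add: linear_add[OF bounded_linear.linear[OF \<pi>(1)]] \<pi>(3) G)
  have "\<pi> (LINT \<tau>:{- s..- s}|lborel. F (X (s, \<tau>))) = 0" for s
    by (rule has_integral_unique[OF F has_integral_null_real]) simp
  then have **: "\<pi> (X (s, - s)) = h s" for s
    using *[of s "- s"] by simp
  then show "\<pi> (X (s, - s)) = h s" .
  show "has_dt (\<lambda>p. \<pi> (X p)) (\<lambda>p. \<pi> (F (X p)))"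
    unfolding has_dt_def
  proof (intro conjI allI impI)
    show "loc_bdd_measurable (\<lambda>p. \<pi> (X p))"
      by (rule loc_bdd_measurable_continuous_compose[OF X c])
    show "loc_bdd_measurable (\<lambda>p. \<pi> (F (X p)))"
      by (rule loc_bdd_measurable_continuous_compose[OF loc_bdd_measurable_continuous_compose[OF X FG(1)] c])
    show "((\<lambda>\<tau>. \<pi> (F (X (s, \<tau>)))) has_integral \<pi> (X (s, t)) - \<pi> (X (s, - s))) {- s..t}" for s t
      using F[of s t] unfolding **[of s] *[of s t] by simp
  qed
qed

lemma component_has_ds:
  fixes X X0 :: "real \<times> real \<Rightarrow> 'b::euclidean_space" and \<pi> :: "'b \<Rightarrow> real"
  assumes eq: "\<And>s t. X (s, t) = X0 (s, t) + (LINT \<tau>:{- s..t}|lborel. F (X (s, \<tau>))) + (LINT \<sigma>:{- t..s}|lborel. G (X (\<sigma>, t)))"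
    and X: "loc_bdd_measurable X" and FG: "continuous_on UNIV F" "continuous_on UNIV G"
    and \<pi>: "bounded_linear \<pi>" "\<And>z. \<pi> (F z) = 0" "\<And>s t. \<pi> (X0 (s, t)) = h t"
  shows "has_ds (\<lambda>p. \<pi> (X p)) (\<lambda>p. \<pi> (G (X p)))" "\<pi> (X (- t, t)) = h t"
proof -
  let ?X = "\<lambda>p. X (prod.swap p)" and ?Y = "\<lambda>p. X0 (prod.swap p)"
  have eq': "?X (s, t) = ?Y (s, t) + (LINT \<tau>:{- s..t}|lborel. G (?X (s, \<tau>))) + (LINT \<sigma>:{- t..s}|lborel. F (?X (\<sigma>, t)))" for s t
    using eq[of t s] by (simp add: algebra_simps)
  have X': "loc_bdd_measurable ?X" using X by (simp add: loc_bdd_measurable_swap)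
  show "has_ds (\<lambda>p. \<pi> (X p)) (\<lambda>p. \<pi> (G (X p)))"
    unfolding has_ds_def
    by (rule component_has_dt(1)[OF eq' X' FG(2,1) \<pi>(1,2), of h]) (simp add: \<pi>(3))
  show "\<pi> (X (- t, t)) = h t"
    using component_has_dt(2)[OF eq' X' FG(2,1) \<pi>(1,2), of h] \<pi>(3) by simp
qed

lemma has_dt_lower:
  fixes f :: "real \<times> real \<Rightarrow> real"
  assumes "has_dt f f'" "\<And>s t. - s \<le> t \<Longrightarrow> f (s, t) < \<mu> \<Longrightarrow> 0 \<le> f' (s, t)" "\<And>s. \<mu> \<le> f (s, - s)" "- s \<le> t"
  shows "\<mu> \<le> f (s, t)"
  by (rule integral_barrier[of "- s" "\<lambda>\<tau>. f' (s, \<tau>)" "\<lambda>\<tau>. f (s, \<tau>)"]) (use assms has_dtD(3)[OF assms(1)] in auto)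

lemma has_dt_upper:
  fixes f :: "real \<times> real \<Rightarrow> real"
  assumes "has_dt f f'" "\<And>s t. - s \<le> t \<Longrightarrow> \<mu> < f (s, t) \<Longrightarrow> f' (s, t) \<le> 0" "\<And>s. f (s, - s) \<le> \<mu>" "- s \<le> t"
  shows "f (s, t) \<le> \<mu>"
  using has_dt_lower[OF has_dt_cmult[OF assms(1), of "- 1"], of "- \<mu>"] assms by force

lemma has_ds_lower:
  fixes f :: "real \<times> real \<Rightarrow> real"
  assumes "has_ds f f'" "\<And>s t. - s \<le> t \<Longrightarrow> f (s, t) < \<mu> \<Longrightarrow> 0 \<le> f' (s, t)" "\<And>t. \<mu> \<le> f (- t, t)" "- s \<le> t"
  shows "\<mu> \<le> f (s, t)"
  using has_dt_lower[OF assms(1)[unfolded has_ds_def], of \<mu> t s] assms by force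

lemma has_ds_upper:
  fixes f :: "real \<times> real \<Rightarrow> real"
  assumes "has_ds f f'" "\<And>s t. - s \<le> t \<Longrightarrow> \<mu> < f (s, t) \<Longrightarrow> f' (s, t) \<le> 0" "\<And>t. f (- t, t) \<le> \<mu>" "- s \<le> t"
  shows "f (s, t) \<le> \<mu>"
  using has_dt_upper[OF assms(1)[unfolded has_ds_def], of \<mu> t s] assms by force

lemma has_dt_cong_above:
  assumes "has_dt f f'" "loc_bdd_measurable g'" "\<And>s t. - s \<le> t \<Longrightarrow> f' (s, t) = g' (s, t)"
  shows "has_dt f g'"
  unfolding has_dt_def
proof (intro conjI allI impI)
  fix s t :: real assume "- s \<le> t"
  from has_dtD(3)[OF assms(1) this] show "((\<lambda>\<tau>. g' (s, \<tau>)) has_integral f (s, t) - f (s, - s)) {- s..t}"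
    by (rule has_integral_eq[rotated]) (use assms(3) in auto)
qed (use assms has_dtD in auto)

lemma has_ds_cong_above:
  assumes "has_ds f f'" "loc_bdd_measurable g'" "\<And>s t. - s \<le> t \<Longrightarrow> f' (s, t) = g' (s, t)"
  shows "has_ds f g'"
  using has_dt_cong_above[OF assms(1)[unfolded has_ds_def], of "\<lambda>p. g' (prod.swap p)"] assms(2,3)
  by (simp add: loc_bdd_measurable_swap has_ds_def)

section \<open>Bounded Lipschitz nonlinearities and clamping\<close>

text \<open>Boundedness is included because it closes the class under products, which the polynomial
  sources require.\<close>

definition bdd_lipschitz :: "('a::metric_space \<Rightarrow> real) \<Rightarrow> bool" where
  "bdd_lipschitz f \<longleftrightarrow> (\<exists>B. \<forall>x. \<bar>f x\<bar> \<le> B) \<and> (\<exists>L. L-lipschitz_on UNIV f)"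

lemma bdd_lipschitz_const [simp]: "bdd_lipschitz (\<lambda>x. c)"
  unfolding bdd_lipschitz_def by (auto intro: lipschitz_on_constant)

lemma bdd_lipschitz_add:
  assumes "bdd_lipschitz f" "bdd_lipschitz g"
  shows "bdd_lipschitz (\<lambda>x. f x + g x)"
proof -
  obtain B1 B2 L1 L2 where *: "\<And>x. \<bar>f x\<bar> \<le> B1" "\<And>x. \<bar>g x\<bar> \<le> B2" "L1-lipschitz_on UNIV f" "L2-lipschitz_on UNIV g"
    using assms unfolding bdd_lipschitz_def by metis
  have "\<bar>f x + g x\<bar> \<le> B1 + B2" for x using *(1)[of x] *(2)[of x] by linarith
  moreover have "(L1 + L2)-lipschitz_on UNIV (\<lambda>x. f x + g x)" by (intro lipschitz_intros *)
  ultimately show ?thesis unfolding bdd_lipschitz_def by blast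
qed

lemma bdd_lipschitz_mult:
  assumes "bdd_lipschitz f" "bdd_lipschitz g"
  shows "bdd_lipschitz (\<lambda>x. f x * g x)"
proof -
  obtain B1 B2 L1 L2 where *: "\<And>x. \<bar>f x\<bar> \<le> B1" "\<And>x. \<bar>g x\<bar> \<le> B2" "L1-lipschitz_on UNIV f" "L2-lipschitz_on UNIV g"
    using assms unfolding bdd_lipschitz_def by metis
  have B: "0 \<le> B1" "0 \<le> B2" using *(1,2) by (meson abs_ge_zero order_trans)+
  have "\<bar>f x * g x\<bar> \<le> B1 * B2" for x unfolding abs_mult using *(1)[of x] *(2)[of x] B by (intro mult_mono) auto
  moreover have "(B1 * L2 + B2 * L1)-lipschitz_on UNIV (\<lambda>x. f x * g x)"
  proof (rule lipschitz_onI)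
    fix x y
    have "f x * g x - f y * g y = f x * (g x - g y) + (f x - f y) * g y" by (simp add: algebra_simps)
    then have "\<bar>f x * g x - f y * g y\<bar> \<le> \<bar>f x\<bar> * \<bar>g x - g y\<bar> + \<bar>f x - f y\<bar> * \<bar>g y\<bar>"
      by (metis abs_mult abs_triangle_ineq)
    also have "\<dots> \<le> B1 * (L2 * dist x y) + (L1 * dist x y) * B2"
      using *(1,2) lipschitz_onD[OF *(3), of x y] lipschitz_onD[OF *(4), of x y] B
      by (intro add_mono mult_mono) (auto simp: dist_real_def lipschitz_on_nonneg[OF *(3)])
    finally show "dist (f x * g x) (f y * g y) \<le> (B1 * L2 + B2 * L1) * dist x y"
      by (simp add: dist_real_def algebra_simps)
  next
    show "0 \<le> B1 * L2 + B2 * L1"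
      using B lipschitz_on_nonneg[OF *(3)] lipschitz_on_nonneg[OF *(4)] by simp
  qed
  ultimately show ?thesis unfolding bdd_lipschitz_def by blast
qed

lemma bdd_lipschitz_diff:
  assumes "bdd_lipschitz f" "bdd_lipschitz g"
  shows "bdd_lipschitz (\<lambda>x. f x - g x)"
  using bdd_lipschitz_add[OF assms(1) bdd_lipschitz_mult[OF bdd_lipschitz_const assms(2)], of "- 1"] by simp

lemma bdd_lipschitz_compose:
  assumes "bdd_lipschitz f" "L-lipschitz_on UNIV h"
  shows "bdd_lipschitz (\<lambda>x. f (h x))"
proof -
  obtain B M where *: "\<And>x. \<bar>f x\<bar> \<le> B" "M-lipschitz_on UNIV f"
    using assms unfolding bdd_lipschitz_def by metis
  have "(M * L)-lipschitz_on UNIV (f \<circ> h)"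
    by (rule lipschitz_on_compose[OF assms(2) lipschitz_on_subset[OF *(2)]]) simp
  then show ?thesis using *(1) unfolding bdd_lipschitz_def o_def by blast
qed

definition clamp_to :: "real \<Rightarrow> real \<Rightarrow> real \<Rightarrow> real" where
  "clamp_to l u x = max l (min u x)"

lemma bdd_lipschitz_clamp_to: "bdd_lipschitz (clamp_to l u)"
proof -
  have "\<bar>clamp_to l u x\<bar> \<le> \<bar>l\<bar> + \<bar>u\<bar>" for x unfolding clamp_to_def by linarith
  moreover have "1-lipschitz_on UNIV (clamp_to l u)"
    by (rule lipschitz_onI) (auto simp: dist_real_def clamp_to_def)
  ultimately show ?thesis unfolding bdd_lipschitz_def by blast
qed

section \<open>The helicoid system in characteristic coordinates\<close>

text \<open>With \<open>c = - a / 2\<close>, \<open>k = - E' / (2 E)\<close> and \<open>\<sigma>' = k\<close> one has \<open>sqrt E = e0 exp (- \<sigma>)\<close> and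
  \<open>\<gamma> = g0 exp (2 c \<sigma>)\<close>. The scaled Riemann invariants \<open>P = sqrt E (u + v)\<close> and
  \<open>Q = - sqrt E (u - v)\<close> have the invariant square \<open>[m, U]\<^sup>2\<close> with \<open>m U = 2 c - 1\<close>.\<close>

locale helicoid_data =
  fixes c e0 g0 y0 m U S :: real and k \<sigma> P0 Q0 :: "real \<Rightarrow> real"
  assumes c: "1 \<le> c" and e0: "0 < e0" and g0: "0 < g0" and y0: "0 < y0"
    and m: "0 < m" "m \<le> U" "m * U = 2 * c - 1"
    and \<sigma>: "\<And>y. (\<sigma> has_real_derivative k y) (at y)" "\<sigma> (- y0) = 0" "\<And>y. \<sigma> y \<le> S"
    and k: "\<And>y. 0 \<le> k y" "bdd_lipschitz k"
    and P0: "P0 \<in> borel_measurable borel" "\<And>x. m \<le> P0 x \<and> P0 x \<le> U"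
    and Q0: "Q0 \<in> borel_measurable borel" "\<And>x. m \<le> Q0 x \<and> Q0 x \<le> U"
begin

lemma U_pos: "0 < U" using m by linarith

text \<open>Since \<open>m * U = 2 * c - 1\<close>, any \<open>q\<close> in \<open>[m, U]\<close>
  satisfies \<open>m * q \<le> 2 * c - 1 \<le> U * q\<close>. Replacing the cubic term accordingly
  leaves \<open>(c - 1) * (q - m)\<close> on the lower edge and \<open>(c - 1) * (q - U)\<close> on
  the upper one. Hence the reaction field never points out of the square.\<close>

lemma reaction_sign:
  assumes "m \<le> q" "q \<le> U"
  shows "0 \<le> c * m + (c - 1) * q - m\<^sup>2 * q" "c * U + (c - 1) * q - U\<^sup>2 * q \<le> 0"
proof -
  have "m * q \<le> m * U" using assms m by (intro mult_left_mono) auto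
  then have "m * (m * q) \<le> m * (2 * c - 1)" using m by (intro mult_left_mono) auto
  moreover have "0 \<le> (c - 1) * (q - m)" using c assms by (intro mult_nonneg_nonneg) auto
  ultimately show "0 \<le> c * m + (c - 1) * q - m\<^sup>2 * q" by (simp add: power2_eq_square algebra_simps)
  have "U * m \<le> U * q" using assms U_pos by (intro mult_left_mono) auto
  then have "2 * c - 1 \<le> U * q" using m(3) by (simp add: mult.commute)
  then have "U * (2 * c - 1) \<le> U * (U * q)" using U_pos by (intro mult_left_mono) auto
  moreover have "(c - 1) * (q - U) \<le> 0" using c assms by (intro mult_nonneg_nonpos) auto
  ultimately show "c * U + (c - 1) * q - U\<^sup>2 * q \<le> 0" by (simp add: power2_eq_square algebra_simps)
qed

text \<open>On the square \<open>growth\<close> bounds the modulus of \<open>P Q - 2 c\<close>. The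
  logarithm of \<open>a\<close> has \<open>t\<close>-derivative \<open>(P Q - 2 c) k b\<close>, and
  \<open>\<sigma>\<close> along the flow has \<open>k b\<close>. So \<open>a\<close> changes at most
  by the factor \<open>exp (growth * \<sigma>)\<close> either way, where
  \<open>\<sigma> \<le> S\<close>. The other factors bound the initial value
  \<open>e0 / (P0 + Q0)\<close>. The same applies to \<open>b\<close> in the direction
  \<open>s\<close>.\<close>

definition "growth = U\<^sup>2 + 2 * c"
definition "char_max = e0 / (2 * m) * exp (growth * S)"
definition "char_min = e0 / (2 * U) * exp (- (growth * S))"

lemma char_bounds_pos: "0 < char_max" "0 < char_min"
  using e0 m U_pos by (auto simp: char_max_def char_min_def)

lemma growth_bound:
  assumes "m \<le> p" "p \<le> U" "m \<le> q" "q \<le> U"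
  shows "p * q - 2 * c \<le> growth" "- growth \<le> p * q - 2 * c"
proof -
  have "p * q \<le> U * U" using assms m by (intro mult_mono) auto
  moreover have "0 \<le> p * q" using assms m by simp
  moreover have "0 \<le> U * U" by simp
  ultimately show "p * q - 2 * c \<le> growth" "- growth \<le> p * q - 2 * c"
    using c unfolding growth_def power2_eq_square by linarith+
qed

lemma continuous_k: "continuous_on UNIV k"
  using k(2) lipschitz_on_continuous_on unfolding bdd_lipschitz_def by blast

lemma continuous_\<sigma>: "continuous_on UNIV \<sigma>"
  using \<sigma>(1) by (meson DERIV_continuous continuous_at_imp_continuous_on)

lemma initial_speed:
  "e0 / (2 * U) \<le> e0 / (P0 x + Q0 x)" "e0 / (P0 x + Q0 x) \<le> e0 / (2 * m)"
  using P0(2)[of x] Q0(2)[of x] m e0 by (auto intro!: divide_left_mono mult_pos_pos)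

text \<open>The sources are polynomial in \<open>P\<close>, \<open>Q\<close>, \<open>a\<close>,
  \<open>b\<close>, hence not globally Lipschitz; clamping makes Picard iteration applicable. The
  clamp of \<open>a\<close> and \<open>b\<close> starts at \<open>0\<close>, not at
  \<open>char_min\<close>, so that the source vanishes for negative values and nonnegativity can be
  proved first.\<close>

lemma clamped_solution:
  fixes cl :: "real \<Rightarrow> real" and ca :: "real \<Rightarrow> real"
  defines "cl \<equiv> clamp_to m U" and "ca \<equiv> clamp_to 0 char_max"
  obtains P Q a b y :: "real \<times> real \<Rightarrow> real" where
    "has_dt P (\<lambda>p. k (y p) * ca (b p) * (c * cl (P p) + (c - 1) * cl (Q p) - (cl (P p))\<^sup>2 * cl (Q p)))"
    "has_ds Q (\<lambda>p. k (y p) * ca (a p) * ((c - 1) * cl (P p) + c * cl (Q p) - cl (P p) * (cl (Q p))\<^sup>2))"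
    "has_dt a (\<lambda>p. k (y p) * (cl (P p) * cl (Q p) - 2 * c) * ca (a p) * ca (b p))"
    "has_ds b (\<lambda>p. k (y p) * (cl (P p) * cl (Q p) - 2 * c) * ca (a p) * ca (b p))"
    "has_dt y b"
    "\<And>s. P (s, - s) = P0 s" "\<And>s. Q (s, - s) = Q0 s" "\<And>s. a (s, - s) = e0 / (P0 s + Q0 s)"
    "\<And>s. b (s, - s) = e0 / (P0 s + Q0 s)" "\<And>s. y (s, - s) = - y0"
proof -
  let ?P = "\<lambda>z :: real \<times> real \<times> real \<times> real \<times> real. fst z" and ?Q = "\<lambda>z :: real \<times> real \<times> real \<times> real \<times> real. fst (snd z)"
    and ?a = "\<lambda>z :: real \<times> real \<times> real \<times> real \<times> real. fst (snd (snd z))"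
    and ?b = "\<lambda>z :: real \<times> real \<times> real \<times> real \<times> real. fst (snd (snd (snd z)))"
    and ?y = "\<lambda>z :: real \<times> real \<times> real \<times> real \<times> real. snd (snd (snd (snd z)))"
  have lin: "bounded_linear ?P" "bounded_linear ?Q" "bounded_linear ?a" "bounded_linear ?b" "bounded_linear ?y"
    by (auto intro!: bounded_linear_intros)
  have lip1: "\<exists>L. L-lipschitz_on UNIV ?P" "\<exists>L. L-lipschitz_on UNIV ?Q" "\<exists>L. L-lipschitz_on UNIV ?a"
    "\<exists>L. L-lipschitz_on UNIV ?b" "\<exists>L. L-lipschitz_on UNIV ?y"
    using lin bounded_linear.lipschitz_boundE by metis+
  have bl: "bdd_lipschitz (\<lambda>z. f (h z))" if "bdd_lipschitz f" "\<exists>L. L-lipschitz_on UNIV h"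
    for f :: "real \<Rightarrow> real" and h :: "real \<times> real \<times> real \<times> real \<times> real \<Rightarrow> real"
    using bdd_lipschitz_compose that by blast
  note cbl = bl[OF bdd_lipschitz_clamp_to[of m U], folded cl_def] bl[OF bdd_lipschitz_clamp_to[of 0 char_max], folded ca_def] bl[OF k(2)]
  define h where "h z = k (?y z) * (cl (?P z) * cl (?Q z) - 2 * c) * ca (?a z) * ca (?b z)" for z
  define fP where "fP z = k (?y z) * ca (?b z) * (c * cl (?P z) + (c - 1) * cl (?Q z) - (cl (?P z))\<^sup>2 * cl (?Q z))" for z
  define fQ where "fQ z = k (?y z) * ca (?a z) * ((c - 1) * cl (?P z) + c * cl (?Q z) - cl (?P z) * (cl (?Q z))\<^sup>2)" for z
  have blip: "bdd_lipschitz h" "bdd_lipschitz fP" "bdd_lipschitz fQ"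
    unfolding h_def fP_def fQ_def power2_eq_square
    by (intro bdd_lipschitz_mult bdd_lipschitz_add bdd_lipschitz_diff bdd_lipschitz_const cbl lip1)+
  \<comment> \<open>\<open>F\<close> drives \<open>P\<close>, \<open>a\<close> and \<open>y\<close>
    in \<open>t\<close>, and \<open>G\<close> drives \<open>Q\<close> and \<open>b\<close> in
    \<open>s\<close>. The entry for \<open>y\<close> is linear and needs no clamp; the
    \<open>s\<close>-derivative of \<open>y\<close> is recovered later from closedness.\<close>
  define F where "F z = (fP z, 0 :: real, h z, 0 :: real, ?b z)" for z
  define G where "G z = (0 :: real, fQ z, 0 :: real, h z, 0 :: real)" for z
  obtain L1 L2 where L: "L1-lipschitz_on UNIV F" "L2-lipschitz_on UNIV G"
  proof -
    obtain l1 l2 l3 l4 where l: "l1-lipschitz_on UNIV h" "l2-lipschitz_on UNIV fP" "l3-lipschitz_on UNIV fQ" "l4-lipschitz_on UNIV ?b"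
      using blip lip1 unfolding bdd_lipschitz_def by blast
    show thesis
      by (rule that; unfold F_def G_def; (rule lipschitz_on_Pair lipschitz_on_constant l)+)
  qed
  define L where "L = max L1 L2"
  have L': "L-lipschitz_on UNIV F" "L-lipschitz_on UNIV G"
    using L by (auto simp: L_def intro: lipschitz_on_mono)
  then have cFG: "continuous_on UNIV F" "continuous_on UNIV G"
    using lipschitz_on_continuous_on by blast+
  \<comment> \<open>The line of constant \<open>t\<close> meets the antidiagonal at
    \<open>(- t, t)\<close>, so the components driven in \<open>s\<close> read their data at
    \<open>- t\<close>. The common initial value of \<open>a\<close> and \<open>b\<close> makes
    \<open>x_s - x_t = 1\<close> and \<open>y_s - y_t = 0\<close> there, that is,
    \<open>x = s\<close> and \<open>y = - y0\<close> on the antidiagonal.\<close>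
  define X0 where "X0 p = (P0 (fst p), Q0 (- snd p), e0 / (P0 (fst p) + Q0 (fst p)),
    e0 / (P0 (- snd p) + Q0 (- snd p)), - y0)" for p :: "real \<times> real"
  have mX: "X0 \<in> borel_measurable borel"
    unfolding X0_def using P0(1) Q0(1) by (simp add: borel_prod[symmetric]; measurable)
  have bX: "norm (X0 p) \<le> U + (U + (e0 / (2 * m) + (e0 / (2 * m) + y0)))" for p
  proof -
    have 1: "\<bar>P0 x\<bar> \<le> U" "\<bar>Q0 x\<bar> \<le> U" for x using P0(2)[of x] Q0(2)[of x] m by auto
    have 2: "\<bar>e0 / (P0 x + Q0 x)\<bar> \<le> e0 / (2 * m)" for x
    proof -
      have "0 < e0 / (2 * U)" using e0 U_pos by simp
      then show ?thesis using initial_speed[of x] by linarith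
    qed
    show ?thesis
      unfolding X0_def
      by (intro order_trans[OF norm_Pair_le] add_mono) (use 1 2 y0 in auto)
  qed
  obtain X where X: "loc_bdd_measurable X"
    "\<And>s t. X (s, t) = X0 (s, t) + (LINT \<tau>:{- s..t}|lborel. F (X (s, \<tau>))) + (LINT \<sigma>:{- t..s}|lborel. G (X (\<sigma>, t)))"
    using characteristic_system_solvable[OF mX bX L'] by blast
  note dt = component_has_dt[OF X(2,1) cFG] and ds = component_has_ds[OF X(2,1) cFG]
  show thesis
  proof (rule that[of "\<lambda>p. ?P (X p)" "\<lambda>p. ?y (X p)" "\<lambda>p. ?b (X p)" "\<lambda>p. ?Q (X p)" "\<lambda>p. ?a (X p)"])
    show "has_dt (\<lambda>p. ?P (X p)) (\<lambda>p. k (?y (X p)) * ca (?b (X p)) * (c * cl (?P (X p)) + (c - 1) * cl (?Q (X p)) - (cl (?P (X p)))\<^sup>2 * cl (?Q (X p))))"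
      using dt(1)[OF lin(1), of P0] by (simp add: F_def G_def X0_def fP_def)
    show "has_ds (\<lambda>p. ?Q (X p)) (\<lambda>p. k (?y (X p)) * ca (?a (X p)) * ((c - 1) * cl (?P (X p)) + c * cl (?Q (X p)) - cl (?P (X p)) * (cl (?Q (X p)))\<^sup>2))"
      using ds(1)[OF lin(2), of "\<lambda>t. Q0 (- t)"] by (simp add: F_def G_def X0_def fQ_def)
    show "has_dt (\<lambda>p. ?a (X p)) (\<lambda>p. k (?y (X p)) * (cl (?P (X p)) * cl (?Q (X p)) - 2 * c) * ca (?a (X p)) * ca (?b (X p)))"
      using dt(1)[OF lin(3), of "\<lambda>x. e0 / (P0 x + Q0 x)"] by (simp add: F_def G_def X0_def h_def)
    show "has_ds (\<lambda>p. ?b (X p)) (\<lambda>p. k (?y (X p)) * (cl (?P (X p)) * cl (?Q (X p)) - 2 * c) * ca (?a (X p)) * ca (?b (X p)))"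
      using ds(1)[OF lin(4), of "\<lambda>t. e0 / (P0 (- t) + Q0 (- t))"] by (simp add: F_def G_def X0_def h_def)
    show "has_dt (\<lambda>p. ?y (X p)) (\<lambda>p. ?b (X p))"
      using dt(1)[OF lin(5), of "\<lambda>_. - y0"] by (simp add: F_def G_def X0_def)
    fix s
    show "?P (X (s, - s)) = P0 s"
      using dt(2)[OF lin(1), of P0] by (simp add: F_def G_def X0_def)
    show "?Q (X (s, - s)) = Q0 s"
      using ds(2)[OF lin(2), of "\<lambda>t. Q0 (- t)" "- s"] by (simp add: F_def G_def X0_def)
    show "?a (X (s, - s)) = e0 / (P0 s + Q0 s)"
      using dt(2)[OF lin(3), of "\<lambda>x. e0 / (P0 x + Q0 x)"] by (simp add: F_def G_def X0_def)
    show "?b (X (s, - s)) = e0 / (P0 s + Q0 s)"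
      using ds(2)[OF lin(4), of "\<lambda>t. e0 / (P0 (- t) + Q0 (- t))" "- s"] by (simp add: F_def G_def X0_def)
    show "?y (X (s, - s)) = - y0"
      using dt(2)[OF lin(5), of "\<lambda>_. - y0"] by (simp add: F_def G_def X0_def)
  qed
qed

text \<open>A priori bounds show that above the antidiagonal no clamp is active. The barriers for
  \<open>P\<close> and \<open>Q\<close> need only that clamped arguments lie in the square and that
  clamped speeds are nonnegative, so they do not presuppose bounds on \<open>a\<close> and
  \<open>b\<close>.\<close>

lemma characteristic_solution:
  obtains P Q a b y :: "real \<times> real \<Rightarrow> real" where
    "has_dt P (\<lambda>p. k (y p) * b p * (c * P p + (c - 1) * Q p - P p * P p * Q p))"
    "has_ds Q (\<lambda>p. k (y p) * a p * ((c - 1) * P p + c * Q p - P p * Q p * Q p))"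
    "has_dt a (\<lambda>p. k (y p) * (P p * Q p - 2 * c) * a p * b p)"
    "has_ds b (\<lambda>p. k (y p) * (P p * Q p - 2 * c) * a p * b p)"
    "has_dt y b" "has_ds y a"
    "\<And>s. P (s, - s) = P0 s" "\<And>s. Q (s, - s) = Q0 s" "\<And>s. a (s, - s) = e0 / (P0 s + Q0 s)"
    "\<And>s. b (s, - s) = e0 / (P0 s + Q0 s)" "\<And>s. y (s, - s) = - y0"
    "\<And>s t. - s \<le> t \<Longrightarrow> P (s, t) \<in> {m..U}" "\<And>s t. - s \<le> t \<Longrightarrow> Q (s, t) \<in> {m..U}"
    "\<And>s t. - s \<le> t \<Longrightarrow> a (s, t) \<in> {char_min..char_max}"
    "\<And>s t. - s \<le> t \<Longrightarrow> b (s, t) \<in> {char_min..char_max}"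
proof -
  define cl where "cl = clamp_to m U"
  define ca where "ca = clamp_to 0 char_max"
  obtain P Q a b y :: "real \<times> real \<Rightarrow> real" where
    P: "has_dt P (\<lambda>p. k (y p) * ca (b p) * (c * cl (P p) + (c - 1) * cl (Q p) - (cl (P p))\<^sup>2 * cl (Q p)))" and
    Q: "has_ds Q (\<lambda>p. k (y p) * ca (a p) * ((c - 1) * cl (P p) + c * cl (Q p) - cl (P p) * (cl (Q p))\<^sup>2))" and
    a: "has_dt a (\<lambda>p. k (y p) * (cl (P p) * cl (Q p) - 2 * c) * ca (a p) * ca (b p))" and
    b: "has_ds b (\<lambda>p. k (y p) * (cl (P p) * cl (Q p) - 2 * c) * ca (a p) * ca (b p))" and
    y: "has_dt y b" and
    init: "\<And>s. P (s, - s) = P0 s" "\<And>s. Q (s, - s) = Q0 s" "\<And>s. a (s, - s) = e0 / (P0 s + Q0 s)"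
    "\<And>s. b (s, - s) = e0 / (P0 s + Q0 s)" "\<And>s. y (s, - s) = - y0"
    by (rule clamped_solution[folded cl_def ca_def], rule that)
  have init': "P (- t, t) = P0 (- t)" "Q (- t, t) = Q0 (- t)" "a (- t, t) = e0 / (P0 (- t) + Q0 (- t))"
    "b (- t, t) = e0 / (P0 (- t) + Q0 (- t))" "y (- t, t) = - y0" for t
    using init[of "- t"] by simp_all
  have cl: "m \<le> cl x" "cl x \<le> U" "x < m \<Longrightarrow> cl x = m" "U < x \<Longrightarrow> cl x = U" "m \<le> x \<Longrightarrow> x \<le> U \<Longrightarrow> cl x = x" for x
    using m by (auto simp: cl_def clamp_to_def)
  have ca: "0 \<le> ca x" "x \<le> 0 \<Longrightarrow> ca x = 0" "0 \<le> x \<Longrightarrow> ca x \<le> x" "0 \<le> x \<Longrightarrow> x \<le> char_max \<Longrightarrow> ca x = x" for x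
    using char_bounds_pos by (auto simp: ca_def clamp_to_def)
  have P_bounds: "P (s, t) \<in> {m..U}" if "- s \<le> t" for s t
  proof -
    have "m \<le> P (s, t)"
      by (rule has_dt_lower[OF P _ _ that])
        (use cl ca k(1) P0(2) reaction_sign(1) init in \<open>auto intro!: mult_nonneg_nonneg\<close>)
    moreover have "P (s, t) \<le> U"
      by (rule has_dt_upper[OF P _ _ that])
        (use cl ca k(1) P0(2) reaction_sign(2) init in \<open>auto intro!: mult_nonneg_nonpos mult_nonneg_nonneg\<close>)
    ultimately show ?thesis by simp
  qed
  have reaction_sign': "0 \<le> (c - 1) * q + c * m - q * m\<^sup>2" "(c - 1) * q + c * U - q * U\<^sup>2 \<le> 0" if "m \<le> q" "q \<le> U" for q
    using reaction_sign[OF that] by (simp_all add: algebra_simps)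
  have Q_bounds: "Q (s, t) \<in> {m..U}" if "- s \<le> t" for s t
  proof -
    have "m \<le> Q (s, t)"
      by (rule has_ds_lower[OF Q _ _ that])
        (use cl ca k(1) Q0(2) reaction_sign'(1) init' in \<open>auto intro!: mult_nonneg_nonneg\<close>)
    moreover have "Q (s, t) \<le> U"
      by (rule has_ds_upper[OF Q _ _ that])
        (use cl ca k(1) Q0(2) reaction_sign'(2) init' in \<open>auto intro!: mult_nonneg_nonpos mult_nonneg_nonneg\<close>)
    ultimately show ?thesis by simp
  qed
  \<comment> \<open>The initial speeds are positive, and below zero the clamp switches the source
    off, so \<open>0\<close> is a barrier for \<open>a\<close> and for \<open>b\<close>.\<close>
  have ab0: "0 < e0 / (P0 s + Q0 s)" for s
    using initial_speed(1)[of s] e0 U_pos by (smt (verit) divide_pos_pos)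
  have a0: "0 \<le> a (s, t)" if "- s \<le> t" for s t
    by (rule has_dt_lower[OF a _ _ that]) (use ca ab0 init in \<open>auto simp: less_imp_le\<close>)
  have b0: "0 \<le> b (s, t)" if "- s \<le> t" for s t
    by (rule has_ds_lower[OF b _ _ that]) (use ca ab0 init' in \<open>auto simp: less_imp_le\<close>)
  \<comment> \<open>The clamped sources of \<open>a\<close> and \<open>b\<close> are identical, so
    \<open>a ds + b dt\<close> is closed already before the clamps are removed. The bound for
    \<open>b\<close> needs this, since it differentiates \<open>\<sigma> (y p)\<close> in
    \<open>s\<close>.\<close>
  have ys: "has_ds y a"
    by (rule has_ds_potential[OF a b y]) (simp add: init)
  note lbm = has_dtD(1)[OF P] has_dsD(1)[OF Q] has_dtD(1)[OF a] has_dsD(1)[OF b] has_dtD(1)[OF y]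
  have source: "k Y * H * ca A * ca B \<le> growth * k Y * A * B" "- (growth * k Y * A * B) \<le> k Y * H * ca A * ca B"
    if "0 \<le> A" "0 \<le> B" "H \<le> growth" "- growth \<le> H" for Y H A B
  proof -
    have "ca A * ca B \<le> A * B" using ca that by (intro mult_mono) auto
    then have "\<bar>H\<bar> * (ca A * ca B) \<le> growth * (A * B)" using that ca by (intro mult_mono) auto
    then have "\<bar>H * (ca A * ca B)\<bar> \<le> growth * (A * B)" using ca by (simp add: abs_mult)
    then have "k Y * \<bar>H * (ca A * ca B)\<bar> \<le> k Y * (growth * (A * B))" using k(1) by (intro mult_left_mono) auto
    then have "\<bar>k Y * H * ca A * ca B\<bar> \<le> growth * k Y * A * B" using k(1)[of Y] by (simp add: abs_mult algebra_simps)
    then show "k Y * H * ca A * ca B \<le> growth * k Y * A * B" "- (growth * k Y * A * B) \<le> k Y * H * ca A * ca B"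
      by linarith+
  qed
  have H: "cl p * cl q - 2 * c \<le> growth" "- growth \<le> cl p * cl q - 2 * c" for p q
    using growth_bound cl by blast+
  have expd: "((\<lambda>x. exp (r * x)) has_real_derivative r * exp (r * x)) (at x)"
    "continuous_on UNIV (\<lambda>x. r * exp (r * x))" for r x :: real
    by (auto intro!: derivative_eq_intros continuous_intros)
  \<comment> \<open>An integrating factor: \<open>\<sigma> (y p)\<close> has derivative
    \<open>k (y p) * b p\<close> in \<open>t\<close> and \<open>k (y p) * a p\<close> in
    \<open>s\<close>, so suitable powers dominate the quadratic source in either direction.\<close>
  define W where "W r p = exp (r * \<sigma> (y p))" for r and p :: "real \<times> real"
  have Wt: "has_dt (W r) (\<lambda>p. r * W r p * (k (y p) * b p))" and Ws: "has_ds (W r) (\<lambda>p. r * W r p * (k (y p) * a p))" for r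
    unfolding W_def using has_dt_compose[OF has_dt_compose[OF y \<sigma>(1) continuous_k] expd]
      has_ds_compose[OF has_ds_compose[OF ys \<sigma>(1) continuous_k] expd] by auto
  have W0: "W r p > 0" for r p by (simp add: W_def)
  have Wi: "W r (s, - s) = 1" "W r (- t, t) = 1" for r s t by (simp_all add: W_def init init' \<sigma>(2))
  have "0 \<le> growth" using c by (simp add: growth_def)
  then have WS: "W growth p \<le> exp (growth * S)" for p using \<sigma>(3) by (simp add: W_def mult_left_mono)
  have Winv: "W growth p * W (- growth) p = 1" for p by (simp add: W_def exp_minus)
  have upper: "A \<le> char_max" if "A * W (- growth) p \<le> e0 / (2 * m)" for A p
  proof -
    have "A * W (- growth) p * W growth p \<le> e0 / (2 * m) * exp (growth * S)"
      using that WS[of p] W0[of growth p] e0 m by (intro mult_mono) auto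
    then show ?thesis using Winv[of p] by (simp add: char_max_def mult.commute mult.left_commute)
  qed
  have lower: "char_min \<le> A" if "e0 / (2 * U) \<le> A * W growth p" "0 \<le> A" for A p
  proof -
    have "e0 / (2 * U) \<le> A * exp (growth * S)"
      using that mult_left_mono[OF WS[of p] that(2)] by linarith
    then have "e0 / (2 * U) * exp (- (growth * S)) \<le> A * exp (growth * S) * exp (- (growth * S))"
      by (intro mult_right_mono) auto
    then show ?thesis by (simp only: char_min_def mult.assoc exp_minus_inverse mult_1_right)
  qed
  have sgn1: "(h :: real) * w + f * (- growth * w * (kk * g)) \<le> 0" if "h \<le> growth * kk * f * g" "0 < w" for h w f kk g
  proof -
    have "h * w \<le> growth * kk * f * g * w" using that by (intro mult_right_mono) auto
    then show ?thesis by (simp add: algebra_simps)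
  qed
  have sgn2: "0 \<le> (h :: real) * w + f * (growth * w * (kk * g))" if "- (growth * kk * f * g) \<le> h" "0 < w" for h w f kk g
  proof -
    have "- (growth * kk * f * g) * w \<le> h * w" using that by (intro mult_right_mono) auto
    then show ?thesis by (simp add: algebra_simps)
  qed
  have a_bounds: "a (s, t) \<in> {char_min..char_max}" if st: "- s \<le> t" for s t
  proof -
    have "a (s, t) * W (- growth) (s, t) \<le> e0 / (2 * m)"
    proof (rule has_dt_upper[OF has_dt_mult[OF a Wt[of "- growth"]] _ _ st], goal_cases)
      case (1 s t)
      show ?case by (rule sgn1[OF source(1)[OF a0[OF 1(1)] b0[OF 1(1)] H] W0])
    next
      case (2 s)
      show ?case using initial_speed(2)[of "s"] by (simp add: init Wi)
    qed
    moreover have "e0 / (2 * U) \<le> a (s, t) * W growth (s, t)"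
    proof (rule has_dt_lower[OF has_dt_mult[OF a Wt[of growth]] _ _ st], goal_cases)
      case (1 s t)
      show ?case by (rule sgn2[OF source(2)[OF a0[OF 1(1)] b0[OF 1(1)] H] W0])
    next
      case (2 s)
      show ?case using initial_speed(1)[of "s"] by (simp add: init Wi)
    qed
    ultimately show ?thesis using upper lower a0[OF st] by auto
  qed
  have b_bounds: "b (s, t) \<in> {char_min..char_max}" if st: "- s \<le> t" for s t
  proof -
    have src: "k Y * H * ca A * ca B \<le> growth * k Y * B * A" "- (growth * k Y * B * A) \<le> k Y * H * ca A * ca B"
      if "0 \<le> A" "0 \<le> B" "H \<le> growth" "- growth \<le> H" for Y H A B
      using source[OF that, of Y] by (simp_all add: mult.commute mult.left_commute)
    have "b (s, t) * W (- growth) (s, t) \<le> e0 / (2 * m)"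
    proof (rule has_ds_upper[OF has_ds_mult[OF b Ws[of "- growth"]] _ _ st], goal_cases)
      case (1 s t)
      show ?case by (rule sgn1[OF src(1)[OF a0[OF 1(1)] b0[OF 1(1)] H] W0])
    next
      case (2 s)
      show ?case using initial_speed(2)[of "- s"] by (simp add: init' Wi)
    qed
    moreover have "e0 / (2 * U) \<le> b (s, t) * W growth (s, t)"
    proof (rule has_ds_lower[OF has_ds_mult[OF b Ws[of growth]] _ _ st], goal_cases)
      case (1 s t)
      show ?case by (rule sgn2[OF src(2)[OF a0[OF 1(1)] b0[OF 1(1)] H] W0])
    next
      case (2 s)
      show ?case using initial_speed(1)[of "- s"] by (simp add: init' Wi)
    qed
    ultimately show ?thesis using upper lower b0[OF st] by auto
  qed
  have unclamp: "cl (P (s, t)) = P (s, t)" "cl (Q (s, t)) = Q (s, t)" "ca (a (s, t)) = a (s, t)" "ca (b (s, t)) = b (s, t)"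
    if "- s \<le> t" for s t
    using cl(5) ca(4) P_bounds[OF that] Q_bounds[OF that] a_bounds[OF that] b_bounds[OF that] a0[OF that] b0[OF that] by auto
  note lk = loc_bdd_measurable_continuous_compose[OF lbm(5) continuous_k]
  note lI = loc_bdd_measurable_arith lbm lk loc_bdd_measurable_const
  have "has_dt P (\<lambda>p. k (y p) * b p * (c * P p + (c - 1) * Q p - P p * P p * Q p))"
    by (rule has_dt_cong_above[OF P]) (intro lI, simp add: unclamp power2_eq_square)
  moreover have "has_ds Q (\<lambda>p. k (y p) * a p * ((c - 1) * P p + c * Q p - P p * Q p * Q p))"
    by (rule has_ds_cong_above[OF Q]) (intro lI, simp add: unclamp power2_eq_square)
  moreover have "has_dt a (\<lambda>p. k (y p) * (P p * Q p - 2 * c) * a p * b p)"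
    by (rule has_dt_cong_above[OF a]) (intro lI, simp add: unclamp)
  moreover have "has_ds b (\<lambda>p. k (y p) * (P p * Q p - 2 * c) * a p * b p)"
    by (rule has_ds_cong_above[OF b]) (intro lI, simp add: unclamp)
  ultimately show thesis
    by (rule that[OF _ _ _ _ y ys init P_bounds Q_bounds a_bounds b_bounds])
qed

end

section \<open>Bump functions and measures on the plane\<close>

lemma max0_square_deriv: "((\<lambda>r::real. (max 0 r)\<^sup>2) has_real_derivative 2 * max 0 r) (at r)"
proof (cases r "0 :: real" rule: linorder_cases)
  case less
  have "((\<lambda>r::real. 0) has_real_derivative 2 * max 0 r) (at r)" using less by simp
  then show ?thesis
    by (rule has_field_derivative_transform_within_open[where S = "{..<0}"]) (use less in auto)
next
  case greater
  have "((\<lambda>r::real. r\<^sup>2) has_real_derivative 2 * max 0 r) (at r)"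
    using greater by (auto intro!: derivative_eq_intros)
  then show ?thesis
    by (rule has_field_derivative_transform_within_open[where S = "{0<..}"]) (use greater in auto)
next
  case equal
  have "((\<lambda>h::real. (max 0 h)\<^sup>2 / h) \<longlongrightarrow> 0) (at 0)"
  proof (rule Lim_null_comparison)
    have "norm ((max 0 h)\<^sup>2 / h) \<le> \<bar>h\<bar>" for h :: real
      by (cases "h \<le> 0") (auto simp: power2_eq_square)
    then show "\<forall>\<^sub>F h :: real in at 0. norm ((max 0 h)\<^sup>2 / h) \<le> \<bar>h\<bar>" by simp
    show "((\<lambda>h::real. \<bar>h\<bar>) \<longlongrightarrow> 0) (at 0)" by (auto intro!: tendsto_eq_intros)
  qed
  then show ?thesis using equal by (simp add: DERIV_def)
qed

text \<open>A continuously differentiable approximation from below to the indicator of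
  \<open>{a<..<b}\<close>. The square smooths the corner of \<open>max 0\<close>, and the map from
  \<open>r\<close> to \<open>r / (1 + r)\<close> keeps values below \<open>1\<close> and is
  monotone, which gives monotonicity in \<open>n\<close>.\<close>

definition bump :: "real \<Rightarrow> real \<Rightarrow> nat \<Rightarrow> real \<Rightarrow> real" where
  "bump a b n z = (max 0 (real n * ((z - a) * (b - z))))\<^sup>2 / (1 + (max 0 (real n * ((z - a) * (b - z))))\<^sup>2)"

lemma bump_deriv:
  obtains g' where "\<And>z. (bump a b n has_real_derivative g' z) (at z)" "continuous_on UNIV g'"
proof -
  define q where "q z = real n * ((z - a) * (b - z))" for z
  define q' where "q' z = real n * ((b - z) - (z - a))" for z
  define w where "w z = (max 0 (q z))\<^sup>2" for z
  define w' where "w' z = 2 * max 0 (q z) * q' z" for z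
  have q: "(q has_real_derivative q' z) (at z)" for z
    unfolding q_def q'_def by (auto intro!: derivative_eq_intros simp: algebra_simps)
  have w: "(w has_real_derivative w' z) (at z)" for z
    unfolding w_def w'_def using DERIV_chain2[OF max0_square_deriv q] by simp
  have w0: "0 \<le> w z" for z by (simp add: w_def)
  have b: "bump a b n = (\<lambda>z. w z / (1 + w z))" by (auto simp: bump_def w_def q_def)
  have w1: "1 + w z \<noteq> 0" for z using w0[of z] by linarith
  have "(bump a b n has_real_derivative (w' z * (1 + w z) - w z * w' z) / ((1 + w z) * (1 + w z))) (at z)" for z
    unfolding b by (rule DERIV_divide) (use w w1 in \<open>auto intro!: derivative_eq_intros\<close>)
  moreover have "continuous_on UNIV (\<lambda>z. (w' z * (1 + w z) - w z * w' z) / ((1 + w z) * (1 + w z)))"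
    using w1 unfolding w'_def w_def q_def q'_def
    by (intro continuous_intros) auto
  ultimately show thesis by (rule that)
qed

lemma bump_continuous: "continuous_on UNIV (bump a b n)"
  using bump_deriv[of a b n] by (metis DERIV_continuous continuous_at_imp_continuous_on)

lemma bump_nonneg: "0 \<le> bump a b n z"
  by (simp add: bump_def)

lemma bump_outside:
  assumes "a < b" "z \<notin> {a<..<b}"
  shows "bump a b n z = 0"
proof -
  have "(z - a) * (b - z) \<le> 0"
    using assms by (auto simp: mult_le_0_iff)
  then have "max 0 (real n * ((z - a) * (b - z))) = 0"
    by (simp add: mult_nonneg_nonpos)
  then show ?thesis unfolding bump_def by simp
qed

lemma bump_mono: "mono (\<lambda>n. bump a b n z)"
proof (rule monoI)
  fix i j :: nat assume ij: "i \<le> j"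
  define q where "q = (z - a) * (b - z)"
  define r where "r n = max 0 (real n * q)" for n
  have "r i \<le> r j"
  proof (cases "0 \<le> q")
    case True
    then show ?thesis using ij by (auto simp: r_def intro: mult_right_mono max.mono)
  next
    case False
    then show ?thesis by (simp add: r_def mult_nonneg_nonpos)
  qed
  moreover have "0 \<le> r i" by (simp add: r_def)
  ultimately have "(r i)\<^sup>2 \<le> (r j)\<^sup>2" by (intro power_mono)
  moreover have "x / (1 + x) \<le> x' / (1 + x')" if "0 \<le> x" "x \<le> x'" for x x' :: real
    using that by (simp add: frac_le divide_le_eq pos_le_divide_eq field_simps)
  ultimately show "bump a b i z \<le> bump a b j z"
    by (simp add: bump_def r_def q_def)
qed

lemma bump_tendsto:
  assumes "a < b"
  shows "(\<lambda>n. bump a b n z) \<longlonglongrightarrow> indicator {a<..<b} z"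
proof (cases "z \<in> {a<..<b}")
  case True
  define q where "q = (z - a) * (b - z)"
  have q: "q > 0" using True by (simp add: q_def)
  have "filterlim (\<lambda>n. q * real n) at_top sequentially"
    by (rule filterlim_tendsto_pos_mult_at_top[OF tendsto_const q filterlim_real_sequentially])
  then have "filterlim (\<lambda>n. (q * real n)\<^sup>2) at_top sequentially"
    by (intro filterlim_pow_at_top) auto
  then have "filterlim (\<lambda>n. 1 + (q * real n)\<^sup>2) at_top sequentially"
    by (intro filterlim_tendsto_add_at_top[OF tendsto_const])
  then have "(\<lambda>n. 1 - inverse (1 + (q * real n)\<^sup>2)) \<longlonglongrightarrow> 1 - 0"
    by (intro tendsto_intros tendsto_inverse_0_at_top)
  moreover have "1 - inverse (1 + (q * real n)\<^sup>2) = bump a b n z" for n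
  proof -
    have "max 0 (real n * q) = q * real n" using q by simp
    moreover have "1 + (q * real n)\<^sup>2 > 0" by (simp add: add_pos_nonneg)
    ultimately show ?thesis unfolding bump_def q_def[symmetric] by (simp add: field_simps)
  qed
  ultimately show ?thesis using True by simp
next
  case False
  then show ?thesis using bump_outside[OF assms] by simp
qed

lemma compact_support_antiderivative:
  fixes f :: "real \<Rightarrow> real"
  assumes f: "continuous_on UNIV f" "\<And>z. z \<notin> {a<..<b} \<Longrightarrow> f z = 0" and ab: "a < b"
  obtains H where "\<And>z. (H has_real_derivative f z) (at z)" "\<And>z. z \<le> a \<Longrightarrow> H z = 0"
    "\<And>z. b \<le> z \<Longrightarrow> (f has_integral H z) UNIV"
proof -
  define H where "H z = integral {a - 1..z} f" for z
  have cf: "continuous_on A f" for A using f(1) continuous_on_subset by blast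
  have fi: "f integrable_on {c..d}" for c d using cf integrable_continuous_interval by blast
  have H0: "H z = 0" if "z \<le> a" for z
    unfolding H_def by (rule integral_unique[OF has_integral_is_0]) (use that f(2) in auto)
  have "(H has_real_derivative f z) (at z)" for z
  proof (cases "z < a")
    case True
    have "((\<lambda>_. 0) has_real_derivative f z) (at z)" using f(2)[of z] True by simp
    then show ?thesis
      by (rule has_field_derivative_transform_within_open[where S = "{..<a}"]) (use True H0 in auto)
  next
    case False
    have "(H has_real_derivative f z) (at z within {a - 1..z + 1})"
      unfolding H_def by (rule integral_has_real_derivative[OF cf]) (use False in auto)
    then show ?thesis using False by (simp add: at_within_Icc_at)
  qed
  moreover have "(f has_integral H z) UNIV" if "b \<le> z" for z
  proof (rule has_integral_on_superset)
    show "(f has_integral H z) {a - 1..z}"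
      unfolding H_def using fi by (simp add: has_integral_iff)
  qed (use f(2) that in auto)
  ultimately show thesis using that[of H] H0 by blast
qed

lemma box_real_Pair: "box (a, c) (b, d) = {a<..<b} \<times> {c<..<d :: real}" for a b :: real
  by (auto simp: box_def Basis_prod_def)

lemma nn_integral_bump_box:
  assumes M: "sets M = sets borel" and "a < b" "c < d"
  shows "(\<lambda>n. \<integral>\<^sup>+z. ennreal (bump a b n (fst z) * bump c d n (snd z)) \<partial>M)
    \<longlonglongrightarrow> emeasure M (box (a, c) (b, d))"
proof -
  have box: "box (a, c) (b, d) = {a<..<b} \<times> {c<..<d}"
    by (simp add: box_real_Pair)
  have "(\<lambda>n. \<integral>\<^sup>+z. ennreal (bump a b n (fst z) * bump c d n (snd z)) \<partial>M)
    \<longlonglongrightarrow> (\<integral>\<^sup>+z. ennreal (indicator {a<..<b} (fst z) * indicator {c<..<d} (snd z)) \<partial>M)"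
  proof (rule nn_integral_LIMSEQ)
    show "incseq (\<lambda>n z. ennreal (bump a b n (fst z) * bump c d n (snd z)))"
      unfolding incseq_def le_fun_def
      by (intro allI impI ennreal_leI mult_mono monoD[OF bump_mono] bump_nonneg)
    have "continuous_on UNIV (\<lambda>z. bump a b n (fst z) * bump c d n (snd z))" for n
      by (intro continuous_intros continuous_on_compose2[OF bump_continuous]) auto
    then have "(\<lambda>z. bump a b n (fst z) * bump c d n (snd z)) \<in> borel_measurable borel" for n
      by (rule borel_measurable_continuous_onI)
    then show "(\<lambda>z. ennreal (bump a b n (fst z) * bump c d n (snd z))) \<in> borel_measurable M" for n
      using M by (simp cong: measurable_cong_sets)
    show "(\<lambda>n. ennreal (bump a b n (fst z) * bump c d n (snd z))) \<longlonglongrightarrow>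
        ennreal (indicator {a<..<b} (fst z) * indicator {c<..<d} (snd z))" for z
      by (intro tendsto_ennrealI tendsto_intros bump_tendsto assms)
  qed
  also have "(\<integral>\<^sup>+z. ennreal (indicator {a<..<b} (fst z) * indicator {c<..<d} (snd z)) \<partial>M) =
      (\<integral>\<^sup>+z. indicator (box (a, c) (b, d)) z \<partial>M)"
    by (intro nn_integral_cong) (auto simp: box indicator_def)
  also have "\<dots> = emeasure M (box (a, c) (b, d))"
    by (rule nn_integral_indicator) (simp add: M)
  finally show ?thesis .
qed

text \<open>Boxes form an intersection-stable generator, and products of bumps increase to the
  indicator of a box. Only boxes inside the strip are tested, because boundary terms in the later
  integration by parts vanish for these; any other box is clipped, as both measures are null outside
  the strip.\<close>

lemma strip_measure_eqI:
  fixes M N :: "(real \<times> real) measure"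
  assumes sets: "sets M = sets borel" "sets N = sets borel"
    and null: "emeasure M (- (UNIV \<times> {l<..<u})) = 0" "emeasure N (- (UNIV \<times> {l<..<u})) = 0"
    and fin: "\<And>p q. emeasure M (box p q) < \<infinity>"
    and eq: "\<And>a b c d n. a < b \<Longrightarrow> l \<le> c \<Longrightarrow> c < d \<Longrightarrow> d \<le> u \<Longrightarrow>
      (\<integral>\<^sup>+z. ennreal (bump a b n (fst z) * bump c d n (snd z)) \<partial>M) =
      (\<integral>\<^sup>+z. ennreal (bump a b n (fst z) * bump c d n (snd z)) \<partial>N)"
  shows "M = N"
proof (rule measure_eqI_generator_eq)
  let ?E = "range (\<lambda>(a, b). box a b :: (real \<times> real) set)"
  show "Int_stable ?E"
    by (auto simp: Int_stable_def box_Int_box)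
  show "?E \<subseteq> Pow UNIV" "sets M = sigma_sets UNIV ?E" "sets N = sigma_sets UNIV ?E"
    by (simp_all add: borel_eq_box sets)
  let ?A = "\<lambda>n::nat. box (- (real n *\<^sub>R One)) (real n *\<^sub>R One) :: (real \<times> real) set"
  show "range ?A \<subseteq> ?E" "(\<Union>i. ?A i) = UNIV"
    unfolding UN_box_eq_UNIV by auto
  show "emeasure M (?A i) \<noteq> \<infinity>" for i
    using fin[of "- (real i *\<^sub>R One)" "real i *\<^sub>R One"] by (simp only: less_irrefl less_top[symmetric] infinity_ennreal_def not_False_eq_True)
  have clip: "emeasure L (box (a, c) (b, d)) = emeasure L (box (a, max l c) (b, min u d))"
    if "sets L = sets borel" "emeasure L (- (UNIV \<times> {l<..<u})) = 0" for L :: "(real \<times> real) measure" and a b c d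
  proof -
    have "open (UNIV \<times> {l<..<u} :: (real \<times> real) set)" by (intro open_Times) auto
    then have "- (UNIV \<times> {l<..<u}) \<in> sets L"
      unfolding that(1) by (intro borel_closed closed_Compl)
    then have nl: "- (UNIV \<times> {l<..<u}) \<in> null_sets L"
      using that(2) by (intro null_setsI)
    have "box (a, max l c) (b, min u d) = box (a, c) (b, d) - (- (UNIV \<times> {l<..<u}))"
      by (auto simp: box_real_Pair)
    then show ?thesis
      using emeasure_Diff_null_set[OF nl, of "box (a, c) (b, d)"] that(1) by simp
  qed
  fix X assume "X \<in> ?E"
  then obtain p q where "X = box p q" by auto
  then obtain a b c d where X: "X = box (a, c) (b, d)" by (cases p, cases q) blast
  show "emeasure M X = emeasure N X"
  proof (cases "a < b \<and> max l c < min u d")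
    case True
    then have ab: "a < b" "max l c < min u d" by auto
    have "emeasure M (box (a, max l c) (b, min u d)) = emeasure N (box (a, max l c) (b, min u d))"
      by (rule LIMSEQ_unique[OF nn_integral_bump_box[OF sets(1) ab]])
        (simp only: eq[OF ab(1) max.cobounded1 ab(2) min.cobounded1] nn_integral_bump_box[OF sets(2) ab])
    then show ?thesis
      unfolding X clip[OF sets(1) null(1), of a c b d] clip[OF sets(2) null(2), of a c b d] .
  next
    case False
    then have "box (a, max l c) (b, min u d) = {}" by (auto simp: box_real_Pair)
    then show ?thesis
      unfolding X clip[OF sets(1) null(1), of a c b d] clip[OF sets(2) null(2), of a c b d] by simp
  qed
qed

lemma has_dt_increment:
  fixes f :: "real \<times> real \<Rightarrow> real"
  assumes f: "has_dt f f'" and b: "\<And>s t. - s \<le> t \<Longrightarrow> l \<le> f' (s, t)" "\<And>s t. - s \<le> t \<Longrightarrow> f' (s, t) \<le> u"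
    and st: "- s \<le> t1" "t1 \<le> t2"
  shows "l * (t2 - t1) \<le> f (s, t2) - f (s, t1)" "f (s, t2) - f (s, t1) \<le> u * (t2 - t1)"
proof -
  have int: "((\<lambda>\<tau>. f' (s, \<tau>)) has_integral (f (s, t2) - f (s, t1))) {t1..t2}"
    using lipschitz_of_has_integral(1)[of "- s" "\<lambda>\<tau>. f' (s, \<tau>)" "\<lambda>\<tau>. f (s, \<tau>)"] has_dtD(3)[OF f] st by blast
  show "l * (t2 - t1) \<le> f (s, t2) - f (s, t1)"
    using has_integral_le[OF has_integral_const_real[of l t1 t2] int] b(1) st by (simp add: mult.commute)
  show "f (s, t2) - f (s, t1) \<le> u * (t2 - t1)"
    using has_integral_le[OF int has_integral_const_real[of u t1 t2]] b(2) st by (simp add: mult.commute)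
qed

lemma has_ds_increment:
  fixes f :: "real \<times> real \<Rightarrow> real"
  assumes f: "has_ds f f'" and b: "\<And>s t. - s \<le> t \<Longrightarrow> l \<le> f' (s, t)" "\<And>s t. - s \<le> t \<Longrightarrow> f' (s, t) \<le> u"
    and st: "- t \<le> s1" "s1 \<le> s2"
  shows "l * (s2 - s1) \<le> f (s2, t) - f (s1, t)" "f (s2, t) - f (s1, t) \<le> u * (s2 - s1)"
  using has_dt_increment[OF f[unfolded has_ds_def], of l u t s1 s2] b st by (simp_all add: minus_le_iff)

definition upper_half :: "(real \<times> real) set" where
  "upper_half = {p. - fst p \<le> snd p}"

lemma closed_upper_half: "closed upper_half"
  unfolding upper_half_def by (intro closed_Collect_le continuous_intros)

lemma upper_half_borel [measurable]: "upper_half \<in> sets borel"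
  using closed_upper_half by simp

text \<open>Two points are joined through the point with the larger of each coordinate. A path that
  moves only in the directions of increasing \<open>s\<close> and \<open>t\<close> stays above the
  antidiagonal, where the derivative bounds hold.\<close>

lemma continuous_on_upper_half:
  fixes f :: "real \<times> real \<Rightarrow> real"
  assumes dt: "has_dt f f'" "\<And>s t. - s \<le> t \<Longrightarrow> \<bar>f' (s, t)\<bar> \<le> M"
    and ds: "has_ds f f''" "\<And>s t. - s \<le> t \<Longrightarrow> \<bar>f'' (s, t)\<bar> \<le> M"
  shows "continuous_on upper_half f"
proof -
  have M: "0 \<le> M" using dt(2)[of 0 0] by simp
  have t: "\<bar>f (s, t2) - f (s, t1)\<bar> \<le> M * (t2 - t1)" if "- s \<le> t1" "t1 \<le> t2" for s t1 t2
    using has_dt_increment[OF dt(1), of "- M" M, OF _ _ that] dt(2) by (simp add: abs_le_iff minus_le_iff)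
  have s: "\<bar>f (s2, t) - f (s1, t)\<bar> \<le> M * (s2 - s1)" if "- t \<le> s1" "s1 \<le> s2" for s1 s2 t
    using has_ds_increment[OF ds(1), of "- M" M, OF _ _ that] ds(2) by (simp add: abs_le_iff minus_le_iff)
  have corner: "\<bar>f (s', t') - f (s, t)\<bar> \<le> 2 * M * dist (s', t') (s, t)" if "- s \<le> t" "s \<le> s'" "t \<le> t'" for s t s' t'
  proof -
    have "\<bar>f (s', t') - f (s, t)\<bar> \<le> M * (t' - t) + M * (s' - s)"
      using t[of s' t t'] s[of t s s'] that by linarith
    also have "\<dots> \<le> M * dist (s', t') (s, t) + M * dist (s', t') (s, t)"
      using dist_fst_le[of "(s', t')" "(s, t)"] dist_snd_le[of "(s', t')" "(s, t)"] that M
      by (intro add_mono mult_left_mono) (auto simp: dist_real_def)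
    finally show ?thesis by simp
  qed
  have "dist (f p) (f q) \<le> (4 * M) * dist p q" if pq: "p \<in> upper_half" "q \<in> upper_half" for p q
  proof -
    obtain s t s' t' where [simp]: "p = (s, t)" "q = (s', t')" by fastforce
    define r where "r = (max s s', max t t')"
    have "dist r p \<le> dist p q" "dist r q \<le> dist p q"
      by (auto simp: r_def dist_Pair_Pair dist_real_def max_def power2_commute intro!: real_sqrt_le_mono)
    moreover have "\<bar>f r - f p\<bar> \<le> 2 * M * dist r p" "\<bar>f r - f q\<bar> \<le> 2 * M * dist r q"
      using corner[of s t "max s s'" "max t t'"] corner[of s' t' "max s s'" "max t t'"] pq
      by (auto simp: r_def upper_half_def)
    ultimately have "\<bar>f r - f p\<bar> \<le> 2 * M * dist p q" "\<bar>f r - f q\<bar> \<le> 2 * M * dist p q"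
      using M by (meson mult_left_mono mult_nonneg_nonneg order_trans zero_le_numeral)+
    then show ?thesis by (simp add: dist_real_def)
  qed
  then have "(4 * M)-lipschitz_on upper_half f"
    using M by (intro lipschitz_onI) auto
  then show ?thesis by (rule lipschitz_on_continuous_on)
qed

section \<open>The flow map from characteristic coordinates to the plane\<close>

locale helicoid_flow = helicoid_data +
  fixes P Q a b y :: "real \<times> real \<Rightarrow> real"
  assumes P: "has_dt P (\<lambda>p. k (y p) * b p * (c * P p + (c - 1) * Q p - P p * P p * Q p))"
    and Q: "has_ds Q (\<lambda>p. k (y p) * a p * ((c - 1) * P p + c * Q p - P p * Q p * Q p))"
    and a: "has_dt a (\<lambda>p. k (y p) * (P p * Q p - 2 * c) * a p * b p)"
    and b: "has_ds b (\<lambda>p. k (y p) * (P p * Q p - 2 * c) * a p * b p)"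
    and yt: "has_dt y b" and ys: "has_ds y a"
    and init: "\<And>s. P (s, - s) = P0 s" "\<And>s. Q (s, - s) = Q0 s" "\<And>s. a (s, - s) = e0 / (P0 s + Q0 s)"
      "\<And>s. b (s, - s) = e0 / (P0 s + Q0 s)" "\<And>s. y (s, - s) = - y0"
    and bounds: "\<And>s t. - s \<le> t \<Longrightarrow> P (s, t) \<in> {m..U}" "\<And>s t. - s \<le> t \<Longrightarrow> Q (s, t) \<in> {m..U}"
      "\<And>s t. - s \<le> t \<Longrightarrow> a (s, t) \<in> {char_min..char_max}"
      "\<And>s t. - s \<le> t \<Longrightarrow> b (s, t) \<in> {char_min..char_max}"
begin

text \<open>\<open>\<rho> = 1 / sqrt E\<close> along the flow.\<close>

definition \<rho> :: "real \<times> real \<Rightarrow> real" where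
  "\<rho> p = exp (\<sigma> (y p)) / e0"

text \<open>Only the prescribed \<open>t\<close>-derivative is integrated, from \<open>x = s\<close>
  on the antidiagonal; the relation \<open>x_s = P a \<rho>\<close> is a consequence, proved in
  \<open>xs\<close>.\<close>

definition x :: "real \<times> real \<Rightarrow> real" where
  "x p = fst p + (LINT \<tau>:{- fst p..snd p}|lborel. - (Q (fst p, \<tau>) * b (fst p, \<tau>) * \<rho> (fst p, \<tau>)))"

lemma init': "P (- t, t) = P0 (- t)" "Q (- t, t) = Q0 (- t)" "a (- t, t) = e0 / (P0 (- t) + Q0 (- t))"
    "b (- t, t) = e0 / (P0 (- t) + Q0 (- t))" "y (- t, t) = - y0" for t
  using init[of "- t"] by simp_all

lemmas lbm_basic = has_dtD(1)[OF P] has_dsD(1)[OF Q] has_dtD(1)[OF a] has_dsD(1)[OF b] has_dtD(1)[OF yt]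

lemma exp_\<sigma>_deriv:
  "((\<lambda>z. C * exp (r * \<sigma> z)) has_real_derivative C * (r * k z * exp (r * \<sigma> z))) (at z)"
  "continuous_on UNIV (\<lambda>z. C * (r * k z * exp (r * \<sigma> z)))"
  by (auto intro!: derivative_eq_intros continuous_intros \<sigma>(1) continuous_k continuous_\<sigma>)

lemma \<rho>t: "has_dt \<rho> (\<lambda>p. k (y p) * b p * \<rho> p)" and \<rho>s: "has_ds \<rho> (\<lambda>p. k (y p) * a p * \<rho> p)"
proof -
  have e: "\<rho> = (\<lambda>p. 1 / e0 * exp (1 * \<sigma> (y p)))" by (simp add: \<rho>_def fun_eq_iff)
  show "has_dt \<rho> (\<lambda>p. k (y p) * b p * \<rho> p)"
    unfolding e by (rule has_dt_cong[OF has_dt_compose[OF yt exp_\<sigma>_deriv]]) simp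
  show "has_ds \<rho> (\<lambda>p. k (y p) * a p * \<rho> p)"
    unfolding e by (rule has_ds_cong[OF has_ds_compose[OF ys exp_\<sigma>_deriv]]) simp
qed

lemma lbm_\<rho>: "loc_bdd_measurable \<rho>" by (rule has_dtD(1)[OF \<rho>t])

text \<open>Together with \<open>Q_b_\<rho>_ds\<close> this is the compatibility
  \<open>x_st = x_ts\<close>. The cubic reaction term cancels against the product \<open>P Q\<close>
  in the source of \<open>a\<close>, and \<open>\<rho>\<close> supplies the last term linear in
  \<open>P\<close>.\<close>

lemma P_a_\<rho>_dt: "has_dt (\<lambda>p. P p * a p * \<rho> p) (\<lambda>p. k (y p) * a p * b p * \<rho> p * (c - 1) * (Q p - P p))"
  by (rule has_dt_cong[OF has_dt_mult[OF has_dt_mult[OF P a] \<rho>t]]) (simp add: algebra_simps)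

lemma Q_b_\<rho>_ds: "has_ds (\<lambda>p. - (Q p * b p * \<rho> p)) (\<lambda>p. k (y p) * a p * b p * \<rho> p * (c - 1) * (Q p - P p))"
proof -
  have "has_ds (\<lambda>p. - 1 * (Q p * b p * \<rho> p)) (\<lambda>p. k (y p) * a p * b p * \<rho> p * (c - 1) * (Q p - P p))"
    by (rule has_ds_cong[OF has_ds_cmult[OF has_ds_mult[OF has_ds_mult[OF Q b] \<rho>s]]]) (simp add: algebra_simps)
  then show ?thesis by simp
qed

lemma x_init: "x (s, - s) = s"
proof -
  have "(LINT \<tau>:{- s..- s}|lborel. - (Q (s, \<tau>) * b (s, \<tau>) * \<rho> (s, \<tau>))) = 0"
    by (rule has_integral_unique[OF loc_bdd_measurable_has_integral[OF
          loc_bdd_measurable_line(1)[OF has_dsD(1)[OF Q_b_\<rho>_ds]]] has_integral_null_real]) simp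
  then show ?thesis by (simp add: x_def)
qed

lemma xt: "has_dt x (\<lambda>p. - (Q p * b p * \<rho> p))"
proof -
  have "has_dt fst (\<lambda>p :: real \<times> real. 0 :: real)"
    unfolding has_dt_def by (auto intro!: loc_bdd_measurable_continuous continuous_on_fst continuous_on_id)
  from has_dt_linear(1)[OF this has_dt_line_integral[OF has_dsD(1)[OF Q_b_\<rho>_ds]]]
  show ?thesis unfolding x_def[abs_def] by simp
qed

lemma P0_Q0_pos: "0 < P0 s + Q0 s"
  using P0(2)[of s] Q0(2)[of s] m by linarith

lemma xs: "has_ds x (\<lambda>p. P p * a p * \<rho> p)"
proof (rule has_ds_potential[OF P_a_\<rho>_dt Q_b_\<rho>_ds xt])
  fix l u :: real assume "l \<le> u"
  \<comment> \<open>The derivative of \<open>x\<close> along the antidiagonal; it equals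
    \<open>1\<close> because of the choice \<open>e0 / (P0 + Q0)\<close> for the initial
    \<open>a\<close> and \<open>b\<close>.\<close>
  have "P (\<sigma>', - \<sigma>') * a (\<sigma>', - \<sigma>') * \<rho> (\<sigma>', - \<sigma>') - - (Q (\<sigma>', - \<sigma>') * b (\<sigma>', - \<sigma>') * \<rho> (\<sigma>', - \<sigma>')) = 1" for \<sigma>'
    using P0_Q0_pos[of \<sigma>'] e0 by (simp add: init \<rho>_def \<sigma>(2) add_divide_distrib[symmetric])
  then show "((\<lambda>\<sigma>'. P (\<sigma>', - \<sigma>') * a (\<sigma>', - \<sigma>') * \<rho> (\<sigma>', - \<sigma>') - - (Q (\<sigma>', - \<sigma>') * b (\<sigma>', - \<sigma>') * \<rho> (\<sigma>', - \<sigma>')))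
      has_integral x (u, - u) - x (l, - l)) {l..u}"
    using has_integral_const_real[of "1 :: real" l u] \<open>l \<le> u\<close> by (simp only: x_init) simp
qed

lemma y_ge: "- s \<le> t \<Longrightarrow> - y0 \<le> y (s, t)"
  by (rule has_dt_lower[OF yt]) (use bounds(4) char_bounds_pos in \<open>force simp: init\<close>)+

lemma \<sigma>_nonneg: "- y0 \<le> z \<Longrightarrow> 0 \<le> \<sigma> z"
  using DERIV_nonneg_imp_nondecreasing[of "- y0" z \<sigma>] \<sigma> k(1) by auto

lemma \<rho>_bounds:
  assumes "- s \<le> t" shows "1 / e0 \<le> \<rho> (s, t)" "\<rho> (s, t) \<le> exp S / e0"
  using \<sigma>_nonneg[OF y_ge[OF assms]] \<sigma>(3)[of "y (s, t)"] e0 by (auto simp: \<rho>_def divide_right_mono)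

text \<open>\<open>slope_min\<close> and \<open>slope_max\<close> bound all four of
  \<open>x_s\<close>, \<open>- x_t\<close>, \<open>y_s\<close> and \<open>y_t\<close>, whereas
  \<open>speed_max\<close> bounds the modulus of \<open>dx / dy\<close> along characteristics of
  both families.\<close>

definition "slope_min = min char_min (m * char_min / e0)"
definition "speed_max = U * exp S / e0"
definition "slope_max = max char_max (speed_max * char_max)"

lemma slope_min_pos: "0 < slope_min"
  using char_bounds_pos m e0 by (simp add: slope_min_def)

lemma slope_bounds:
  assumes st: "- s \<le> t"
  shows "slope_min \<le> a (s, t)" "slope_min \<le> b (s, t)"
    "slope_min \<le> P (s, t) * a (s, t) * \<rho> (s, t)" "slope_min \<le> Q (s, t) * b (s, t) * \<rho> (s, t)"
    "P (s, t) * a (s, t) * \<rho> (s, t) \<le> speed_max * a (s, t)" "Q (s, t) * b (s, t) * \<rho> (s, t) \<le> speed_max * b (s, t)"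
    "a (s, t) \<le> slope_max" "b (s, t) \<le> slope_max"
    "P (s, t) * a (s, t) * \<rho> (s, t) \<le> slope_max" "Q (s, t) * b (s, t) * \<rho> (s, t) \<le> slope_max"
proof -
  note B = bounds[OF st] \<rho>_bounds[OF st]
  have pos: "0 \<le> a (s, t)" "0 \<le> b (s, t)" "0 \<le> \<rho> (s, t)" "0 \<le> P (s, t)" "0 \<le> Q (s, t)"
    using B char_bounds_pos m e0 by (auto simp: \<rho>_def)
  have low: "m * char_min / e0 \<le> f * g * \<rho> (s, t)" if "f \<in> {m..U}" "g \<in> {char_min..char_max}" for f g
  proof -
    have "m * char_min * (1 / e0) \<le> f * g * \<rho> (s, t)"
      using that B m char_bounds_pos e0 by (intro mult_mono) auto
    then show ?thesis by simp
  qed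
  have up: "f * g * \<rho> (s, t) \<le> speed_max * g" if "f \<in> {m..U}" "g \<in> {char_min..char_max}" for f g
  proof -
    have "f * \<rho> (s, t) * g \<le> U * (exp S / e0) * g"
      using that B m char_bounds_pos e0 pos U_pos by (intro mult_right_mono mult_mono) auto
    then show ?thesis by (simp add: speed_max_def mult.commute mult.left_commute)
  qed
  have up': "speed_max * g \<le> slope_max" if "g \<in> {char_min..char_max}" for g
  proof -
    have "speed_max * g \<le> speed_max * char_max"
      using that U_pos e0 by (intro mult_left_mono) (auto simp: speed_max_def)
    then show ?thesis by (simp add: slope_max_def)
  qed
  show "slope_min \<le> a (s, t)" "slope_min \<le> b (s, t)" "a (s, t) \<le> slope_max" "b (s, t) \<le> slope_max"
    using B by (auto simp: slope_min_def slope_max_def)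
  show "slope_min \<le> P (s, t) * a (s, t) * \<rho> (s, t)" "slope_min \<le> Q (s, t) * b (s, t) * \<rho> (s, t)"
    using low[OF B(1,3)] low[OF B(2,4)] by (auto simp: slope_min_def)
  show "P (s, t) * a (s, t) * \<rho> (s, t) \<le> speed_max * a (s, t)" "Q (s, t) * b (s, t) * \<rho> (s, t) \<le> speed_max * b (s, t)"
    using up[OF B(1,3)] up[OF B(2,4)] by auto
  then show "P (s, t) * a (s, t) * \<rho> (s, t) \<le> slope_max" "Q (s, t) * b (s, t) * \<rho> (s, t) \<le> slope_max"
    using up'[OF B(3)] up'[OF B(4)] by auto
qed

text \<open>Characteristics of the two families leave a point in different quadrants, which makes the
  characteristic coordinates bi-Lipschitz.\<close>

lemma expanding:
  assumes "p \<in> upper_half" "q \<in> upper_half"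
  shows "slope_min * dist p q \<le> dist (x p, y p) (x q, y q)"
proof -
  define l where "l = slope_min"
  have x1: "l * (s2 - s1) \<le> x (s2, t) - x (s1, t)" and y1: "l * (s2 - s1) \<le> y (s2, t) - y (s1, t)"
    if "- t \<le> s1" "s1 \<le> s2" for s1 s2 t
    using has_ds_increment(1)[OF xs, of l slope_max, OF _ _ that] has_ds_increment(1)[OF ys, of l slope_max, OF _ _ that]
      slope_bounds by (simp_all add: l_def)
  have x2: "l * (t2 - t1) \<le> x (s, t1) - x (s, t2)" and y2: "l * (t2 - t1) \<le> y (s, t2) - y (s, t1)"
    if "- s \<le> t1" "t1 \<le> t2" for s t1 t2
    using has_dt_increment(2)[OF xt, of "- slope_max" "- l", OF _ _ that] has_dt_increment(1)[OF yt, of l slope_max, OF _ _ that]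
      slope_bounds by (simp_all add: l_def)
  have wlog: "l * dist (s1, t1) (s2, t2) \<le> dist (x (s1, t1), y (s1, t1)) (x (s2, t2), y (s2, t2))"
    if st: "- s1 \<le> t1" "- s2 \<le> t2" "s1 \<le> s2" for s1 t1 s2 t2
  proof -
    have d: "dist (s1, t1) (s2, t2) \<le> (s2 - s1) + \<bar>t2 - t1\<bar>"
      using sqrt_sum_squares_le_sum_abs[of "s1 - s2" "t1 - t2"] st by (simp add: dist_Pair_Pair dist_real_def power2_commute abs_minus_commute)
    have "l * dist (s1, t1) (s2, t2) \<le> l * ((s2 - s1) + \<bar>t2 - t1\<bar>)"
      using d slope_min_pos by (intro mult_left_mono) (auto simp: l_def)
    also have "\<dots> \<le> max \<bar>x (s1, t1) - x (s2, t2)\<bar> \<bar>y (s1, t1) - y (s2, t2)\<bar>"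
    proof (cases "t1 \<le> t2")
      case True
      then have "l * (s2 - s1) + l * (t2 - t1) \<le> y (s2, t2) - y (s1, t1)"
        using y1[of t1 s1 s2] y2[of s2 t1 t2] st by linarith
      then show ?thesis using True by (simp add: algebra_simps)
    next
      case False
      then have "l * (s2 - s1) + l * (t1 - t2) \<le> x (s2, t2) - x (s1, t1)"
        using x1[of t1 s1 s2] x2[of s2 t2 t1] st by linarith
      then show ?thesis using False by (simp add: algebra_simps)
    qed
    also have "\<dots> \<le> dist (x (s1, t1), y (s1, t1)) (x (s2, t2), y (s2, t2))"
      using dist_fst_le[of "(x (s1, t1), y (s1, t1))" "(x (s2, t2), y (s2, t2))"]
        dist_snd_le[of "(x (s1, t1), y (s1, t1))" "(x (s2, t2), y (s2, t2))"] by (simp add: dist_real_def)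
    finally show ?thesis .
  qed
  obtain s1 t1 s2 t2 where [simp]: "p = (s1, t1)" "q = (s2, t2)" by fastforce
  show ?thesis
    using wlog[of s1 t1 s2 t2] wlog[of s2 t2 s1 t1] assms
    by (cases "s1 \<le> s2") (auto simp: upper_half_def l_def dist_commute)
qed

end

lemma has_dt_fst: "has_dt fst (\<lambda>p :: real \<times> real. 0 :: real)"
  unfolding has_dt_def by (auto intro!: loc_bdd_measurable_continuous continuous_on_fst continuous_on_id)

lemma has_ds_snd: "has_ds snd (\<lambda>p :: real \<times> real. 0 :: real)"
  unfolding has_ds_def by (simp add: prod.swap_def has_dt_fst[unfolded id_def])

section \<open>Change of variables to characteristic coordinates\<close>

context helicoid_flow
begin

text \<open>The Jacobian determinant \<open>x_s y_t - x_t y_s\<close>.\<close>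

definition jac :: "real \<times> real \<Rightarrow> real" where
  "jac p = (P p + Q p) * a p * b p * \<rho> p"

lemma lbm_x: "loc_bdd_measurable x" by (rule has_dtD(1)[OF xt])

lemma lbm_jac: "loc_bdd_measurable jac"
  unfolding jac_def by (intro loc_bdd_measurable_arith lbm_basic lbm_\<rho>)

lemma jac_nonneg: "p \<in> upper_half \<Longrightarrow> 0 \<le> jac p"
proof -
  assume "p \<in> upper_half"
  then obtain s t where p: "p = (s, t)" "- s \<le> t" by (cases p) (auto simp: upper_half_def)
  show ?thesis
    using bounds[OF p(2)] char_bounds_pos m e0 unfolding jac_def p(1)
    by (intro mult_nonneg_nonneg) (auto simp: \<rho>_def)
qed

text \<open>\<open>x + speed_max * y\<close> does not decrease in \<open>t\<close>, and
  \<open>x - speed_max * y\<close> does not increase in \<open>s\<close>; both start on the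
  antidiagonal, where \<open>x = s = - t\<close>. As long as \<open>y\<close> is at most
  \<open>0\<close>, large \<open>s\<close> thus forces \<open>x\<close> far to the right and large
  \<open>t\<close> far to the left, so a bounded triangle captures every compactly supported
  integrand.\<close>

lemma finite_speed:
  assumes st: "- s \<le> t"
  shows "s - speed_max * (y (s, t) + y0) \<le> x (s, t)" "x (s, t) \<le> - t + speed_max * (y (s, t) + y0)"
proof -
  have "- speed_max * y0 \<le> x (s, t) + speed_max * y (s, t) - fst (s, t)"
    by (rule has_dt_lower[OF has_dt_linear(2)[OF has_dt_linear(1)[OF xt has_dt_cmult[OF yt]] has_dt_fst] _ _ st])
      (use slope_bounds(6) in \<open>auto simp: init x_init\<close>)
  then show "s - speed_max * (y (s, t) + y0) \<le> x (s, t)" by (simp add: algebra_simps)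
  have "x (s, t) - speed_max * y (s, t) + snd (s, t) \<le> speed_max * y0"
    by (rule has_ds_upper[OF has_ds_linear(1)[OF has_ds_linear(2)[OF xs has_ds_cmult[OF ys]] has_ds_snd] _ _ st])
      (use slope_bounds(5) x_init[of "- _", simplified] in \<open>auto simp: init'\<close>)
  then show "x (s, t) \<le> - t + speed_max * (y (s, t) + y0)" by (simp add: algebra_simps)
qed

lemma speed_max_nonneg: "0 \<le> speed_max"
  using U_pos e0 by (simp add: speed_max_def)

lemma y_growth: "- s \<le> t \<Longrightarrow> char_min * (s + t) - y0 \<le> y (s, t)"
  using has_dt_increment(1)[OF yt, of char_min char_max s "- s" t] bounds(4)
  by (auto simp: init algebra_simps)

text \<open>Green's theorem for \<open>H(x) g(y) dy\<close> with \<open>H' = f\<close>, whose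
  exterior derivative pulls back to \<open>f(x) g(y) jac ds dt\<close>. On a large triangle only the
  side \<open>s = N\<close> contributes, with \<open>H(x) = H B\<close> wherever \<open>g(y)\<close>
  is nonzero. On the side \<open>t = N\<close> one of \<open>H(x)\<close>, \<open>g(y)\<close>
  vanishes, and on the initial side \<open>g(y)\<close> does.\<close>

lemma jac_integral_bump:
  assumes "A < B" "- y0 \<le> C" "C < D" "D \<le> 0"
  shows "(\<integral>\<^sup>+p. ennreal (indicator upper_half p * (bump A B n (x p) * bump C D n (y p) * jac p)) \<partial>lborel) =
    (\<integral>\<^sup>+z. ennreal (bump A B n (fst z) * bump C D n (snd z)) \<partial>lborel)"
proof -
  define f where "f = bump A B n"
  define g where "g = bump C D n"
  have cf: "continuous_on UNIV f" and cg: "continuous_on UNIV g"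
    unfolding f_def g_def by (rule bump_continuous)+
  have f0: "f z = 0" if "z \<notin> {A<..<B}" for z unfolding f_def by (rule bump_outside[OF assms(1) that])
  have g0: "g z = 0" if "z \<notin> {C<..<D}" for z unfolding g_def by (rule bump_outside[OF assms(3) that])
  have fg: "0 \<le> f z" "0 \<le> g z" for z by (simp_all add: f_def g_def bump_nonneg)
  obtain H where H: "\<And>z. (H has_real_derivative f z) (at z)" "\<And>z. z \<le> A \<Longrightarrow> H z = 0" "\<And>z. B \<le> z \<Longrightarrow> (f has_integral H z) UNIV"
    using compact_support_antiderivative[OF cf f0 assms(1)] by metis
  obtain G where G: "\<And>z. (G has_real_derivative g z) (at z)" "\<And>z. z \<le> C \<Longrightarrow> G z = 0" "\<And>z. D \<le> z \<Longrightarrow> (g has_integral G z) UNIV"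
    using compact_support_antiderivative[OF cg g0 assms(3)] by metis
  have HB: "H z = H B" if "B \<le> z" for z using has_integral_unique[OF H(3)[OF that] H(3)] by simp
  have GD: "G z = G D" if "D \<le> z" for z using has_integral_unique[OF G(3)[OF that] G(3)] by simp
  have HG0: "0 \<le> H B" "0 \<le> G D"
    using has_integral_nonneg[OF H(3)[of B]] has_integral_nonneg[OF G(3)[of D]] fg by auto
  obtain g' where g': "\<And>z. (g has_real_derivative g' z) (at z)" "continuous_on UNIV g'"
    using bump_deriv[of C D n] unfolding g_def by metis
  \<comment> \<open>Large enough that, while \<open>y < D\<close>, the sides \<open>s = N\<close>
    and \<open>t = N\<close> lie to the right of \<open>B\<close> and to the left of
    \<open>A\<close>, and that \<open>y (N, N)\<close> is nonnegative.\<close>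
  define N where "N = \<bar>A\<bar> + \<bar>B\<bar> + speed_max * y0 + y0 / char_min"
  have "0 \<le> speed_max * y0" "0 \<le> y0 / char_min" using speed_max_nonneg y0 char_bounds_pos by auto
  then have N: "0 \<le> N" "B + speed_max * y0 \<le> N" "- A + speed_max * y0 \<le> N" "y0 / char_min \<le> N"
    unfolding N_def by linarith+
  define r where "r p = k (y p) * (P p * Q p - 2 * c) * a p * b p" for p
  note a' = a[folded r_def] and b' = b[folded r_def]
  \<comment> \<open>Derivatives of the \<open>dt\<close> and \<open>ds\<close> coefficients of the
    form. The mixed derivative \<open>r\<close> of \<open>y\<close> and the terms with
    \<open>g'\<close> occur in both and cancel in the difference.\<close>
  define \<alpha>' where "\<alpha>' p = (f (x p) * (P p * a p * \<rho> p)) * (g (y p) * b p) + H (x p) * ((g' (y p) * a p) * b p + g (y p) * r p)" for p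
  define \<beta>' where "\<beta>' p = (f (x p) * (- (Q p * b p * \<rho> p))) * (g (y p) * a p) + H (x p) * ((g' (y p) * b p) * a p + g (y p) * r p)" for p
  have \<alpha>: "has_ds (\<lambda>p. H (x p) * (g (y p) * b p)) \<alpha>'"
    unfolding \<alpha>'_def
    by (rule has_ds_mult[OF has_ds_compose[OF xs H(1) cf] has_ds_mult[OF has_ds_compose[OF ys g'] b']])
  have \<beta>: "has_dt (\<lambda>p. H (x p) * (g (y p) * a p)) \<beta>'"
    unfolding \<beta>'_def
    by (rule has_dt_mult[OF has_dt_compose[OF xt H(1) cf] has_dt_mult[OF has_dt_compose[OF yt g'] a']])
  have "\<alpha>' p - \<beta>' p = f (x p) * g (y p) * jac p" for p
    unfolding \<alpha>'_def \<beta>'_def jac_def by (simp add: algebra_simps)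
  then have "(LINT p:triangle N N|lborel. f (x p) * g (y p) * jac p) =
      (LINT p:triangle N N|lborel. \<alpha>' p) - (LINT p:triangle N N|lborel. \<beta>' p)"
    using set_integral_diff(2)[OF loc_bdd_measurable_integrable[OF has_dsD(2)[OF \<alpha>] triangle_bounded triangle_borel]
        loc_bdd_measurable_integrable[OF has_dtD(2)[OF \<beta>] triangle_bounded triangle_borel], of N N] by simp
  also have "(LINT p:triangle N N|lborel. \<alpha>' p) = (LINT t:{- N..N}|lborel. H B * (g (y (N, t)) * b (N, t)))"
    unfolding has_ds_triangle[OF \<alpha>]
  proof (rule set_lebesgue_integral_cong)
    show "\<forall>t. t \<in> {- N..N} \<longrightarrow> H (x (N, t)) * (g (y (N, t)) * b (N, t)) - H (x (- t, t)) * (g (y (- t, t)) * b (- t, t)) =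
        H B * (g (y (N, t)) * b (N, t))"
    proof (intro allI impI)
      fix t assume "t \<in> {- N..N}"
      then have t: "- N \<le> t" by simp
      have "g (y (N, t)) = 0 \<or> H (x (N, t)) = H B"
      proof (cases "y (N, t) < D")
        case True
        then have "speed_max * (y (N, t) + y0) \<le> speed_max * y0"
          using speed_max_nonneg assms by (intro mult_left_mono) auto
        then have "B \<le> x (N, t)" using finite_speed(1)[OF t] N by linarith
        then show ?thesis using HB by blast
      qed (use g0 in auto)
      moreover have "g (y (- t, t)) = 0" using g0[of "- y0"] assms by (simp add: init')
      ultimately show "H (x (N, t)) * (g (y (N, t)) * b (N, t)) - H (x (- t, t)) * (g (y (- t, t)) * b (- t, t)) =
          H B * (g (y (N, t)) * b (N, t))" by auto
    qed
  qed simp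
  also have "\<dots> = H B * G D"
  proof -
    have GY: "has_dt (\<lambda>p. G (y p)) (\<lambda>p. g (y p) * b p)" by (rule has_dt_compose[OF yt G(1) cg])
    have "y0 \<le> N * char_min" using N(4) char_bounds_pos by (simp add: divide_le_eq)
    then have "0 \<le> y (N, N)" using y_growth[of N N] N(1) mult_nonneg_nonneg[OF N(1) less_imp_le[OF char_bounds_pos(2)]]
      by (simp add: algebra_simps)
    then have "G (y (N, N)) - G (y (N, - N)) = G D" using GD[of "y (N, N)"] G(2)[of "- y0"] assms by (simp add: init)
    then have "(LINT t:{- N..N}|lborel. g (y (N, t)) * b (N, t)) = G D"
      using has_integral_unique[OF loc_bdd_measurable_has_integral[OF loc_bdd_measurable_line(1)[OF has_dtD(2)[OF GY]]] has_dtD(3)[OF GY, of N N]] N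
      by simp
    then show ?thesis by simp
  qed
  also have "(LINT p:triangle N N|lborel. \<beta>' p) = (LINT s:{- N..N}|lborel. 0)"
    unfolding has_dt_triangle[OF \<beta>]
  proof (rule set_lebesgue_integral_cong)
    show "\<forall>s. s \<in> {- N..N} \<longrightarrow> H (x (s, N)) * (g (y (s, N)) * a (s, N)) - H (x (s, - s)) * (g (y (s, - s)) * a (s, - s)) = 0"
    proof (intro allI impI)
      fix s assume "s \<in> {- N..N}"
      then have s: "- s \<le> N" by simp
      have "g (y (s, N)) = 0 \<or> H (x (s, N)) = 0"
      proof (cases "y (s, N) < D")
        case True
        then have "speed_max * (y (s, N) + y0) \<le> speed_max * y0"
          using speed_max_nonneg assms by (intro mult_left_mono) auto
        then have "x (s, N) \<le> A" using finite_speed(2)[OF s] N by linarith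
        then show ?thesis using H(2) by blast
      qed (use g0 in auto)
      moreover have "g (y (s, - s)) = 0" using g0[of "- y0"] assms by (simp add: init)
      ultimately show "H (x (s, N)) * (g (y (s, N)) * a (s, N)) - H (x (s, - s)) * (g (y (s, - s)) * a (s, - s)) = 0" by auto
    qed
  qed simp
  finally have I: "(LINT p:triangle N N|lborel. f (x p) * g (y p) * jac p) = H B * G D" by simp
  have lfgJ: "loc_bdd_measurable (\<lambda>p. f (x p) * g (y p) * jac p)"
    by (intro loc_bdd_measurable_arith loc_bdd_measurable_continuous_compose[OF lbm_x cf]
        loc_bdd_measurable_continuous_compose[OF lbm_basic(5) cg] lbm_jac)
  have tri: "triangle N N \<subseteq> upper_half" by (auto simp: triangle_def upper_half_def)
  \<comment> \<open>Outside the triangle one of the two bumps is zero, so the integral over the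
    unbounded half plane is one over the triangle.\<close>
  have eq: "indicator upper_half p * (f (x p) * g (y p) * jac p) = indicator (triangle N N) p *\<^sub>R (f (x p) * g (y p) * jac p)" for p
  proof (cases "p \<in> upper_half - triangle N N \<and> y p < D")
    case True
    obtain s t where p: "p = (s, t)" by fastforce
    have st: "- s \<le> t" "s > N \<or> t > N" using True by (auto simp: p upper_half_def triangle_def)
    have "speed_max * (y (s, t) + y0) \<le> speed_max * y0"
      using speed_max_nonneg assms True p by (intro mult_left_mono) auto
    then have "B \<le> x p \<or> x p \<le> A" using finite_speed[OF st(1)] N st(2) unfolding p by linarith
    then have "f (x p) = 0" using f0[of "x p"] by auto
    then show ?thesis by simp
  next
    case False
    then show ?thesis using g0[of "y p"] tri by (auto simp: indicator_def)
  qed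
  have "(\<integral>\<^sup>+p. ennreal (indicator upper_half p * (f (x p) * g (y p) * jac p)) \<partial>lborel) =
      ennreal (LINT p:triangle N N|lborel. f (x p) * g (y p) * jac p)"
    unfolding eq set_lebesgue_integral_def
  proof (rule nn_integral_eq_integral)
    show "integrable lborel (\<lambda>p. indicat_real (triangle N N) p *\<^sub>R (f (x p) * g (y p) * jac p))"
      using loc_bdd_measurable_integrable[OF lfgJ triangle_bounded triangle_borel] by (simp add: set_integrable_def)
    have "0 \<le> indicat_real (triangle N N) p *\<^sub>R (f (x p) * g (y p) * jac p)" for p
      unfolding eq[symmetric] using fg jac_nonneg by (auto simp: indicator_def)
    then show "AE p in lborel. 0 \<le> indicat_real (triangle N N) p *\<^sub>R (f (x p) * g (y p) * jac p)" by simp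
  qed
  also have "\<dots> = ennreal (H B) * ennreal (G D)" unfolding I using HG0 by (simp add: ennreal_mult)
  also have "\<dots> = (\<integral>\<^sup>+z. ennreal (f z) \<partial>lborel) * (\<integral>\<^sup>+z. ennreal (g z) \<partial>lborel)"
    using nn_integral_has_integral_lborel[OF borel_measurable_continuous_onI[OF cf] fg(1) H(3)[of B]]
      nn_integral_has_integral_lborel[OF borel_measurable_continuous_onI[OF cg] fg(2) G(3)[of D]] by simp
  also have "\<dots> = (\<integral>\<^sup>+u. \<integral>\<^sup>+v. ennreal (f u) * ennreal (g v) \<partial>lborel \<partial>lborel)"
    using borel_measurable_continuous_onI[OF cf] borel_measurable_continuous_onI[OF cg]
    by (simp add: nn_integral_cmult nn_integral_multc)
  also have "\<dots> = (\<integral>\<^sup>+z. ennreal (f (fst z)) * ennreal (g (snd z)) \<partial>(lborel \<Otimes>\<^sub>M lborel))"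
  proof -
    have "continuous_on UNIV (\<lambda>z :: real \<times> real. f (fst z))" "continuous_on UNIV (\<lambda>z :: real \<times> real. g (snd z))"
      by (intro continuous_on_compose2[OF cf] continuous_on_compose2[OF cg] continuous_intros; simp)+
    from this[THEN borel_measurable_continuous_onI]
    have "(\<lambda>z. ennreal (f (fst z)) * ennreal (g (snd z))) \<in> borel_measurable (lborel \<Otimes>\<^sub>M lborel)"
      unfolding lborel_prod by simp
    from lborel.nn_integral_fst[OF this] show ?thesis by simp
  qed
  also have "\<dots> = (\<integral>\<^sup>+z. ennreal (f (fst z) * g (snd z)) \<partial>lborel)"
    using fg by (simp add: lborel_prod ennreal_mult)
  finally show ?thesis unfolding f_def g_def .
qed

text \<open>The flow continues past \<open>y = 0\<close>, since the coefficient \<open>k\<close> is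
  defined on the whole line; only the part over the open strip represents the given metric.\<close>

definition flow_domain :: "(real \<times> real) set" where
  "flow_domain = {p \<in> upper_half. y p \<in> {- y0<..<0}}"

lemma flow_domain_borel [measurable]: "flow_domain \<in> sets borel"
proof -
  have [measurable]: "y \<in> borel_measurable borel" by (rule loc_bdd_measurableD(1)[OF lbm_basic(5)])
  have "flow_domain = upper_half \<inter> (y -` {- y0<..<0} \<inter> space borel)" by (auto simp: flow_domain_def)
  then show ?thesis by (simp add: measurable_sets_borel)
qed

lemma flow_measurable [measurable]: "(\<lambda>p. (x p, y p)) \<in> borel \<rightarrow>\<^sub>M borel"
  using loc_bdd_measurableD(1)[OF loc_bdd_measurable_Pair[OF lbm_x lbm_basic(5)]] .

text \<open>As an identity of measures this also contains surjectivity: the complement of the image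
  of the flow in the strip is null. It suffices to compare products of bumps, which
  \<open>jac_integral_bump\<close> does.\<close>

lemma change_of_variables:
  "density lborel (indicator (UNIV \<times> {- y0<..<0})) =
    distr (density lborel (\<lambda>p. ennreal (indicator flow_domain p * jac p))) borel (\<lambda>p. (x p, y p))"
  (is "?M = ?N")
proof (rule strip_measure_eqI[where l = "- y0" and u = 0])
  let ?S = "UNIV \<times> {- y0<..<0 :: real} :: (real \<times> real) set"
  have S [measurable]: "?S \<in> sets borel" by (intro borel_open open_Times) auto
  then have nS: "- ?S \<in> sets borel" by (rule borel_comp)
  have J [measurable]: "jac \<in> borel_measurable borel" by (rule loc_bdd_measurableD(1)[OF lbm_jac])
  have dens: "(\<lambda>p. ennreal (indicator flow_domain p * jac p)) \<in> borel_measurable borel" by measurable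
  show "sets ?M = sets borel" "sets ?N = sets borel" by simp_all
  have "emeasure ?M (- ?S) = (\<integral>\<^sup>+z. indicator ?S z * indicator (- ?S) z \<partial>lborel)"
    by (rule emeasure_density) (use S nS in simp_all)
  also have "\<dots> = integral\<^sup>N lborel (\<lambda>_ :: real \<times> real. 0)" by (intro nn_integral_cong) (auto simp: indicator_def)
  finally show "emeasure ?M (- ?S) = 0" by simp
  have "emeasure ?N (- ?S) = (\<integral>\<^sup>+p. ennreal (indicator flow_domain p * jac p) * indicator (- ?S) (x p, y p) \<partial>lborel)"
  proof -
    have "emeasure ?N (- ?S) = (\<integral>\<^sup>+z. indicator (- ?S) z \<partial>?N)" using nS by (simp only: nn_integral_indicator sets_distr)
    also have "\<dots> = (\<integral>\<^sup>+p. indicator (- ?S) (x p, y p) \<partial>density lborel (\<lambda>p. ennreal (indicator flow_domain p * jac p)))"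
      by (rule nn_integral_distr) (use nS in \<open>auto simp: flow_measurable intro!: borel_measurable_indicator\<close>)
    also have "\<dots> = (\<integral>\<^sup>+p. ennreal (indicator flow_domain p * jac p) * indicator (- ?S) (x p, y p) \<partial>lborel)"
      by (rule nn_integral_density)
        (use measurable_compose[OF flow_measurable borel_measurable_indicator[OF nS]] dens in simp_all)
    finally show ?thesis .
  qed
  also have "\<dots> = integral\<^sup>N lborel (\<lambda>_ :: real \<times> real. 0)"
    by (intro nn_integral_cong) (auto simp: indicator_def flow_domain_def)
  finally show "emeasure ?N (- ?S) = 0" by simp
  fix p q :: "real \<times> real"
  have "emeasure ?M (box p q) = (\<integral>\<^sup>+z. indicator ?S z * indicator (box p q) z \<partial>lborel)"
    by (rule emeasure_density) (use S in auto)
  also have "\<dots> \<le> (\<integral>\<^sup>+z. indicator (box p q) z \<partial>lborel)"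
    by (intro nn_integral_mono) (auto simp: indicator_def)
  also have "\<dots> = emeasure lborel (box p q)" by simp
  also have "\<dots> < \<infinity>" using emeasure_bounded_finite[OF bounded_box] by simp
  finally show "emeasure ?M (box p q) < \<infinity>" .
next
  fix A B C D :: real and n :: nat
  assume as: "A < B" "- y0 \<le> C" "C < D" "D \<le> 0"
  let ?F = "\<lambda>z. ennreal (bump A B n (fst z) * bump C D n (snd z))"
  have [measurable]: "bump A B n \<in> borel_measurable borel" "bump C D n \<in> borel_measurable borel"
    using bump_continuous borel_measurable_continuous_onI by blast+
  have F: "?F \<in> borel_measurable borel"
    unfolding borel_prod[symmetric] by measurable
  have S: "UNIV \<times> {- y0<..<0 :: real} \<in> sets (borel :: (real \<times> real) measure)" by (intro borel_open open_Times) auto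
  have J [measurable]: "jac \<in> borel_measurable borel" by (rule loc_bdd_measurableD(1)[OF lbm_jac])
  have dens: "(\<lambda>p. ennreal (indicator flow_domain p * jac p)) \<in> borel_measurable borel" by measurable
  have z0: "bump C D n z = 0" if "z \<notin> {- y0<..<0}" for z
    by (rule bump_outside[OF as(3)]) (use that as in auto)
  have "(\<integral>\<^sup>+z. ?F z \<partial>?M) = (\<integral>\<^sup>+z. indicator (UNIV \<times> {- y0<..<0}) z * ?F z \<partial>lborel)"
    by (rule nn_integral_density) (use S F in auto)
  also have "\<dots> = (\<integral>\<^sup>+z. ?F z \<partial>lborel)"
  proof (intro nn_integral_cong)
    fix z :: "real \<times> real"
    show "indicator (UNIV \<times> {- y0<..<0}) z * ?F z = ?F z"
      using z0[of "snd z"] by (cases "snd z \<in> {- y0<..<0}") (auto simp: indicator_def mem_Times_iff)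
  qed
  also have "\<dots> = (\<integral>\<^sup>+p. ennreal (indicator upper_half p * (bump A B n (x p) * bump C D n (y p) * jac p)) \<partial>lborel)"
    using jac_integral_bump[OF as] by simp
  also have "\<dots> = (\<integral>\<^sup>+p. ennreal (indicator flow_domain p * jac p) * ?F (x p, y p) \<partial>lborel)"
  proof (intro nn_integral_cong)
    fix p
    show "ennreal (indicator upper_half p * (bump A B n (x p) * bump C D n (y p) * jac p)) =
        ennreal (indicator flow_domain p * jac p) * ?F (x p, y p)"
    proof (cases "p \<in> upper_half \<and> y p \<in> {- y0<..<0}")
      case True
      then show ?thesis
        using jac_nonneg[of p] by (simp add: flow_domain_def ennreal_mult[symmetric] bump_nonneg mult.commute)
    next
      case False
      then show ?thesis using z0[of "y p"] by (auto simp: flow_domain_def)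
    qed
  qed
  also have "\<dots> = (\<integral>\<^sup>+p. ?F (x p, y p) \<partial>density lborel (\<lambda>p. ennreal (indicator flow_domain p * jac p)))"
    by (rule nn_integral_density[symmetric]) (use F dens flow_measurable in measurable)
  also have "\<dots> = (\<integral>\<^sup>+z. ?F z \<partial>?N)"
    by (rule nn_integral_distr[symmetric]) (use F in \<open>auto simp: flow_measurable\<close>)
  finally show "(\<integral>\<^sup>+z. ?F z \<partial>?M) = (\<integral>\<^sup>+z. ?F z \<partial>?N)" .
qed

lemma integral_change_of_variables:
  fixes h :: "real \<times> real \<Rightarrow> real"
  assumes h [measurable]: "h \<in> borel_measurable borel"
  shows "(LINT z:UNIV \<times> {- y0<..<0}|lborel. h z) = (LINT p:flow_domain|lborel. jac p * h (x p, y p))"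
proof -
  let ?S = "UNIV \<times> {- y0<..<0 :: real} :: (real \<times> real) set"
  have S [measurable]: "?S \<in> sets borel" by (intro borel_open open_Times) auto
  have J [measurable]: "jac \<in> borel_measurable borel" by (rule loc_bdd_measurableD(1)[OF lbm_jac])
  have nn: "0 \<le> indicator flow_domain p * jac p" for p
    using jac_nonneg by (auto simp: indicator_def flow_domain_def)
  have "(LINT z:?S|lborel. h z) = (LINT z|density lborel (\<lambda>z. ennreal (indicator ?S z)). h z)"
    unfolding set_lebesgue_integral_def by (rule integral_density[symmetric]) (use h S in auto)
  also have "density lborel (\<lambda>z. ennreal (indicator ?S z)) = density lborel (indicator ?S)"
    by (simp add: ennreal_indicator)
  also have "(LINT z|density lborel (indicator ?S). h z) =
      (LINT p|density lborel (\<lambda>p. ennreal (indicator flow_domain p * jac p)). h (x p, y p))"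
    unfolding change_of_variables by (rule integral_distr) (use flow_measurable h in auto)
  also have "\<dots> = (LINT p|lborel. (indicator flow_domain p * jac p) *\<^sub>R h (x p, y p))"
  proof (rule integral_density)
    show "(\<lambda>p. h (x p, y p)) \<in> borel_measurable lborel"
      using measurable_compose[OF flow_measurable h] by simp
  qed (use nn in \<open>measurable, auto\<close>)
  finally show ?thesis by (simp add: set_lebesgue_integral_def mult.assoc)
qed

end

section \<open>The weak form in characteristic coordinates\<close>

lemma AE_off_antidiagonal: "AE p in lborel. - fst p \<noteq> (snd p :: real)"
proof -
  have "negligible {p :: real \<times> real. (1, 1) \<bullet> p = 0}"
    by (rule negligible_hyperplane) (simp add: zero_prod_def)
  then have "{p :: real \<times> real. (1, 1) \<bullet> p = 0} \<in> null_sets lebesgue"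
    by (simp add: negligible_iff_null_sets)
  then have "AE p in lebesgue. p \<notin> {p :: real \<times> real. (1, 1) \<bullet> p = 0}"
    by (rule AE_not_in)
  then have "AE p in lborel. p \<notin> {p :: real \<times> real. (1, 1) \<bullet> p = 0}"
    by (simp only: AE_completion_iff)
  then show ?thesis
    by eventually_elim (auto simp: inner_prod_def)
qed

context helicoid_flow
begin

lemma continuous_flow: "continuous_on upper_half (\<lambda>p. (x p, y p))"
proof -
  have pos: "0 \<le> slope_min" using slope_min_pos by simp
  have "continuous_on upper_half x"
    by (rule continuous_on_upper_half[OF xt _ xs, of slope_max])
      (use slope_bounds(3,4,9,10) pos in \<open>force simp: abs_le_iff\<close>)+
  moreover have "continuous_on upper_half y"
    by (rule continuous_on_upper_half[OF yt _ ys, of slope_max])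
      (use slope_bounds(1,2,7,8) pos in \<open>force simp: abs_le_iff\<close>)+
  ultimately show ?thesis by (rule continuous_on_Pair)
qed

lemma inj_flow: "inj_on (\<lambda>p. (x p, y p)) upper_half"
proof (rule inj_onI)
  fix p q assume "p \<in> upper_half" "q \<in> upper_half" "(x p, y p) = (x q, y q)"
  then have "slope_min * dist p q \<le> 0" using expanding[of p q] by simp
  then show "p = q" using slope_min_pos by (simp add: mult_le_0_iff)
qed

definition flow_image :: "(real \<times> real) set" where
  "flow_image = (\<lambda>p. (x p, y p)) ` upper_half"

text \<open>The default value \<open>(0, 0)\<close> lies in \<open>upper_half\<close>. Hence bounds
  and algebraic identities for functions of \<open>inv_flow z\<close> hold at every
  \<open>z\<close>, also off the image.\<close>

definition inv_flow :: "real \<times> real \<Rightarrow> real \<times> real" where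
  "inv_flow z = (if z \<in> flow_image then inv_into upper_half (\<lambda>p. (x p, y p)) z else (0, 0))"

lemma inv_flow_upper_half: "inv_flow z \<in> upper_half"
  using inv_into_into[of z "\<lambda>p. (x p, y p)" upper_half]
  by (auto simp: inv_flow_def flow_image_def upper_half_def)

lemma inv_flow_flow: "p \<in> upper_half \<Longrightarrow> inv_flow (x p, y p) = p"
  using inv_into_f_f[OF inj_flow, of p] by (auto simp: inv_flow_def flow_image_def)

text \<open>The closed half plane is a countable union of compact sets, and so is its continuous
  image.\<close>

lemma flow_image_borel: "flow_image \<in> sets borel"
proof -
  have "compact (upper_half \<inter> cball 0 (real n))" for n
    by (rule closed_Int_compact[OF closed_upper_half compact_cball])
  then have "compact ((\<lambda>p. (x p, y p)) ` (upper_half \<inter> cball 0 (real n)))" for n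
    by (intro compact_continuous_image continuous_on_subset[OF continuous_flow]) auto
  then have "(\<Union>n. (\<lambda>p. (x p, y p)) ` (upper_half \<inter> cball 0 (real n))) \<in> sets borel"
    by (intro sets.countable_UN) (auto intro: borel_compact)
  moreover have "(\<Union>n. (\<lambda>p. (x p, y p)) ` (upper_half \<inter> cball 0 (real n))) = flow_image"
    unfolding flow_image_def using real_arch_simple by (fastforce simp: image_iff)
  ultimately show ?thesis by simp
qed

text \<open>By \<open>expanding\<close> the inverse is Lipschitz on the image; off the image it is
  constant.\<close>

lemma inv_flow_measurable [measurable]: "inv_flow \<in> borel \<rightarrow>\<^sub>M borel"
proof -
  let ?i = "inv_into upper_half (\<lambda>p. (x p, y p))"
  have "(1 / slope_min)-lipschitz_on flow_image ?i"
  proof (rule lipschitz_onI)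
    fix z w assume zw: "z \<in> flow_image" "w \<in> flow_image"
    then obtain p q where pq: "p \<in> upper_half" "q \<in> upper_half" "z = (x p, y p)" "w = (x q, y q)"
      unfolding flow_image_def by auto
    then have "?i z = p" "?i w = q" using inv_into_f_f[OF inj_flow] by auto
    then show "dist (?i z) (?i w) \<le> 1 / slope_min * dist z w"
      using expanding[OF pq(1,2)] slope_min_pos pq by (simp add: field_simps)
  qed (use slope_min_pos in simp)
  then have "continuous_on flow_image ?i" by (rule lipschitz_on_continuous_on)
  then show ?thesis
    unfolding inv_flow_def by (intro borel_measurable_continuous_on_if flow_image_borel continuous_on_const)
qed

text \<open>In characteristic coordinates the form \<open>(A \<phi>_x + B \<phi>_y) dx dy\<close> becomes
  \<open>(\<mu> \<psi>_s + \<nu> \<psi>_t) ds dt\<close>, so that the weak form reduces to integrations by parts along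
  coordinate lines.\<close>

lemma weak_form:
  fixes A B C \<phi> \<phi>x \<phi>y :: "real \<times> real \<Rightarrow> real"
  assumes \<phi>: "\<And>p. (\<phi> has_derivative (\<lambda>h. \<phi>x p * fst h + \<phi>y p * snd h)) (at p)"
      "continuous_on UNIV \<phi>x" "continuous_on UNIV \<phi>y"
    and supp: "\<And>X Y. - y0 \<le> Y \<Longrightarrow> R \<le> \<bar>X\<bar> \<or> 0 \<le> Y \<Longrightarrow> \<phi> (X, Y) = 0"
      "\<And>X Y. - y0 < Y \<Longrightarrow> R \<le> \<bar>X\<bar> \<or> 0 \<le> Y \<Longrightarrow> \<phi>x (X, Y) = 0 \<and> \<phi>y (X, Y) = 0"
    and \<mu>: "has_ds \<mu> \<mu>'" and \<nu>: "has_dt \<nu> \<nu>'"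
    and meas: "A \<in> borel_measurable borel" "B \<in> borel_measurable borel" "C \<in> borel_measurable borel"
    and AB: "\<And>p X Y. p \<in> upper_half \<Longrightarrow> jac p * (A (x p, y p) * X + B (x p, y p) * Y) =
      \<mu> p * (X * (P p * a p * \<rho> p) + Y * a p) + \<nu> p * (X * (- (Q p * b p * \<rho> p)) + Y * b p)"
    and C: "\<And>p. p \<in> upper_half \<Longrightarrow> jac p * C (x p, y p) = - (\<mu>' p + \<nu>' p)"
  shows "(LINT z:UNIV \<times> {- y0<..<0}|lborel. A z * \<phi>x z + B z * \<phi>y z)
      + (LINT s|lborel. (\<mu> (s, - s) + \<nu> (s, - s)) * \<phi> (s, - y0))
    = (LINT z:UNIV \<times> {- y0<..<0}|lborel. C z * \<phi> z)"
proof -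
  define \<psi> where "\<psi> p = \<phi> (x p, y p)" for p
  define \<psi>s where "\<psi>s p = \<phi>x (x p, y p) * (P p * a p * \<rho> p) + \<phi>y (x p, y p) * a p" for p
  define \<psi>t where "\<psi>t p = \<phi>x (x p, y p) * (- (Q p * b p * \<rho> p)) + \<phi>y (x p, y p) * b p" for p
  have \<psi>: "has_ds \<psi> \<psi>s" "has_dt \<psi> \<psi>t"
    unfolding \<psi>_def[abs_def] \<psi>s_def[abs_def] \<psi>t_def[abs_def]
    by (rule has_ds_compose2[OF xs ys \<phi>] has_dt_compose2[OF xt yt \<phi>])+
  have c\<phi>: "continuous_on UNIV \<phi>"
    using \<phi>(1) has_derivative_continuous continuous_at_imp_continuous_on by blast
  have m\<phi> [measurable]: "\<phi> \<in> borel_measurable borel" "\<phi>x \<in> borel_measurable borel" "\<phi>y \<in> borel_measurable borel"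
    using c\<phi> \<phi>(2,3) borel_measurable_continuous_onI by blast+
  note [measurable] = meas
  define N where "N = \<bar>R\<bar> + speed_max * y0"
  have N: "0 \<le> N" "\<bar>R\<bar> \<le> N" "\<bar>R\<bar> + speed_max * y0 \<le> N"
    using speed_max_nonneg y0 by (auto simp: N_def)
  have far: "R \<le> \<bar>x (s, t)\<bar> \<or> 0 \<le> y (s, t)" if "- s \<le> t" "N \<le> s \<or> N \<le> t" for s t
  proof (cases "0 \<le> y (s, t)")
    case False
    then have "speed_max * (y (s, t) + y0) \<le> speed_max * y0"
      using speed_max_nonneg by (intro mult_left_mono) auto
    then show ?thesis using finite_speed[OF that(1)] N that(2) by linarith
  qed simp
  have far\<psi>: "\<psi> (s, t) = 0" if "- s \<le> t" "N \<le> s \<or> N \<le> t" for s t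
    unfolding \<psi>_def using supp(1)[OF y_ge[OF that(1)] far[OF that]] .
  have tri: "triangle N N \<subseteq> upper_half" by (auto simp: triangle_def upper_half_def)
  have y_gt: "- y0 < y p" if "p \<in> upper_half" "- fst p \<noteq> snd p" for p
  proof -
    obtain s t where p: "p = (s, t)" by fastforce
    have "0 < char_min * (s + t)" using that char_bounds_pos p by (auto simp: upper_half_def)
    then show ?thesis using y_growth[of s t] that p by (auto simp: upper_half_def)
  qed
  \<comment> \<open>By \<open>far\<close>, the support of the integrand corresponds to a subset of
    one fixed triangle. The triangle contains its antidiagonal side while \<open>flow_domain\<close>
    omits it, so the two integrands agree only almost everywhere; this is why \<open>h0\<close> can
    be restricted to \<open>- y0 < Y\<close>.\<close>
  have to_triangle: "(LINT z:UNIV \<times> {- y0<..<0}|lborel. h z) = (LINT p:triangle N N|lborel. f p)"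
    if h: "h \<in> borel_measurable borel" and f: "loc_bdd_measurable f"
      and hf: "\<And>p. p \<in> upper_half \<Longrightarrow> jac p * h (x p, y p) = f p"
      and h0: "\<And>X Y. - y0 < Y \<Longrightarrow> R \<le> \<bar>X\<bar> \<or> 0 \<le> Y \<Longrightarrow> h (X, Y) = 0" for h f
  proof -
    have [measurable]: "f \<in> borel_measurable borel" by (rule loc_bdd_measurableD(1)[OF f])
    have J [measurable]: "jac \<in> borel_measurable borel" by (rule loc_bdd_measurableD(1)[OF lbm_jac])
    have hm: "(\<lambda>p. h (x p, y p)) \<in> borel_measurable borel"
      using measurable_compose[OF flow_measurable h] by simp
    have "(LINT z:UNIV \<times> {- y0<..<0}|lborel. h z) = (LINT p:flow_domain|lborel. jac p * h (x p, y p))"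
      by (rule integral_change_of_variables[OF h])
    also have "\<dots> = (LINT p:triangle N N|lborel. f p)"
      unfolding set_lebesgue_integral_def
    proof (rule integral_cong_AE)
      show "(\<lambda>p. indicat_real flow_domain p *\<^sub>R (jac p * h (x p, y p))) \<in> borel_measurable lborel"
        using hm by measurable
      show "(\<lambda>p. indicat_real (triangle N N) p *\<^sub>R f p) \<in> borel_measurable lborel"
        by measurable
      show "AE p in lborel. indicat_real flow_domain p *\<^sub>R (jac p * h (x p, y p)) = indicat_real (triangle N N) p *\<^sub>R f p"
        using AE_off_antidiagonal
      proof eventually_elim
        case (elim p)
        obtain s t where p: "p = (s, t)" by fastforce
        show ?case
        proof (cases "p \<in> upper_half")
          case True
          have y: "- y0 < y p" by (rule y_gt[OF True elim])
          have st: "- s \<le> t" using True p by (simp add: upper_half_def)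
          show ?thesis
          proof (cases "p \<in> flow_domain \<and> p \<in> triangle N N")
            case True
            then show ?thesis using hf[OF \<open>p \<in> upper_half\<close>] by simp
          next
            case False
            then have "R \<le> \<bar>x p\<bar> \<or> 0 \<le> y p"
              using far[OF st] st y True by (auto simp: p flow_domain_def triangle_def)
            then have "h (x p, y p) = 0" by (rule h0[OF y])
            then show ?thesis using hf[OF True] by auto
          qed
        next
          case False
          then show ?thesis using tri by (auto simp: indicator_def flow_domain_def)
        qed
      qed
    qed
    finally show ?thesis .
  qed
  have lb: "loc_bdd_measurable (\<lambda>p. \<mu> p * \<psi>s p + \<nu> p * \<psi>t p)" "loc_bdd_measurable (\<lambda>p. - ((\<mu>' p + \<nu>' p) * \<psi> p))"
  proof -
    show "loc_bdd_measurable (\<lambda>p. \<mu> p * \<psi>s p + \<nu> p * \<psi>t p)"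
      by (intro loc_bdd_measurable_arith(1,3) has_dsD(1)[OF \<mu>] has_dtD(1)[OF \<nu>] has_dsD(2)[OF \<psi>(1)] has_dtD(2)[OF \<psi>(2)])
    have "loc_bdd_measurable (\<lambda>p. - 1 * ((\<mu>' p + \<nu>' p) * \<psi> p))"
      by (intro loc_bdd_measurable_arith(1,3) loc_bdd_measurable_const has_dsD(2)[OF \<mu>] has_dtD(2)[OF \<nu>] has_dsD(1)[OF \<psi>(1)])
    then show "loc_bdd_measurable (\<lambda>p. - ((\<mu>' p + \<nu>' p) * \<psi> p))" by simp
  qed
  have 1: "(LINT z:UNIV \<times> {- y0<..<0}|lborel. A z * \<phi>x z + B z * \<phi>y z) =
      (LINT p:triangle N N|lborel. \<mu> p * \<psi>s p + \<nu> p * \<psi>t p)"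
  proof (rule to_triangle[OF _ lb(1)])
    show "jac p * (A (x p, y p) * \<phi>x (x p, y p) + B (x p, y p) * \<phi>y (x p, y p)) = \<mu> p * \<psi>s p + \<nu> p * \<psi>t p"
      if "p \<in> upper_half" for p
      unfolding \<psi>s_def \<psi>t_def by (rule AB[OF that])
  qed (use supp(2) in \<open>auto\<close>)
  have 2: "(LINT z:UNIV \<times> {- y0<..<0}|lborel. C z * \<phi> z) = (LINT p:triangle N N|lborel. - ((\<mu>' p + \<nu>' p) * \<psi> p))"
  proof (rule to_triangle[OF _ lb(2)])
    show "jac p * (C (x p, y p) * \<phi> (x p, y p)) = - ((\<mu>' p + \<nu>' p) * \<psi> p)" if "p \<in> upper_half" for p
      using C[OF that] by (simp only: \<psi>_def mult.assoc[symmetric] mult_minus_left)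
  qed (use supp(1) in \<open>auto\<close>)
  \<comment> \<open>The difference of the two area integrals is that of the exact derivatives of
    \<open>\<mu> \<psi>\<close> in \<open>s\<close> and \<open>\<nu> \<psi>\<close> in
    \<open>t\<close>. On \<open>s = N\<close> and \<open>t = N\<close> the test function vanishes;
    the antidiagonal contributes the data with a minus sign.\<close>
  define f where "f p = \<mu>' p * \<psi> p + \<mu> p * \<psi>s p" for p
  define g where "g p = \<nu>' p * \<psi> p + \<nu> p * \<psi>t p" for p
  have fg: "has_ds (\<lambda>p. \<mu> p * \<psi> p) f" "has_dt (\<lambda>p. \<nu> p * \<psi> p) g"
    unfolding f_def[abs_def] g_def[abs_def] by (rule has_ds_mult[OF \<mu> \<psi>(1)] has_dt_mult[OF \<nu> \<psi>(2)])+
  have si: "set_integrable lborel (triangle N N) h" if "loc_bdd_measurable h" for h :: "real \<times> real \<Rightarrow> real"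
    by (rule loc_bdd_measurable_integrable[OF that triangle_bounded triangle_borel])
  have "(LINT p:triangle N N|lborel. \<mu> p * \<psi>s p + \<nu> p * \<psi>t p) - (LINT p:triangle N N|lborel. - ((\<mu>' p + \<nu>' p) * \<psi> p)) =
      (LINT p:triangle N N|lborel. f p + g p)"
    by (subst set_integral_diff(2)[symmetric, OF si[OF lb(1)] si[OF lb(2)]]) (simp add: f_def g_def algebra_simps)
  also have "\<dots> = (LINT p:triangle N N|lborel. f p) + (LINT p:triangle N N|lborel. g p)"
    by (rule set_integral_add(2)[OF si[OF has_dsD(2)[OF fg(1)]] si[OF has_dtD(2)[OF fg(2)]]])
  also have "(LINT p:triangle N N|lborel. f p) = (LINT t:{- N..N}|lborel. - (\<mu> (- t, t) * \<phi> (- t, - y0)))"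
    unfolding has_ds_triangle[OF fg(1)]
    by (rule set_lebesgue_integral_cong) (use far\<psi> x_init[of "- _", simplified] in \<open>auto simp: \<psi>_def init'\<close>)
  also have "\<dots> = (LINT s:{- N..N}|lborel. - (\<mu> (s, - s) * \<phi> (s, - y0)))"
    using set_integral_reflect[where a = "- N" and b = N and f = "\<lambda>s. - (\<mu> (s, - s) * \<phi> (s, - y0))"] by simp
  also have "(LINT p:triangle N N|lborel. g p) = (LINT s:{- N..N}|lborel. - (\<nu> (s, - s) * \<phi> (s, - y0)))"
    unfolding has_dt_triangle[OF fg(2)]
    by (rule set_lebesgue_integral_cong) (use far\<psi> in \<open>auto simp: \<psi>_def init x_init\<close>)
  also have "(LINT s:{- N..N}|lborel. - (\<mu> (s, - s) * \<phi> (s, - y0))) + (LINT s:{- N..N}|lborel. - (\<nu> (s, - s) * \<phi> (s, - y0))) =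
      (LINT s:{- N..N}|lborel. - ((\<mu> (s, - s) + \<nu> (s, - s)) * \<phi> (s, - y0)))"
  proof -
    have d: "loc_bdd_measurable (\<lambda>s. h (s, - s))" if "loc_bdd_measurable h" for h :: "real \<times> real \<Rightarrow> real"
      by (rule loc_bdd_measurable_compose_continuous[OF that]) (intro continuous_intros)
    have e: "loc_bdd_measurable (\<lambda>s. \<phi> (s, - y0))"
      by (rule loc_bdd_measurable_compose_continuous[OF loc_bdd_measurable_continuous[OF c\<phi>]]) (intro continuous_intros)
    have i: "set_integrable lborel {- N..N} (\<lambda>s. - (h (s, - s) * \<phi> (s, - y0)))" if "loc_bdd_measurable h" for h :: "real \<times> real \<Rightarrow> real"
      using loc_bdd_measurable_integrable[OF loc_bdd_measurable_arith(3)[OF loc_bdd_measurable_const[of "- 1"]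
            loc_bdd_measurable_arith(3)[OF d[OF that] e]], of "{- N..N}"] by simp
    show ?thesis
      by (subst set_integral_add(2)[symmetric, OF i[OF has_dsD(1)[OF \<mu>]] i[OF has_dtD(1)[OF \<nu>]]]) (simp add: algebra_simps)
  qed
  also have "\<dots> = - (LINT s|lborel. (\<mu> (s, - s) + \<nu> (s, - s)) * \<phi> (s, - y0))"
  proof -
    have "indicat_real {- N..N} s * \<phi> (s, - y0) = \<phi> (s, - y0)" for s
    proof (cases "s \<in> {- N..N}")
      case False
      then have "R \<le> \<bar>s\<bar>" using N by auto
      then show ?thesis using supp(1)[of "- y0" s] by simp
    qed simp
    then have eq: "indicat_real {- N..N} s *\<^sub>R - ((\<mu> (s, - s) + \<nu> (s, - s)) * \<phi> (s, - y0)) = - ((\<mu> (s, - s) + \<nu> (s, - s)) * \<phi> (s, - y0))" for s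
      by (metis (no_types, lifting) mult.left_commute mult_minus_right real_scaleR_def)
    show ?thesis unfolding set_lebesgue_integral_def eq by simp
  qed
  finally show ?thesis using 1 2 by simp
qed

end

lemma helicoid_flow_exists:
  assumes "helicoid_data c e0 g0 y0 m U S k \<sigma> P0 Q0"
  obtains P Q a b y where "helicoid_flow c e0 g0 y0 m U S k \<sigma> P0 Q0 P Q a b y"
proof -
  interpret helicoid_data c e0 g0 y0 m U S k \<sigma> P0 Q0 by fact
  show thesis
    by (rule characteristic_solution, rule that, unfold_locales) (assumption | blast)+
qed

context helicoid_flow
begin

section \<open>The solution \<open>(L, M, N)\<close> and its Gauss and Codazzi equations\<close>

text \<open>\<open>P \<rho>\<close> and \<open>- Q \<rho>\<close> are the Riemann invariants
  \<open>u + v\<close> and \<open>u - v\<close>; \<open>u\<close> and \<open>v\<close> are half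
  their sum and half their difference.\<close>

definition vel_u :: "real \<times> real \<Rightarrow> real" where "vel_u p = (P p - Q p) * \<rho> p / 2"
definition vel_v :: "real \<times> real \<Rightarrow> real" where "vel_v p = (P p + Q p) * \<rho> p / 2"
definition gam :: "real \<Rightarrow> real" where "gam z = g0 * exp (2 * c * \<sigma> z)"

definition L_sol :: "real \<times> real \<Rightarrow> real" where
  "L_sol z = gam (snd z) / vel_v (inv_flow z)"
definition M_sol :: "real \<times> real \<Rightarrow> real" where
  "M_sol z = - gam (snd z) * vel_u (inv_flow z) / vel_v (inv_flow z)"
definition N_sol :: "real \<times> real \<Rightarrow> real" where
  "N_sol z = gam (snd z) * ((vel_u (inv_flow z))\<^sup>2 - (vel_v (inv_flow z))\<^sup>2) / vel_v (inv_flow z)"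

lemma pos_above:
  assumes "p \<in> upper_half"
  shows "0 < P p" "0 < Q p" "0 < a p" "0 < b p" "0 < \<rho> p"
proof -
  obtain s t where p: "p = (s, t)" "- s \<le> t" using assms by (cases p) (auto simp: upper_half_def)
  show "0 < P p" "0 < Q p" "0 < a p" "0 < b p" "0 < \<rho> p"
    using bounds[OF p(2)] char_bounds_pos m e0 unfolding p(1) by (auto simp: \<rho>_def)
qed

lemma gam_pos: "0 < gam z" using g0 by (simp add: gam_def)

lemma gam_bound: "gam z \<le> g0 * exp (2 * c * S)"
  using \<sigma>(3)[of z] c g0 by (simp add: gam_def)

lemma vel_bounds:
  assumes "p \<in> upper_half"
  shows "m / e0 \<le> vel_v p" "vel_v p \<le> speed_max" "\<bar>vel_u p\<bar> \<le> vel_v p"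
proof -
  obtain s t where p: "p = (s, t)" "- s \<le> t" using assms by (cases p) (auto simp: upper_half_def)
  note B = bounds(1,2)[OF p(2), folded p(1)] \<rho>_bounds[OF p(2), folded p(1)] and pos = pos_above[OF assms]
  have "2 * m * (1 / e0) \<le> (P p + Q p) * \<rho> p"
    using B pos m e0 by (intro mult_mono) auto
  then show "m / e0 \<le> vel_v p" by (simp add: vel_v_def mult.commute)
  have "(P p + Q p) * \<rho> p \<le> (2 * U) * (exp S / e0)"
    using B pos m U_pos by (intro mult_mono) auto
  then show "vel_v p \<le> speed_max" by (simp add: vel_v_def speed_max_def mult_ac)
  have "\<bar>P p - Q p\<bar> * \<rho> p \<le> (P p + Q p) * \<rho> p"
    using pos by (intro mult_right_mono) auto
  then show "\<bar>vel_u p\<bar> \<le> vel_v p" using pos by (simp add: vel_u_def vel_v_def abs_mult)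
qed

lemma vel_v_pos: "p \<in> upper_half \<Longrightarrow> 0 < vel_v p"
  using pos_above[of p] by (simp add: vel_v_def)

lemma sol_measurable:
  "L_sol \<in> borel_measurable borel" "M_sol \<in> borel_measurable borel" "N_sol \<in> borel_measurable borel"
proof -
  have "continuous_on UNIV (\<lambda>z :: real \<times> real. gam (snd z))"
    unfolding gam_def by (intro continuous_intros continuous_on_compose2[OF continuous_\<sigma>]) auto
  then have [measurable]: "(\<lambda>z :: real \<times> real. gam (snd z)) \<in> borel_measurable borel"
    by (rule borel_measurable_continuous_onI)
  note m' = loc_bdd_measurableD(1)
  have [measurable]: "P \<in> borel_measurable borel" "Q \<in> borel_measurable borel" "\<rho> \<in> borel_measurable borel"
    using m'[OF lbm_basic(1)] m'[OF lbm_basic(2)] m'[OF lbm_\<rho>] by auto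
  have [measurable]: "vel_u \<in> borel_measurable borel" "vel_v \<in> borel_measurable borel"
    unfolding vel_u_def vel_v_def by measurable
  show "L_sol \<in> borel_measurable borel" "M_sol \<in> borel_measurable borel" "N_sol \<in> borel_measurable borel"
    unfolding L_sol_def[abs_def] M_sol_def[abs_def] N_sol_def[abs_def] by measurable
qed

lemma sol_bounded:
  obtains B where "\<And>z. \<bar>L_sol z\<bar> \<le> B" "\<And>z. \<bar>M_sol z\<bar> \<le> B" "\<And>z. \<bar>N_sol z\<bar> \<le> B"
proof -
  define g where "g = g0 * exp (2 * c * S)"
  have g: "0 < g" using g0 by (simp add: g_def)
  have L: "\<bar>L_sol z\<bar> \<le> g / (m / e0)" and M: "\<bar>M_sol z\<bar> \<le> g" and N: "\<bar>N_sol z\<bar> \<le> g * speed_max" for z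
  proof -
    define u v where "u = vel_u (inv_flow z)" and "v = vel_v (inv_flow z)"
    have uv: "m / e0 \<le> v" "v \<le> speed_max" "\<bar>u\<bar> \<le> v" "0 < v"
      using vel_bounds[OF inv_flow_upper_half] vel_v_pos[OF inv_flow_upper_half] by (auto simp: u_def v_def)
    have gz: "0 < gam (snd z)" "gam (snd z) \<le> g" using gam_pos gam_bound by (auto simp: g_def)
    have "gam (snd z) / v \<le> g / (m / e0)"
      by (rule frac_le) (use uv gz m e0 in auto)
    then show "\<bar>L_sol z\<bar> \<le> g / (m / e0)"
      using uv gz unfolding L_sol_def v_def[symmetric] by simp
    have "\<bar>M_sol z\<bar> = gam (snd z) * (\<bar>u\<bar> / v)"
      using gz uv unfolding M_sol_def v_def[symmetric] u_def[symmetric] by (simp add: abs_mult)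
    also have "\<dots> \<le> g * 1" using uv gz by (intro mult_mono) auto
    finally show "\<bar>M_sol z\<bar> \<le> g" by simp
    have "\<bar>u\<^sup>2 - v\<^sup>2\<bar> \<le> v\<^sup>2" using uv power_mono[of "\<bar>u\<bar>" v 2] by (simp add: abs_le_iff)
    then have "\<bar>u\<^sup>2 - v\<^sup>2\<bar> / v \<le> v" using uv by (simp add: divide_le_eq power2_eq_square)
    moreover have "\<bar>N_sol z\<bar> = gam (snd z) * (\<bar>u\<^sup>2 - v\<^sup>2\<bar> / v)"
      using gz uv unfolding N_sol_def v_def[symmetric] u_def[symmetric] by (simp add: abs_mult)
    ultimately have "\<bar>N_sol z\<bar> \<le> g * v" using gz uv mult_mono[of "gam (snd z)" g "\<bar>u\<^sup>2 - v\<^sup>2\<bar> / v" v] by simp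
    then show "\<bar>N_sol z\<bar> \<le> g * speed_max"
      using uv g mult_left_mono[of v speed_max g] by linarith
  qed
  define B where "B = max (g / (m / e0)) (max g (g * speed_max))"
  show thesis
    by (rule that[of B]) (use L M N in \<open>auto simp: B_def le_max_iff_disj\<close>)
qed

lemma gauss_equation: "L_sol z * N_sol z - (M_sol z)\<^sup>2 = - (gam (snd z))\<^sup>2"
proof -
  have "vel_v (inv_flow z) \<noteq> 0" using vel_v_pos[OF inv_flow_upper_half[of z]] by simp
  then show ?thesis
    unfolding L_sol_def M_sol_def N_sol_def by (simp add: field_simps power2_eq_square)
qed

text \<open>The Jacobian contains the factor \<open>P + Q\<close> and so cancels the denominator
  \<open>v\<close>. The products are polynomial in the flow variables and can be matched with the
  coefficients in \<open>weak_form\<close>.\<close>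

lemma jac_sol:
  assumes "p \<in> upper_half"
  shows "jac p * L_sol (x p, y p) = 2 * gam (y p) * a p * b p"
    "jac p * M_sol (x p, y p) = - gam (y p) * (P p - Q p) * a p * b p * \<rho> p"
    "jac p * N_sol (x p, y p) = - 2 * gam (y p) * P p * Q p * a p * b p * (\<rho> p)\<^sup>2"
proof -
  note pos = pos_above[OF assms]
  have nz: "P p + Q p \<noteq> 0" "\<rho> p \<noteq> 0" using pos by auto
  show "jac p * L_sol (x p, y p) = 2 * gam (y p) * a p * b p"
    using nz by (simp add: L_sol_def inv_flow_flow[OF assms] jac_def vel_v_def)
  show "jac p * M_sol (x p, y p) = - gam (y p) * (P p - Q p) * a p * b p * \<rho> p"
    using nz by (simp add: M_sol_def inv_flow_flow[OF assms] jac_def vel_v_def vel_u_def)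
  have "(vel_u p)\<^sup>2 - (vel_v p)\<^sup>2 = - (P p * Q p * (\<rho> p)\<^sup>2)"
    by (simp add: vel_u_def vel_v_def power2_eq_square algebra_simps add_divide_distrib diff_divide_distrib)
  then show "jac p * N_sol (x p, y p) = - 2 * gam (y p) * P p * Q p * a p * b p * (\<rho> p)\<^sup>2"
    using nz by (simp add: N_sol_def inv_flow_flow[OF assms] jac_def vel_v_def)
qed

lemma gam_dt: "has_dt (\<lambda>p. gam (y p)) (\<lambda>p. 2 * c * k (y p) * gam (y p) * b p)"
  and gam_ds: "has_ds (\<lambda>p. gam (y p)) (\<lambda>p. 2 * c * k (y p) * gam (y p) * a p)"
  unfolding gam_def
  by (rule has_dt_cong[OF has_dt_compose[OF yt exp_\<sigma>_deriv[of g0 "2 * c"]]], simp)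
    (rule has_ds_cong[OF has_ds_compose[OF ys exp_\<sigma>_deriv[of g0 "2 * c"]]], simp)

lemma sqrtE_\<rho>: "e0 * exp (- \<sigma> (y p)) * \<rho> p = 1"
  using e0 by (simp add: \<rho>_def exp_minus)

lemma coefficient_measurable:
  "(\<lambda>z. k (snd z) * (e0 * exp (- \<sigma> (snd z)))\<^sup>2) \<in> borel_measurable borel"
  "(\<lambda>z. - 2 * k (snd z)) \<in> borel_measurable borel"
  by (intro borel_measurable_continuous_onI continuous_intros
      continuous_on_compose2[OF continuous_k] continuous_on_compose2[OF continuous_\<sigma>]; simp)+

text \<open>Here \<open>\<mu> = \<gamma> b\<close> and \<open>\<nu> = \<gamma> a\<close>.
  Differentiating \<open>\<gamma>\<close> produces \<open>2 c\<close>, which cancels the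
  \<open>- 2 c\<close> in the source of \<open>a\<close> and \<open>b\<close>; the surviving
  \<open>P Q\<close> is the \<open>N\<close> term, because \<open>E\<close> times the square of
  \<open>\<rho>\<close> is \<open>1\<close>.\<close>

lemma first_codazzi:
  assumes \<phi>: "\<And>p. (\<phi> has_derivative (\<lambda>h. \<phi>x p * fst h + \<phi>y p * snd h)) (at p)"
      "continuous_on UNIV \<phi>x" "continuous_on UNIV \<phi>y"
    and supp: "\<And>X Y. - y0 \<le> Y \<Longrightarrow> R \<le> \<bar>X\<bar> \<or> 0 \<le> Y \<Longrightarrow> \<phi> (X, Y) = 0"
      "\<And>X Y. - y0 < Y \<Longrightarrow> R \<le> \<bar>X\<bar> \<or> 0 \<le> Y \<Longrightarrow> \<phi>x (X, Y) = 0 \<and> \<phi>y (X, Y) = 0"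
  shows "(LINT z:UNIV \<times> {- y0<..<0}|lborel. - M_sol z * \<phi>x z + L_sol z * \<phi>y z)
      + (LINT s|lborel. 2 * g0 * e0 / (P0 s + Q0 s) * \<phi> (s, - y0))
    = (LINT z:UNIV \<times> {- y0<..<0}|lborel. k (snd z) * (e0 * exp (- \<sigma> (snd z)))\<^sup>2 * N_sol z * \<phi> z)"
proof -
  have init_sum: "gam (y (s, - s)) * b (s, - s) + gam (y (s, - s)) * a (s, - s) = 2 * g0 * e0 / (P0 s + Q0 s)" for s
    by (simp add: init gam_def \<sigma>(2))
  have meas: "(\<lambda>z. - M_sol z) \<in> borel_measurable borel"
    "(\<lambda>z. k (snd z) * (e0 * exp (- \<sigma> (snd z)))\<^sup>2 * N_sol z) \<in> borel_measurable borel"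
    using sol_measurable borel_measurable_times[OF coefficient_measurable(1) sol_measurable(3)] by simp_all
  have "(LINT z:UNIV \<times> {- y0<..<0}|lborel. - M_sol z * \<phi>x z + L_sol z * \<phi>y z)
      + (LINT s|lborel. (gam (y (s, - s)) * b (s, - s) + gam (y (s, - s)) * a (s, - s)) * \<phi> (s, - y0))
    = (LINT z:UNIV \<times> {- y0<..<0}|lborel. k (snd z) * (e0 * exp (- \<sigma> (snd z)))\<^sup>2 * N_sol z * \<phi> z)"
  proof (rule weak_form[OF \<phi> supp has_ds_mult[OF gam_ds b] has_dt_mult[OF gam_dt a] meas(1) sol_measurable(1) meas(2)])
    fix p assume p: "p \<in> upper_half"
    fix X Y
    have "jac p * (- M_sol (x p, y p) * X + L_sol (x p, y p) * Y) = - (jac p * M_sol (x p, y p)) * X + jac p * L_sol (x p, y p) * Y"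
      by (simp add: algebra_simps)
    then show "jac p * (- M_sol (x p, y p) * X + L_sol (x p, y p) * Y) =
        gam (y p) * b p * (X * (P p * a p * \<rho> p) + Y * a p) + gam (y p) * a p * (X * - (Q p * b p * \<rho> p) + Y * b p)"
      unfolding jac_sol[OF p] by (simp add: algebra_simps)
  next
    fix p assume p: "p \<in> upper_half"
    define r where "r = e0 * exp (- \<sigma> (y p))"
    have r: "r * \<rho> p = 1" unfolding r_def by (rule sqrtE_\<rho>)
    have "jac p * (k (snd (x p, y p)) * r\<^sup>2 * N_sol (x p, y p)) = k (y p) * r\<^sup>2 * (jac p * N_sol (x p, y p))"
      by simp
    also have "\<dots> = - 2 * k (y p) * gam (y p) * P p * Q p * a p * b p * (r * \<rho> p)\<^sup>2"
      unfolding jac_sol[OF p] by (simp add: power_mult_distrib)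
    finally show "jac p * (k (snd (x p, y p)) * (e0 * exp (- \<sigma> (snd (x p, y p))))\<^sup>2 * N_sol (x p, y p)) =
       - (2 * c * k (y p) * gam (y p) * a p * b p + gam (y p) * (k (y p) * (P p * Q p - 2 * c) * a p * b p) +
          (2 * c * k (y p) * gam (y p) * b p * a p + gam (y p) * (k (y p) * (P p * Q p - 2 * c) * a p * b p)))"
      unfolding r by (simp add: r_def algebra_simps)
  qed
  then show ?thesis unfolding init_sum .
qed

text \<open>Here \<open>\<mu> = \<gamma> Q b \<rho>\<close> and
  \<open>\<nu> = - \<gamma> P a \<rho>\<close>, that is, \<open>- \<gamma> x_t\<close> and
  \<open>- \<gamma> x_s\<close>. The factor \<open>2 c\<close> from \<open>\<gamma>\<close> minus
  twice the factor \<open>c - 1\<close> from \<open>x_st\<close> leaves \<open>2\<close>, the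
  coefficient in \<open>- 2 k M\<close>.\<close>

lemma second_codazzi:
  assumes \<phi>: "\<And>p. (\<phi> has_derivative (\<lambda>h. \<phi>x p * fst h + \<phi>y p * snd h)) (at p)"
      "continuous_on UNIV \<phi>x" "continuous_on UNIV \<phi>y"
    and supp: "\<And>X Y. - y0 \<le> Y \<Longrightarrow> R \<le> \<bar>X\<bar> \<or> 0 \<le> Y \<Longrightarrow> \<phi> (X, Y) = 0"
      "\<And>X Y. - y0 < Y \<Longrightarrow> R \<le> \<bar>X\<bar> \<or> 0 \<le> Y \<Longrightarrow> \<phi>x (X, Y) = 0 \<and> \<phi>y (X, Y) = 0"
  shows "(LINT z:UNIV \<times> {- y0<..<0}|lborel. - N_sol z * \<phi>x z + M_sol z * \<phi>y z)
      + (LINT s|lborel. g0 * (Q0 s - P0 s) / (P0 s + Q0 s) * \<phi> (s, - y0))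
    = (LINT z:UNIV \<times> {- y0<..<0}|lborel. - 2 * k (snd z) * M_sol z * \<phi> z)"
proof -
  let ?\<mu> = "\<lambda>p. gam (y p) * (- 1 * - (Q p * b p * \<rho> p))" and ?\<nu> = "\<lambda>p. gam (y p) * (- 1 * (P p * a p * \<rho> p))"
  have init_sum: "?\<mu> (s, - s) + ?\<nu> (s, - s) = g0 * (Q0 s - P0 s) / (P0 s + Q0 s)" for s
    using e0 by (simp add: init gam_def \<rho>_def \<sigma>(2) diff_divide_distrib right_diff_distrib)
  have meas: "(\<lambda>z. - N_sol z) \<in> borel_measurable borel"
    "(\<lambda>z. - 2 * k (snd z) * M_sol z) \<in> borel_measurable borel"
    using sol_measurable borel_measurable_times[OF coefficient_measurable(2) sol_measurable(2)] by simp_all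
  have "(LINT z:UNIV \<times> {- y0<..<0}|lborel. - N_sol z * \<phi>x z + M_sol z * \<phi>y z)
      + (LINT s|lborel. (?\<mu> (s, - s) + ?\<nu> (s, - s)) * \<phi> (s, - y0))
    = (LINT z:UNIV \<times> {- y0<..<0}|lborel. - 2 * k (snd z) * M_sol z * \<phi> z)"
  proof (rule weak_form[OF \<phi> supp has_ds_mult[OF gam_ds has_ds_cmult[OF Q_b_\<rho>_ds]]
        has_dt_mult[OF gam_dt has_dt_cmult[OF P_a_\<rho>_dt]] meas(1) sol_measurable(2) meas(2)])
    fix p assume p: "p \<in> upper_half"
    fix X Y
    have "jac p * (- N_sol (x p, y p) * X + M_sol (x p, y p) * Y) = - (jac p * N_sol (x p, y p)) * X + jac p * M_sol (x p, y p) * Y"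
      by (simp add: algebra_simps)
    then show "jac p * (- N_sol (x p, y p) * X + M_sol (x p, y p) * Y) =
        ?\<mu> p * (X * (P p * a p * \<rho> p) + Y * a p) + ?\<nu> p * (X * - (Q p * b p * \<rho> p) + Y * b p)"
      unfolding jac_sol[OF p] by (simp add: algebra_simps power2_eq_square)
  next
    fix p assume p: "p \<in> upper_half"
    have "jac p * (- 2 * k (snd (x p, y p)) * M_sol (x p, y p)) = - 2 * k (y p) * (jac p * M_sol (x p, y p))"
      by simp
    then show "jac p * (- 2 * k (snd (x p, y p)) * M_sol (x p, y p)) =
       - (2 * c * k (y p) * gam (y p) * a p * (- 1 * - (Q p * b p * \<rho> p)) +
          gam (y p) * (- 1 * (k (y p) * a p * b p * \<rho> p * (c - 1) * (Q p - P p))) +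
          (2 * c * k (y p) * gam (y p) * b p * (- 1 * (P p * a p * \<rho> p)) +
           gam (y p) * (- 1 * (k (y p) * a p * b p * \<rho> p * (c - 1) * (Q p - P p)))))"
      unfolding jac_sol[OF p] by (simp add: algebra_simps)
  qed
  then show ?thesis unfolding init_sum .
qed

end

section \<open>Reduction of the theorem to the characteristic solution\<close>

lemma AE_lebesgue_open_strip:
  "AE p in lebesgue. p \<in> Omega y0 \<longrightarrow> p \<in> UNIV \<times> {- y0<..<0}"
proof -
  have "negligible {p :: real \<times> real. (0, 1) \<bullet> p = r}" for r
    by (rule negligible_hyperplane) (simp add: zero_prod_def)
  then have "negligible ({p :: real \<times> real. (0, 1) \<bullet> p = 0} \<union> {p. (0, 1) \<bullet> p = - y0})"
    by (intro negligible_Un)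
  then have "AE p in lebesgue. p \<notin> {p :: real \<times> real. (0, 1) \<bullet> p = 0} \<union> {p. (0, 1) \<bullet> p = - y0}"
    by (intro AE_not_in) (simp add: negligible_iff_null_sets)
  then show ?thesis
    by eventually_elim (auto simp: Omega_def inner_prod_def)
qed

lemma integral_lebesgue_eq_lborel:
  fixes f h :: "'a::euclidean_space \<Rightarrow> real"
  assumes h: "h \<in> borel_measurable borel" and ae: "AE p in lebesgue. h p = f p"
  shows "(LINT p|lebesgue. f p) = (LINT p|lborel. h p)"
proof -
  have hl: "h \<in> borel_measurable lebesgue" using h by (simp add: measurable_completion)
  have "(LINT p|lebesgue. f p) = (LINT p|lebesgue. h p)"
    by (rule integral_cong_AE[OF borel_measurable_AE[OF hl ae] hl]) (use ae in eventually_elim, simp)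
  also have "\<dots> = (LINT p|lborel. h p)"
    by (rule integral_completion) (use h in simp)
  finally show ?thesis .
qed

lemma integral_Omega:
  fixes f h :: "real \<times> real \<Rightarrow> real"
  assumes h: "h \<in> borel_measurable borel" and eq: "\<And>p. p \<in> UNIV \<times> {- y0<..<0} \<Longrightarrow> f p = h p"
  shows "(LINT p|lebesgue_on (Omega y0). f p) = (LINT p:UNIV \<times> {- y0<..<0}|lborel. h p)"
proof -
  let ?S = "UNIV \<times> {- y0<..<0} :: (real \<times> real) set"
  have S: "?S \<in> sets borel" by (intro borel_open open_Times) auto
  have "closed (Omega y0)" unfolding Omega_def by (intro closed_Times) auto
  then have O: "Omega y0 \<inter> space lebesgue \<in> sets lebesgue" by simp
  have m: "(\<lambda>p. indicat_real ?S p *\<^sub>R h p) \<in> borel_measurable borel" using S h by simp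
  have ae: "AE p in lebesgue. indicat_real ?S p *\<^sub>R h p = indicat_real (Omega y0) p *\<^sub>R f p"
    using AE_lebesgue_open_strip[of y0]
  proof eventually_elim
    case (elim p)
    have "?S \<subseteq> Omega y0" by (auto simp: Omega_def)
    then show ?case using elim eq[of p] by (auto simp: indicator_def)
  qed
  have "(LINT p|lebesgue_on (Omega y0). f p) = (LINT p|lebesgue. indicat_real (Omega y0) p *\<^sub>R f p)"
    by (rule integral_restrict_space[OF O])
  also have "\<dots> = (LINT p|lborel. indicat_real ?S p *\<^sub>R h p)"
    by (rule integral_lebesgue_eq_lborel[OF m ae])
  finally show ?thesis by (simp add: set_lebesgue_integral_def)
qed

lemma gradient_zero_on_open:
  fixes \<phi> :: "real \<times> real \<Rightarrow> real"
  assumes "(\<phi> has_derivative (\<lambda>h. A * fst h + B * snd h)) (at p)" "open W" "p \<in> W" "\<And>q. q \<in> W \<Longrightarrow> \<phi> q = 0"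
  shows "A = 0" "B = 0"
proof -
  have "((\<lambda>_ :: real \<times> real. 0) has_derivative (\<lambda>h. A * fst h + B * snd h)) (at p)"
    by (rule has_derivative_transform_within_open[OF assms(1-3)]) (use assms(4) in auto)
  then have "(\<lambda>h :: real \<times> real. A * fst h + B * snd h) = (\<lambda>h. 0)"
    using has_derivative_unique[OF _ has_derivative_const] by blast
  from fun_cong[OF this, of "(1, 0)"] fun_cong[OF this, of "(0, 1)"] show "A = 0" "B = 0" by simp_all
qed

lemma pd_of_has_derivative:
  assumes "(\<phi> has_derivative (\<lambda>h. A * fst h + B * snd h)) (at p)"
  shows "pd_x \<phi> p = A" "pd_y \<phi> p = B"
proof -
  have "((\<lambda>s. (s, snd p)) has_derivative (\<lambda>h. (h, 0))) (at (fst p))"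
    by (auto intro!: derivative_eq_intros)
  from has_derivative_compose[OF this, of \<phi> "\<lambda>h. A * fst h + B * snd h"] assms
  have "((\<lambda>s. \<phi> (s, snd p)) has_derivative (\<lambda>h. A * h)) (at (fst p))" by simp
  then show "pd_x \<phi> p = A"
    unfolding pd_x_def by (intro DERIV_imp_deriv) (simp add: has_field_derivative_def)
  have "((\<lambda>t. (fst p, t)) has_derivative (\<lambda>h. (0, h))) (at (snd p))"
    by (auto intro!: derivative_eq_intros)
  from has_derivative_compose[OF this, of \<phi> "\<lambda>h. A * fst h + B * snd h"] assms
  have "((\<lambda>t. \<phi> (fst p, t)) has_derivative (\<lambda>h. B * h)) (at (snd p))" by simp
  then show "pd_y \<phi> p = B"
    unfolding pd_y_def by (intro DERIV_imp_deriv) (simp add: has_field_derivative_def)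
qed

text \<open>A test function may be arbitrary above the strip; it is replaced by its truncation there.\<close>

lemma test_function_truncation:
  assumes \<phi>: "test_function y0 \<phi>" and y0: "0 < y0"
  obtains \<psi> \<psi>x \<psi>y R where
    "\<And>p. (\<psi> has_derivative (\<lambda>h. \<psi>x p * fst h + \<psi>y p * snd h)) (at p)"
    "continuous_on UNIV \<psi>x" "continuous_on UNIV \<psi>y"
    "\<And>X Y. - y0 \<le> Y \<Longrightarrow> R \<le> \<bar>X\<bar> \<or> 0 \<le> Y \<Longrightarrow> \<psi> (X, Y) = 0"
    "\<And>X Y. - y0 < Y \<Longrightarrow> R \<le> \<bar>X\<bar> \<or> 0 \<le> Y \<Longrightarrow> \<psi>x (X, Y) = 0 \<and> \<psi>y (X, Y) = 0"
    "\<And>p. p \<in> UNIV \<times> {- y0..<0} \<Longrightarrow> \<phi> p = \<psi> p"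
    "\<And>p. p \<in> UNIV \<times> {- y0<..<0} \<Longrightarrow> pd_x \<phi> p = \<psi>x p \<and> pd_y \<phi> p = \<psi>y p"
proof -
  have "Ck (Suc 0) \<phi>" using \<phi> unfolding test_function_def by blast
  then obtain fx fy where "(\<forall>p. (\<phi> has_derivative (\<lambda>h. fx p * fst h + fy p * snd h)) (at p)) \<and>
      continuous_on UNIV fx \<and> continuous_on UNIV fy"
    unfolding Ck.simps by (elim exE)
  then have f: "\<And>p. (\<phi> has_derivative (\<lambda>h. fx p * fst h + fy p * snd h)) (at p)"
    "continuous_on UNIV fx" "continuous_on UNIV fy" by (simp_all del: split_paired_All)
  obtain C where C: "compact C" "C \<subseteq> UNIV \<times> {- y0..<0}" "\<And>p. p \<in> Omega y0 - C \<Longrightarrow> \<phi> p = 0"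
    using conjunct2[OF \<phi>[unfolded test_function_def]] by metis
  obtain R where R: "\<And>p. p \<in> C \<Longrightarrow> norm p \<le> R" using compact_imp_bounded[OF C(1)] unfolding bounded_iff by blast
  have "\<exists>d>0. \<forall>p\<in>C. snd p \<le> - d"
  proof (cases "C = {}")
    case False
    then obtain q where q: "q \<in> C" "\<And>p. p \<in> C \<Longrightarrow> snd p \<le> snd q"
      using continuous_attains_sup[OF C(1) False, of snd] continuous_on_snd continuous_on_id by blast
    then show ?thesis using C(2) by (intro exI[of _ "- snd q"]) auto
  qed (auto intro: exI[of _ 1])
  then obtain d0 where d0: "d0 > 0" "\<And>p. p \<in> C \<Longrightarrow> snd p \<le> - d0" by blast
  \<comment> \<open>The minimum with \<open>y0\<close> keeps the layer \<open>- d < Y < 0\<close>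
    inside the strip, where vanishing off \<open>C\<close> is known.\<close>
  define d where "d = min d0 y0"
  have d: "0 < d" "d \<le> y0" using d0(1) y0 by (simp_all add: d_def)
  have Cd: "snd p \<le> - d" if "p \<in> C" for p
    using d0(2)[OF that] by (simp add: d_def)
  have top: "\<phi> p = 0" if "- d < snd p" "snd p \<le> 0" for p
    using C(3)[of p] Cd[of p] d that by (force simp: Omega_def mem_Times_iff)
  have side: "\<phi> p = 0" if "R < \<bar>fst p\<bar>" "- y0 \<le> snd p" "snd p \<le> 0" for p
  proof -
    have "\<bar>fst p\<bar> \<le> norm p" using norm_fst_le[of "fst p" "snd p"] by simp
    then have "p \<notin> C" using R[of p] that by auto
    then show ?thesis using C(3)[of p] that by (auto simp: Omega_def mem_Times_iff)
  qed
  have op: "open {p :: real \<times> real. l < snd p \<and> snd p < u}" for l u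
    by (intro open_Collect_conj open_Collect_less continuous_intros)
  have op2: "open {p :: real \<times> real. R < \<bar>fst p\<bar> \<and> - y0 < snd p \<and> snd p < 0}"
    by (intro open_Collect_conj open_Collect_less continuous_intros)
  have top': "fx p = 0" "fy p = 0" if "- d < snd p" "snd p < 0" for p
    using gradient_zero_on_open[OF f(1) op[of "- d" 0]] top that by auto
  have side': "fx p = 0" "fy p = 0" if "R < \<bar>fst p\<bar>" "- y0 < snd p" "snd p < 0" for p
    using gradient_zero_on_open[OF f(1) op2] side that by auto
  \<comment> \<open>The cut at \<open>- d / 2\<close> falls inside the layer where \<open>h\<close>
    is zero, so no regularity is lost, and values above the strip disappear. This matters because
    the flow enters the region \<open>y > 0\<close>.\<close>
  define cut where "cut h p = (if snd p < - d / 2 then h p else 0)" for h :: "real \<times> real \<Rightarrow> real" and p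
  have cut_eq: "cut h p = h p" if "\<And>q. - d < snd q \<Longrightarrow> snd q < 0 \<Longrightarrow> h q = 0" "snd p < 0" for h p
    using that d by (auto simp: cut_def)
  have cut_zero: "cut h p = 0" if "\<And>q. - d < snd q \<Longrightarrow> snd q < 0 \<Longrightarrow> h q = 0" "- d < snd p" for h p
    using that d by (auto simp: cut_def)
  have ol: "open {p :: real \<times> real. snd p < 0}" and ou: "open {p :: real \<times> real. - d < snd p}"
    by (intro open_Collect_less continuous_intros)+
  have cover: "{p :: real \<times> real. snd p < 0} \<union> {p. - d < snd p} = UNIV" using d by auto
  have cut_cont: "continuous_on UNIV (cut h)"
    if "continuous_on UNIV h" "\<And>q. - d < snd q \<Longrightarrow> snd q < 0 \<Longrightarrow> h q = 0" for h
  proof -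
    have "continuous_on {p. snd p < 0} h" using that(1) continuous_on_subset by blast
    then have "continuous_on {p. snd p < 0} (cut h)"
      by (rule continuous_on_eq) (use cut_eq[OF that(2)] in auto)
    moreover have "continuous_on {p. - d < snd p} (cut h)"
      by (rule continuous_on_eq[OF continuous_on_const[of _ 0]]) (use cut_zero[OF that(2)] in auto)
    ultimately have "continuous_on ({p. snd p < 0} \<union> {p. - d < snd p}) (cut h)"
      by (rule continuous_on_open_Un[OF ol ou])
    then show ?thesis by (simp only: cover)
  qed
  show thesis
  proof (rule that[of "cut \<phi>" "cut fx" "cut fy" "\<bar>R\<bar> + 1"])
    show "(cut \<phi> has_derivative (\<lambda>h. cut fx p * fst h + cut fy p * snd h)) (at p)" for p
    proof (cases "snd p < 0")
      case True
      have "(cut \<phi> has_derivative (\<lambda>h. fx p * fst h + fy p * snd h)) (at p)"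
        by (rule has_derivative_transform_within_open[OF f(1) ol]) (use True cut_eq top in auto)
      then show ?thesis using cut_eq[of fx p] cut_eq[of fy p] top' True by simp
    next
      case False
      then have p: "- d < snd p" using d by simp
      have "(cut \<phi> has_derivative (\<lambda>h. 0)) (at p)"
        by (rule has_derivative_transform_within_open[OF has_derivative_const[of 0] ou]) (use p cut_zero top in auto)
      then show ?thesis using cut_zero[of fx p] cut_zero[of fy p] top' p by simp
    qed
    show "continuous_on UNIV (cut fx)" "continuous_on UNIV (cut fy)"
      using cut_cont f(2,3) top' by blast+
    show "cut \<phi> (X, Y) = 0" if "- y0 \<le> Y" "\<bar>R\<bar> + 1 \<le> \<bar>X\<bar> \<or> 0 \<le> Y" for X Y
      using side[of "(X, Y)"] d that by (auto simp: cut_def)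
    show "cut fx (X, Y) = 0 \<and> cut fy (X, Y) = 0" if "- y0 < Y" "\<bar>R\<bar> + 1 \<le> \<bar>X\<bar> \<or> 0 \<le> Y" for X Y
      using side'[of "(X, Y)"] d that by (auto simp: cut_def)
    show "\<phi> p = cut \<phi> p" if "p \<in> UNIV \<times> {- y0..<0}" for p
      using cut_eq[of \<phi> p] top that by auto
    show "pd_x \<phi> p = cut fx p \<and> pd_y \<phi> p = cut fy p" if "p \<in> UNIV \<times> {- y0<..<0}" for p
      using pd_of_has_derivative[OF f(1)] cut_eq[of fx p] cut_eq[of fy p] top' that by auto
  qed
qed

section \<open>Extension of the coefficients and Borel versions of the data\<close>

lemma bdd_lipschitz_clamp_extension:
  fixes f :: "real \<Rightarrow> real"
  assumes f: "B-lipschitz_on {l..u} f" and lu: "l \<le> u"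
  shows "bdd_lipschitz (\<lambda>y. f (clamp_to l u y))"
proof -
  have cl: "clamp_to l u y \<in> {l..u}" for y using lu by (auto simp: clamp_to_def)
  have "bounded (f ` {l..u})"
    using compact_continuous_image[OF lipschitz_on_continuous_on[OF f]] compact_imp_bounded by blast
  then obtain M where "\<And>y. y \<in> {l..u} \<Longrightarrow> \<bar>f y\<bar> \<le> M" unfolding bounded_iff by (metis imageI real_norm_def)
  then have "\<bar>f (clamp_to l u y)\<bar> \<le> M" for y using cl by blast
  moreover have "B-lipschitz_on UNIV (\<lambda>y. f (clamp_to l u y))"
  proof (rule lipschitz_onI)
    fix y z
    have "dist (f (clamp_to l u y)) (f (clamp_to l u z)) \<le> B * dist (clamp_to l u y) (clamp_to l u z)"
      by (rule lipschitz_onD[OF f cl cl])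
    also have "\<dots> \<le> B * dist y z"
      using lipschitz_on_nonneg[OF f] by (intro mult_left_mono) (auto simp: clamp_to_def dist_real_def)
    finally show "dist (f (clamp_to l u y)) (f (clamp_to l u z)) \<le> B * dist y z" .
  qed (rule lipschitz_on_nonneg[OF f])
  ultimately show ?thesis unfolding bdd_lipschitz_def by blast
qed

text \<open>The factors \<open>clamp_to 0 1\<close> cut \<open>k\<close> off outside the strip, so that \<open>\<sigma>\<close> is bounded and the
  characteristic problem has global bounds.\<close>

lemma coefficient_extension:
  fixes E E' :: "real \<Rightarrow> real"
  assumes y0: "0 < y0" and I: "{- y0..0} \<subseteq> I" and E: "C11_on I E E'"
    and E_pos: "\<And>y. y \<in> {- y0..0} \<Longrightarrow> 0 < E y" and E'_neg: "\<And>y. y \<in> {- y0..<0} \<Longrightarrow> E' y < 0"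
  obtains k \<sigma> S where "\<And>y. 0 \<le> k y" "bdd_lipschitz k"
    "\<And>y. (\<sigma> has_real_derivative k y) (at y)" "\<sigma> (- y0) = 0" "\<And>y. \<sigma> y \<le> S"
    "\<And>y. y \<in> {- y0..0} \<Longrightarrow> k y = - E' y / (2 * E y)"
    "\<And>y. y \<in> {- y0..0} \<Longrightarrow> E y = E (- y0) * exp (- 2 * \<sigma> y)"
proof -
  define J where "J = {- y0..0}"
  have J: "compact J" "convex J" "J \<subseteq> I" using I by (auto simp: J_def)
  obtain B where B: "B-lipschitz_on J E'" using E J(1,3) unfolding C11_on_def by blast
  have dE: "(E has_real_derivative E' y) (at y within J)" if "y \<in> J" for y
    using E J(3) that unfolding C11_on_def by (meson DERIV_subset subsetD)
  have cE': "continuous_on J E'" by (rule lipschitz_on_continuous_on[OF B])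
  have cE: "continuous_on J E"
    using dE DERIV_continuous continuous_on_eq_continuous_within by blast
  have E0: "E y \<noteq> 0" if "y \<in> J" for y using E_pos[of y] that by (simp add: J_def)
  \<comment> \<open>The strict sign is assumed only below \<open>0\<close>; at the endpoint the weak
    sign follows by continuity.\<close>
  have E'0: "E' 0 \<le> 0"
  proof (rule tendsto_upperbound)
    have "(E' \<longlongrightarrow> E' 0) (at 0 within J)"
      using cE' y0 by (auto simp: continuous_on_def J_def)
    then show "(E' \<longlongrightarrow> E' 0) (at_left 0)"
      using y0 by (simp add: J_def at_within_Icc_at_left)
    show "\<forall>\<^sub>F y in at_left 0. E' y \<le> 0"
      unfolding eventually_at_left_field using y0 E'_neg
      by (intro exI[of _ "- y0"]) (auto intro!: less_imp_le)
  qed simp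
  have E'np: "E' y \<le> 0" if "y \<in> J" for y
    using E'0 E'_neg[of y] that by (cases "y = 0") (auto simp: J_def)
  define h where "h y = 1 / E y" for y
  define h' where "h' y = - E' y / (E y * E y)" for y
  have dh: "(h has_real_derivative h' y) (at y within J)" if "y \<in> J" for y
    unfolding h_def h'_def using DERIV_divide[OF DERIV_const[of 1] dE[OF that] E0[OF that]] by simp
  have "continuous_on J h'" unfolding h'_def using E0 by (intro continuous_intros cE cE') auto
  then have "bounded (h' ` J)" using J(1) compact_continuous_image compact_imp_bounded by blast
  then obtain M where M: "\<And>y. y \<in> J \<Longrightarrow> \<bar>h' y\<bar> \<le> M" unfolding bounded_iff by auto
  have "M-lipschitz_on J h"
  proof (rule bounded_derivative_imp_lipschitz[OF _ J(2)])
    show "(h has_derivative (\<lambda>t. h' y * t)) (at y within J)" if "y \<in> J" for y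
      using dh[OF that] by (simp add: has_field_derivative_def)
    show "onorm (\<lambda>t. h' y * t) \<le> M" if "y \<in> J" for y
      by (rule onorm_le) (use M[OF that] in \<open>simp add: abs_mult mult_right_mono\<close>)
    show "0 \<le> M" using M[of 0] y0 by (auto simp: J_def)
  qed
  then have lh: "bdd_lipschitz (\<lambda>y. h (clamp_to (- y0) 0 y))"
    unfolding J_def by (rule bdd_lipschitz_clamp_extension) (use y0 in simp)
  have lE': "bdd_lipschitz (\<lambda>y. E' (clamp_to (- y0) 0 y))"
    using B unfolding J_def by (rule bdd_lipschitz_clamp_extension) (use y0 in simp)
  \<comment> \<open>On the strip both cutoffs equal \<open>1\<close>, so \<open>k\<close> is the
    geometric coefficient there. Outside \<open>{- y0 - 1<..<1}\<close> one of them is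
    \<open>0\<close>, which makes the integral of \<open>k\<close> finite.\<close>
  define k where "k y = (- 1 / 2) * E' (clamp_to (- y0) 0 y) * h (clamp_to (- y0) 0 y) *
    (clamp_to 0 1 (1 - y) * clamp_to 0 1 (y + y0 + 1))" for y
  have lip: "1-lipschitz_on UNIV (\<lambda>y :: real. 1 - y)" "1-lipschitz_on UNIV (\<lambda>y :: real. y + y0 + 1)"
    by (auto intro!: lipschitz_onI simp: dist_real_def)
  have kl: "bdd_lipschitz k"
    unfolding k_def by (intro bdd_lipschitz_mult bdd_lipschitz_const lE' lh
        bdd_lipschitz_compose[OF bdd_lipschitz_clamp_to lip(1)] bdd_lipschitz_compose[OF bdd_lipschitz_clamp_to lip(2)])
  have k0: "0 \<le> k y" for y
  proof -
    have c: "clamp_to (- y0) 0 y \<in> J" using y0 by (auto simp: J_def clamp_to_def)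
    have "0 \<le> (- 1 / 2) * E' (clamp_to (- y0) 0 y) * h (clamp_to (- y0) 0 y)"
      using E'np[OF c] E_pos[of "clamp_to (- y0) 0 y"] c unfolding h_def J_def by (simp add: mult_nonpos_nonneg divide_nonpos_pos)
    moreover have "0 \<le> clamp_to 0 1 (1 - y) * clamp_to 0 1 (y + y0 + 1)" by (simp add: clamp_to_def)
    ultimately show ?thesis unfolding k_def by (rule mult_nonneg_nonneg)
  qed
  have kin: "k y = - E' y / (2 * E y)" if "y \<in> J" for y
    using that by (simp add: k_def h_def J_def clamp_to_def)
  have kout: "k y = 0" if "y \<notin> {- y0 - 1<..<1}" for y
    using that by (auto simp: k_def clamp_to_def)
  have ck: "continuous_on UNIV k"
    using kl lipschitz_on_continuous_on unfolding bdd_lipschitz_def by blast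
  have low: "- y0 - 1 < 1" using y0 by simp
  obtain H where H: "\<And>z. (H has_real_derivative k z) (at z)" "\<And>z. z \<le> - y0 - 1 \<Longrightarrow> H z = 0" "\<And>z. 1 \<le> z \<Longrightarrow> (k has_integral H z) UNIV"
    using compact_support_antiderivative[OF ck kout low] by metis
  define \<sigma> where "\<sigma> y = H y - H (- y0)" for y
  have \<sigma>0: "\<sigma> (- y0) = 0" by (simp add: \<sigma>_def)
  have bot: "- y0 \<in> J" using y0 by (simp add: J_def)
  have d\<sigma>: "(\<sigma> has_real_derivative k y) (at y)" for y
    unfolding \<sigma>_def using H(1) by (auto intro!: derivative_eq_intros)
  have mono: "\<sigma> y \<le> \<sigma> z" if "y \<le> z" for y z
    using DERIV_nonneg_imp_nondecreasing[OF that, of \<sigma>] d\<sigma> k0 by blast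
  have \<sigma>S: "\<sigma> y \<le> \<sigma> 1" for y
  proof (cases "y \<le> 1")
    case False
    then have "H y = H 1" using has_integral_unique[OF H(3) H(3)] by simp
    then show ?thesis by (simp add: \<sigma>_def)
  qed (rule mono)
  \<comment> \<open>On the strip \<open>E' = - 2 k E\<close>, so the product
    \<open>E y * exp (2 * \<sigma> y)\<close> is constant.\<close>
  have Eexp: "E y = E (- y0) * exp (- 2 * \<sigma> y)" if "y \<in> J" for y
  proof -
    have "((\<lambda>y. E y * exp (2 * \<sigma> y)) has_real_derivative 0) (at z within J)" if "z \<in> J" for z
    proof -
      have "E' z = - (2 * E z * k z)" using E0[OF that] kin[OF that] by (simp add: field_simps)
      then show ?thesis
        by (auto intro!: derivative_eq_intros dE[OF that] has_field_derivative_at_within[OF d\<sigma>])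
    qed
    then obtain C where C: "\<And>z. z \<in> J \<Longrightarrow> E z * exp (2 * \<sigma> z) = C"
      using has_field_derivative_zero_constant[OF J(2), of "\<lambda>y. E y * exp (2 * \<sigma> y)"] by blast
    have "E y * exp (2 * \<sigma> y) = E (- y0)"
      using C[OF that] C[OF bot] \<sigma>0 by simp
    then have "E (- y0) * exp (- 2 * \<sigma> y) = E y * (exp (2 * \<sigma> y) * exp (- (2 * \<sigma> y)))"
      by (metis minus_mult_left mult.assoc)
    then show ?thesis by (simp only: exp_minus_inverse mult_1_right)
  qed
  show thesis
    by (rule that[OF k0 kl d\<sigma> \<sigma>0 \<sigma>S kin[unfolded J_def] Eexp[unfolded J_def]])
qed

text \<open>The data are Lebesgue measurable, whereas the characteristic problem needs Borel data
  with bounds at every point. Clamping the Borel version restores the bounds on the exceptional null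
  set and changes nothing elsewhere.\<close>

lemma bounded_borel_version:
  fixes f :: "real \<Rightarrow> real"
  assumes f: "f \<in> borel_measurable lebesgue" and b: "\<And>x. l \<le> f x \<and> f x \<le> u"
  shows "\<exists>g\<in>borel_measurable borel. (\<forall>x. l \<le> g x \<and> g x \<le> u) \<and> (AE x in lebesgue. f x = g x)"
proof -
  obtain h where h: "h \<in> borel_measurable lborel" "AE x in lborel. f x = h x"
    using completion_ex_borel_measurable_real[OF f] by blast
  have ae: "AE x in lebesgue. f x = clamp_to l u (h x)"
    using AE_completion[OF h(2)]
  proof eventually_elim
    case (elim x)
    show ?case using elim b[of x] by (simp add: clamp_to_def)
  qed
  have "(\<lambda>x. clamp_to l u (h x)) \<in> borel_measurable borel"
    using h(1) unfolding clamp_to_def by simp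
  moreover have "\<forall>x. l \<le> clamp_to l u (h x) \<and> clamp_to l u (h x) \<le> u"
    using b[of 0] by (auto simp: clamp_to_def)
  ultimately show ?thesis using ae by (intro bexI[of _ "\<lambda>x. clamp_to l u (h x)"]) simp_all
qed

theorem theorem5p2:
  fixes y0 k0 a :: real and I :: "real set"
    and E E' K \<gamma> :: "real \<Rightarrow> real"
    and u0 v0 :: "real \<Rightarrow> real"
  assumes y0: "y0 > 0"
    and I: "is_interval I" "{- y0..0} \<subseteq> I"
    and E_C11: "C11_on I E E'"
    and E_pos: "\<And>y. y \<in> {- y0..0} \<Longrightarrow> E y > 0"
    and E'_neg: "\<And>y. y \<in> {- y0..<0} \<Longrightarrow> E' y < 0"
    and k0: "k0 > 0" and a: "a \<le> - 2"
    and K: "\<And>y. y \<in> {- y0..0} \<Longrightarrow> K y = - k0 * E y powr a"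
    and K_curv: "AE p in lebesgue_on (Omega y0).
        gauss_curvature (\<lambda>p. E (snd p)) (\<lambda>_. 0) (\<lambda>_. 1) p = K (snd p)"
    and \<gamma>: "\<And>y. y \<in> {- y0..0} \<Longrightarrow> \<gamma> y > 0 \<and> K y = - (\<gamma> y)\<^sup>2"
    and meas: "u0 \<in> borel_measurable lebesgue" "v0 \<in> borel_measurable lebesgue"
    and bdd: "bounded (range (\<lambda>x. u0 x + v0 x))" "bounded (range (\<lambda>x. u0 x - v0 x))"
    and inf_pos: "(INF x. u0 x + v0 x) > 0"
    and sup_neg: "(SUP x. u0 x - v0 x) < 0"
  shows "\<exists>L M N. gauss_codazzi_weak_solution y0
           (\<lambda>p. E (snd p)) (\<lambda>_. 0) (\<lambda>_. 1) (\<lambda>p. K (snd p))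
           (\<lambda>x. L_of_uv (\<gamma> (- y0)) (u0 x) (v0 x))
           (\<lambda>x. M_of_uv (\<gamma> (- y0)) (u0 x) (v0 x)) L M N"
proof -
  define c where "c = - a / 2"
  define e0 where "e0 = sqrt (E (- y0))"
  define g0 where "g0 = \<gamma> (- y0)"
  have bot: "- y0 \<in> {- y0..0}" using y0 by simp
  have c: "1 \<le> c" using a by (simp add: c_def)
  have e0: "0 < e0" "e0\<^sup>2 = E (- y0)" using E_pos[OF bot] by (simp_all add: e0_def)
  have g0: "0 < g0" using \<gamma>[OF bot] by (simp add: g0_def)
  obtain k \<sigma> S where k: "\<And>y. 0 \<le> k y" "bdd_lipschitz k"
    and \<sigma>: "\<And>y. (\<sigma> has_real_derivative k y) (at y)" "\<sigma> (- y0) = 0" "\<And>y. \<sigma> y \<le> S"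
    and kE: "\<And>y. y \<in> {- y0..0} \<Longrightarrow> k y = - E' y / (2 * E y)"
    and \<sigma>E: "\<And>y. y \<in> {- y0..0} \<Longrightarrow> E y = E (- y0) * exp (- 2 * \<sigma> y)"
    by (rule coefficient_extension[OF y0 I(2) E_C11 E_pos E'_neg], assumption, assumption, rule that)
  \<comment> \<open>The curvature law makes the square of \<open>\<gamma>\<close> a constant
    multiple of \<open>E powr a\<close>, and thus of \<open>exp (4 * c * \<sigma> y)\<close>;
    positivity selects the root.\<close>
  have gam: "\<gamma> y = g0 * exp (2 * c * \<sigma> y)" if y: "y \<in> {- y0..0}" for y
  proof -
    have "E y powr a = E (- y0) powr a * exp (- 2 * a * \<sigma> y)"
      unfolding \<sigma>E[OF y] using E_pos[OF bot] by (simp add: powr_mult exp_powr_real mult_ac)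
    then have "K y = K (- y0) * exp (- 2 * a * \<sigma> y)" using K[OF y] K[OF bot] by simp
    then have "(\<gamma> y)\<^sup>2 = g0\<^sup>2 * exp (- 2 * a * \<sigma> y)" using \<gamma>[OF y] \<gamma>[OF bot] by (simp add: g0_def)
    also have "\<dots> = (g0 * exp (2 * c * \<sigma> y))\<^sup>2"
      by (simp add: c_def power_mult_distrib exp_of_nat_mult[symmetric])
    finally show ?thesis using \<gamma>[OF y] g0 by (simp add: power2_eq_iff_nonneg less_imp_le)
  qed
  obtain B1 where B1: "\<And>x. \<bar>u0 x + v0 x\<bar> \<le> B1" using bdd(1) unfolding bounded_iff by auto
  obtain B2 where B2: "\<And>x. \<bar>u0 x - v0 x\<bar> \<le> B2" using bdd(2) unfolding bounded_iff by auto
  define i1 where "i1 = (INF x. u0 x + v0 x)"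
  define i2 where "i2 = - (SUP x. u0 x - v0 x)"
  have i: "0 < i1" "0 < i2" using inf_pos sup_neg by (simp_all add: i1_def i2_def)
  have i1: "i1 \<le> u0 x + v0 x" for x
    unfolding i1_def using bounded_imp_bdd_below[OF bdd(1)] by (intro cINF_lower) auto
  have i2: "i2 \<le> - (u0 x - v0 x)" for x
    unfolding i2_def using cSUP_upper[OF UNIV_I bounded_imp_bdd_above[OF bdd(2)], of x] by simp
  define lo where "lo = e0 * min i1 i2"
  \<comment> \<open>The invariant square must contain the scaled data. \<open>U\<close> exceeds
    their upper bound, \<open>U \<ge> (2 * c - 1) / lo\<close> gives \<open>m \<le> lo\<close>, and
    \<open>U \<ge> 2 * c - 1 \<ge> 1\<close> gives \<open>m \<le> U\<close>.\<close>
  define U where "U = max (e0 * max B1 B2) (max ((2 * c - 1) / lo) (2 * c - 1))"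
  define m where "m = (2 * c - 1) / U"
  have lo: "0 < lo" using i e0 by (simp add: lo_def)
  have U1: "2 * c - 1 \<le> U" "1 \<le> U" "0 < U" using c by (auto simp: U_def)
  have U2: "(2 * c - 1) / lo \<le> U" "e0 * max B1 B2 \<le> U" by (simp_all add: U_def)
  have m: "0 < m" "m * U = 2 * c - 1" using c U1 by (simp_all add: m_def)
  have mU: "m \<le> U"
  proof -
    have "(2 * c - 1) * 1 \<le> U * U" using U1 c by (intro mult_mono) auto
    then show ?thesis using U1 by (simp add: m_def divide_le_eq)
  qed
  have mlo: "m \<le> lo" using U2(1) U1 lo by (simp add: m_def divide_le_eq mult.commute)
  have bnd: "m \<le> e0 * w \<and> e0 * w \<le> U" if "min i1 i2 \<le> w" "w \<le> max B1 B2" for w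
  proof -
    have "lo \<le> e0 * w" "e0 * w \<le> e0 * max B1 B2"
      using that e0 unfolding lo_def by (auto intro!: mult_left_mono)
    then show ?thesis using mlo U2 by linarith
  qed
  have m1: "(\<lambda>x. e0 * (u0 x + v0 x)) \<in> borel_measurable lebesgue" "(\<lambda>x. e0 * (- (u0 x - v0 x))) \<in> borel_measurable lebesgue"
    using meas by measurable
  have b1: "m \<le> e0 * (u0 x + v0 x) \<and> e0 * (u0 x + v0 x) \<le> U" for x
    by (rule bnd) (use min.cobounded1[of i1 i2] max.cobounded1[of B1 B2] i1[of x] B1[of x] in linarith)+
  have b2: "m \<le> e0 * (- (u0 x - v0 x)) \<and> e0 * (- (u0 x - v0 x)) \<le> U" for x
    by (rule bnd) (use min.cobounded2[of i1 i2] max.cobounded2[of B1 B2] i2[of x] B2[of x] in linarith)+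
  obtain P0 where P0: "P0 \<in> borel_measurable borel" "\<And>x. m \<le> P0 x \<and> P0 x \<le> U"
      "AE x in lebesgue. e0 * (u0 x + v0 x) = P0 x"
    using bounded_borel_version[OF m1(1) b1] by blast
  obtain Q0 where Q0: "Q0 \<in> borel_measurable borel" "\<And>x. m \<le> Q0 x \<and> Q0 x \<le> U"
      "AE x in lebesgue. e0 * (- (u0 x - v0 x)) = Q0 x"
    using bounded_borel_version[OF m1(2) b2] by blast
  have "helicoid_data c e0 g0 y0 m U S k \<sigma> P0 Q0"
    by unfold_locales (use c e0 g0 y0 m mU \<sigma> k P0 Q0 in auto)
  from helicoid_flow_exists[OF this] obtain P Q a' b y where "helicoid_flow c e0 g0 y0 m U S k \<sigma> P0 Q0 P Q a' b y" .
  then interpret flow: helicoid_flow c e0 g0 y0 m U S k \<sigma> P0 Q0 P Q a' b y .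
  let ?S = "UNIV \<times> {- y0<..<0} :: (real \<times> real) set"
  have inS: "snd p \<in> {- y0..0}" "snd p \<in> {- y0<..<0}" if "p \<in> ?S" for p
    using that by (auto simp: mem_Times_iff)
  \<comment> \<open>The Christoffel symbols use two-sided derivatives, while \<open>C11_on\<close>
    may be one-sided at the ends of \<open>I\<close>; on the open strip the two notions
    agree.\<close>
  have dE: "(E has_real_derivative E' z) (at z)" if z: "z \<in> {- y0<..<0}" for z
  proof -
    have zI: "z \<in> I" "{- y0<..<0} \<subseteq> I" using I(2) z by auto
    have "(E has_real_derivative E' z) (at z within I)" using E_C11 zI(1) by (simp add: C11_on_def)
    then have "(E has_real_derivative E' z) (at z within {- y0<..<0})" by (rule DERIV_subset[OF _ zI(2)])
    then show ?thesis using at_within_open[OF z open_greaterThanLessThan] by simp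
  qed
  have ch: "Gamma2_22 (\<lambda>p. E (snd p)) (\<lambda>_. 0) (\<lambda>_. 1) p = 0" "Gamma2_12 (\<lambda>p. E (snd p)) (\<lambda>_. 0) (\<lambda>_. 1) p = 0"
      "Gamma2_11 (\<lambda>p. E (snd p)) (\<lambda>_. 0) (\<lambda>_. 1) p = k (snd p) * (e0 * exp (- \<sigma> (snd p)))\<^sup>2"
      "Gamma1_22 (\<lambda>p. E (snd p)) (\<lambda>_. 0) (\<lambda>_. 1) p = 0" "2 * Gamma1_12 (\<lambda>p. E (snd p)) (\<lambda>_. 0) (\<lambda>_. 1) p = - 2 * k (snd p)"
      "Gamma1_11 (\<lambda>p. E (snd p)) (\<lambda>_. 0) (\<lambda>_. 1) p = 0" if p: "p \<in> ?S" for p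
  proof -
    have Ep: "0 < E (snd p)" by (rule E_pos[OF inS(1)[OF p]])
    note C = christoffel_helicoid[OF dE[OF inS(2)[OF p]] Ep, of "fst p"]
    have "(e0 * exp (- \<sigma> (snd p)))\<^sup>2 = E (snd p)"
      by (subst \<sigma>E[OF inS(1)[OF p]]) (simp add: power_mult_distrib e0(2) exp_of_nat_mult[symmetric])
    then show "Gamma2_11 (\<lambda>p. E (snd p)) (\<lambda>_. 0) (\<lambda>_. 1) p = k (snd p) * (e0 * exp (- \<sigma> (snd p)))\<^sup>2"
      using C(3) kE[OF inS(1)[OF p]] Ep by simp
    show "2 * Gamma1_12 (\<lambda>p. E (snd p)) (\<lambda>_. 0) (\<lambda>_. 1) p = - 2 * k (snd p)"
      using C(5) kE[OF inS(1)[OF p]] Ep by simp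
  qed (use christoffel_helicoid[OF dE[OF inS(2)[OF p]] E_pos[OF inS(1)[OF p]], of "fst p"] in simp_all)
  have init: "AE x in lebesgue. 2 * g0 * e0 / (P0 x + Q0 x) = L_of_uv (\<gamma> (- y0)) (u0 x) (v0 x) \<and>
      g0 * (Q0 x - P0 x) / (P0 x + Q0 x) = M_of_uv (\<gamma> (- y0)) (u0 x) (v0 x)"
    using P0(3) Q0(3)
  proof eventually_elim
    case (elim x)
    \<comment> \<open>The factor \<open>e0\<close> in the scaled invariants cancels, so the boundary
      terms of the weak form become \<open>\<gamma> / v0\<close> and
      \<open>- \<gamma> u0 / v0\<close> at the initial height.\<close>
    have "P0 x + Q0 x = 2 * e0 * v0 x" "Q0 x - P0 x = - (2 * e0 * u0 x)"
      by (simp_all only: elim[symmetric]) (simp_all add: algebra_simps)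
    then show ?case using e0(1) by (simp add: L_of_uv_def M_of_uv_def g0_def)
  qed
  obtain B where B: "\<And>z. \<bar>flow.L_sol z\<bar> \<le> B" "\<And>z. \<bar>flow.M_sol z\<bar> \<le> B" "\<And>z. \<bar>flow.N_sol z\<bar> \<le> B"
    using flow.sol_bounded by blast
  have Linf: "Linfty_on (Omega y0) f" if "f \<in> borel_measurable borel" "\<And>z. \<bar>f z\<bar> \<le> B" for f
    unfolding Linfty_on_def
  proof
    show "f \<in> borel_measurable (lebesgue_on (Omega y0))"
      using that(1) by (intro measurable_restrict_space1 measurable_completion) simp
    show "\<exists>B. AE p in lebesgue_on (Omega y0). \<bar>f p\<bar> \<le> B"
      using that(2) by (intro exI[of _ B] AE_I2)
  qed
  have "gauss_codazzi_weak_solution y0 (\<lambda>p. E (snd p)) (\<lambda>_. 0) (\<lambda>_. 1) (\<lambda>p. K (snd p))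
      (\<lambda>x. L_of_uv (\<gamma> (- y0)) (u0 x) (v0 x)) (\<lambda>x. M_of_uv (\<gamma> (- y0)) (u0 x) (v0 x))
      flow.L_sol flow.M_sol flow.N_sol"
    unfolding gauss_codazzi_weak_solution_def
  proof (intro conjI allI impI)
    show "Linfty_on (Omega y0) flow.L_sol" "Linfty_on (Omega y0) flow.M_sol" "Linfty_on (Omega y0) flow.N_sol"
      using Linf flow.sol_measurable B by blast+
    show "AE p in lebesgue_on (Omega y0). flow.L_sol p * flow.N_sol p - (flow.M_sol p)\<^sup>2 = K (snd p)"
    proof (rule AE_I2)
      fix p assume "p \<in> space (lebesgue_on (Omega y0))"
      then have p: "snd p \<in> {- y0..0}" by (auto simp: Omega_def)
      show "flow.L_sol p * flow.N_sol p - (flow.M_sol p)\<^sup>2 = K (snd p)"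
        using \<gamma>[OF p] gam[OF p] unfolding flow.gauss_equation flow.gam_def by simp
    qed
  next
    fix \<phi> assume \<phi>_test: "test_function y0 \<phi>"
    obtain \<psi> \<psi>x \<psi>y R where
      \<psi>: "\<And>p. (\<psi> has_derivative (\<lambda>h. \<psi>x p * fst h + \<psi>y p * snd h)) (at p)"
      "continuous_on UNIV \<psi>x" "continuous_on UNIV \<psi>y" and
      supp: "\<And>X Y. - y0 \<le> Y \<Longrightarrow> R \<le> \<bar>X\<bar> \<or> 0 \<le> Y \<Longrightarrow> \<psi> (X, Y) = 0"
      "\<And>X Y. - y0 < Y \<Longrightarrow> R \<le> \<bar>X\<bar> \<or> 0 \<le> Y \<Longrightarrow> \<psi>x (X, Y) = 0 \<and> \<psi>y (X, Y) = 0" and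
      \<phi>: "\<And>p. p \<in> UNIV \<times> {- y0..<0} \<Longrightarrow> \<phi> p = \<psi> p"
      "\<And>p. p \<in> ?S \<Longrightarrow> pd_x \<phi> p = \<psi>x p \<and> pd_y \<phi> p = \<psi>y p"
      by (rule test_function_truncation[OF \<phi>_test y0]) (rule that)
    have \<phi>': "\<phi> p = \<psi> p" if "p \<in> ?S" for p using \<phi>(1)[of p] that by auto
    have c\<psi>: "continuous_on UNIV \<psi>"
      using \<psi>(1) has_derivative_continuous continuous_at_imp_continuous_on by blast
    have m\<psi> [measurable]: "\<psi> \<in> borel_measurable borel" "\<psi>x \<in> borel_measurable borel" "\<psi>y \<in> borel_measurable borel"
      using c\<psi> \<psi>(2,3) borel_measurable_continuous_onI by blast+
    have "continuous_on UNIV (\<lambda>s. \<psi> (s, - y0))"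
      by (rule continuous_on_compose2[OF c\<psi>]) (auto intro!: continuous_intros)
    then have m\<psi>0 [measurable]: "(\<lambda>s. \<psi> (s, - y0)) \<in> borel_measurable borel"
      by (rule borel_measurable_continuous_onI)
    have \<phi>0: "\<phi> (s, - y0) = \<psi> (s, - y0)" for s using \<phi>(1)[of "(s, - y0)"] y0 by simp
    note [measurable] = flow.sol_measurable flow.coefficient_measurable P0(1) Q0(1)
    have 1: "(LINT p|lebesgue_on (Omega y0). - flow.M_sol p * pd_x \<phi> p + flow.L_sol p * pd_y \<phi> p) =
        (LINT z:?S|lborel. - flow.M_sol z * \<psi>x z + flow.L_sol z * \<psi>y z)"
      by (rule integral_Omega) (measurable, use \<phi>(2) in auto)
    have 2: "(LINT x|lebesgue. L_of_uv (\<gamma> (- y0)) (u0 x) (v0 x) * \<phi> (x, - y0)) =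
        (LINT s|lborel. 2 * g0 * e0 / (P0 s + Q0 s) * \<psi> (s, - y0))"
      by (rule integral_lebesgue_eq_lborel) (measurable, use init in eventually_elim, simp add: \<phi>0)
    have 3: "(LINT p|lebesgue_on (Omega y0). (Gamma2_22 (\<lambda>p. E (snd p)) (\<lambda>_. 0) (\<lambda>_. 1) p * flow.L_sol p -
          2 * Gamma2_12 (\<lambda>p. E (snd p)) (\<lambda>_. 0) (\<lambda>_. 1) p * flow.M_sol p +
          Gamma2_11 (\<lambda>p. E (snd p)) (\<lambda>_. 0) (\<lambda>_. 1) p * flow.N_sol p) * \<phi> p) =
        (LINT z:?S|lborel. k (snd z) * (e0 * exp (- \<sigma> (snd z)))\<^sup>2 * flow.N_sol z * \<psi> z)"
      by (rule integral_Omega) (measurable, simp only: ch \<phi>', simp)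
    show "(LINT p|lebesgue_on (Omega y0). - flow.M_sol p * pd_x \<phi> p + flow.L_sol p * pd_y \<phi> p)
          + (LINT x|lebesgue. L_of_uv (\<gamma> (- y0)) (u0 x) (v0 x) * \<phi> (x, - y0))
        = (LINT p|lebesgue_on (Omega y0). (Gamma2_22 (\<lambda>p. E (snd p)) (\<lambda>_. 0) (\<lambda>_. 1) p * flow.L_sol p -
          2 * Gamma2_12 (\<lambda>p. E (snd p)) (\<lambda>_. 0) (\<lambda>_. 1) p * flow.M_sol p +
          Gamma2_11 (\<lambda>p. E (snd p)) (\<lambda>_. 0) (\<lambda>_. 1) p * flow.N_sol p) * \<phi> p)"
      unfolding 1 2 3 by (rule flow.first_codazzi[OF \<psi> supp])
    have 4: "(LINT p|lebesgue_on (Omega y0). - flow.N_sol p * pd_x \<phi> p + flow.M_sol p * pd_y \<phi> p) =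
        (LINT z:?S|lborel. - flow.N_sol z * \<psi>x z + flow.M_sol z * \<psi>y z)"
      by (rule integral_Omega) (measurable, use \<phi>(2) in auto)
    have 5: "(LINT x|lebesgue. M_of_uv (\<gamma> (- y0)) (u0 x) (v0 x) * \<phi> (x, - y0)) =
        (LINT s|lborel. g0 * (Q0 s - P0 s) / (P0 s + Q0 s) * \<psi> (s, - y0))"
      by (rule integral_lebesgue_eq_lborel) (measurable, use init in eventually_elim, simp add: \<phi>0)
    have 6: "(LINT p|lebesgue_on (Omega y0). (- Gamma1_22 (\<lambda>p. E (snd p)) (\<lambda>_. 0) (\<lambda>_. 1) p * flow.L_sol p +
          2 * Gamma1_12 (\<lambda>p. E (snd p)) (\<lambda>_. 0) (\<lambda>_. 1) p * flow.M_sol p -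
          Gamma1_11 (\<lambda>p. E (snd p)) (\<lambda>_. 0) (\<lambda>_. 1) p * flow.N_sol p) * \<phi> p) =
        (LINT z:?S|lborel. - 2 * k (snd z) * flow.M_sol z * \<psi> z)"
      by (rule integral_Omega) (measurable, simp only: ch \<phi>', simp)
    show "(LINT p|lebesgue_on (Omega y0). - flow.N_sol p * pd_x \<phi> p + flow.M_sol p * pd_y \<phi> p)
          + (LINT x|lebesgue. M_of_uv (\<gamma> (- y0)) (u0 x) (v0 x) * \<phi> (x, - y0))
        = (LINT p|lebesgue_on (Omega y0). (- Gamma1_22 (\<lambda>p. E (snd p)) (\<lambda>_. 0) (\<lambda>_. 1) p * flow.L_sol p +
          2 * Gamma1_12 (\<lambda>p. E (snd p)) (\<lambda>_. 0) (\<lambda>_. 1) p * flow.M_sol p -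
          Gamma1_11 (\<lambda>p. E (snd p)) (\<lambda>_. 0) (\<lambda>_. 1) p * flow.N_sol p) * \<phi> p)"
      unfolding 4 5 6 by (rule flow.second_codazzi[OF \<psi> supp])
  qed
  then show ?thesis by blast
qed

end
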